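(* Let $n\ge 2$, let $R$ be a commutative domain with an invertible element $\hat q$ such that $\hat q^2$ is a primitive $m''$-th root of unity, let $d'=\gcd(n,m'')$ and $m'=m''/d'$. Let $\Sigma$ be a triangulable essentially bordered pb surface without interior punctures and let $\lambda$ be an ideal triangulation of $\Sigma$. If $m''$ is odd, then the center of the quantum torus $\mathcal A_{\hat q}(\Sigma,\lambda)$ is the $R$-subalgebra generated by the following elements: (i) the elements $a^{\mathbf k}$ with $\mathbf k\in\Lambda_{m'}=\{\mathbf k\in\mathbb Z^{V'_\lambda}\mid \mathbf k\,\mathsf K_\lambda\equiv \mathbf 0 \bmod m'\}$ (with $\mathbf k$ regarded as a row vector); (ii) for every boundary component $\partial$ of $\overline\Sigma$ containing an even number $r$ of punctures, with boundary edges of $\Sigma$ on $\partial$ labeled consecutively $e_1,\dots,e_r$ along the positive orientation of $\partial$, and for all $1\le i\le n-1$ and $0\le k\le m'$, the elements $$ (a_{u_i^{e_1}})^{k}(a_{u_i^{e_2}})^{m'-k}\cdots (a_{u_i^{e_{r-1}}})^{k}(a_{u_i^{e_r}})^{m'-k},$$ where $u_i^{e}\in V'_\lambda$ denotes the small vertex with coordinates $(i,0,n-i)$ in the triangle attached to the boundary edge $e$.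
   Context: **Surfaces.** A pb surface $\Sigma$ is obtained from a compact oriented surface $\overline\Sigma$ by removing finitely many points (punctures) so that each connected component of $\partial\Sigma$ (a boundary edge) is diffeomorphic to an open interval. Punctures in the interior of $\overline\Sigma$ are interior punctures. $\Sigma$ is essentially bordered if each connected component has non-empty boundary. The positive orientation of $\partial\Sigma$ is the one induced by $\Sigma$ (surface on the left). An ideal arc is an embedding $(0,1)\to\Sigma$ extending to an immersion $[0,1]\to\overline\Sigma$ with endpoints at punctures; it is trivial if null-homotopic. $\Sigma$ is triangulable if each component has at least one puncture and is not the once- or twice-punctured sphere, the monogon or the bigon. An ideal triangulation $\lambda$ is a maximal collection of pairwise disjoint, pairwise non-isotopic, non-trivial ideal arcs (up to isotopy); cutting $\Sigma$ along the arcs not isotopic to boundary edges gives ideal triangles, the faces of $\lambda$. **Quantum torus.** For an anti-symmetric integer matrix $P$ indexed by a finite set $I$, $\mathbb T(P)=R\langle x_i^{\pm1}, i\in I\rangle/(x_ix_j=\hat q^{2P(i,j)}x_jx_i)$, and for $\mathbf k\in\mathbb Z^I$, $x^{\mathbf k}=\hat q^{-\sum_{i<j}\mathbf k(i)\mathbf k(j)P(i,j)}\prod_i x_i^{\mathbf k(i)}$ (product in a fixed total order of $I$; the result is independent of the order). **Small vertices.** Let $\mathbb P_3$ be an ideal triangle with ideal vertices $v_1=(n,0,0)$, $v_2=(0,n,0)$, $v_3=(0,0,n)$ placed in clockwise order, and edges $e_1=v_1v_2$, $e_2=v_2v_3$, $e_3=v_3v_1$. Its small vertices are $\overline V=\{(i,j,k)\in\mathbb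 Z_{\ge0}^3: i+j+k=n\}\setminus\{v_1,v_2,v_3\}$. There is an arrow from $v$ to $v'$ in $\overline V$ if $v'-v\in\{(0,1,-1),(1,-1,0),(-1,0,1)\}$, of weight $1$ if $v,v'$ lie on a common edge of $\mathbb P_3$ and $2$ otherwise. $\overline{\mathsf Q}_{\mathbb P_3}(v,v')=w$ (resp. $-w$) if there is an arrow of weight $w$ from $v$ to $v'$ (resp. from $v'$ to $v$), and $0$ otherwise. For a triangulation $\lambda$, identify each face $\tau$ with $\mathbb P_3$ (orientation-preservingly); $\overline V_\lambda$ is the union of the sets of small vertices of all faces, small vertices on glued edges being identified, and $\overline{\mathsf Q}_\lambda$ is the sum over faces $\tau$ of $\overline{\mathsf Q}_{\mathbb P_3}$ transported to $\tau$ and extended by zero. **Extended surface.** Attach a copy of $\mathbb P_3$ along its edge $e_1$ to every boundary edge of $\Sigma$, giving $\Sigma^*$ with triangulation $\lambda^*$ extending $\lambda$. $V_\lambda\subset\overline V_{\lambda^*}$ (resp. $V'_\lambda\subset\overline V_{\lambda^*}$) is the set of small vertices not on the edges $e_3$ (resp. not on the edges $e_2$) of the attached triangles. $\mathsf Q_\lambda$ is the restriction of $\overline{\mathsf Q}_{\lambda^*}$ to $V_\lambda\times V_\lambda$. **The matrix $\overline{\mathsf K}_\lambda$** (for a triangulation $\lambda$ of a surface without interior punctures). $\overline{\mathsf K}_{\mathbb P_3}:\overline V\times\overline V\to\mathbb Z$ is the function invariant under simultaneous cyclic permutation of the coordinates of both arguments such that $\overline{\mathsf K}_{\mathbb P_3}(ijk,i'j'k')=jk'+ki'+i'j$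 whenever $i'\le i$ and $j'\ge j$. For $u\in\overline V_\lambda$ lying in a face $\nu$ with coordinates $(i,j,k)$, let $\widetilde Y_u$ be the weighted graph consisting of the tripod $Y_u$ in $\nu$ with three outgoing edges from $u$, of weights $i,j,k$, ending on $e_1,e_2,e_3$ of $\nu$ respectively (edges of weight $0$ are discarded), each edge being elongated past $\partial\nu$ by turning left in each face it enters, until it reaches the boundary of the surface. The part of $\widetilde Y_u$ in faces consists of the main segment $s=Y_u$, with $Y(s)=u$, and of arc segments $s$: for an arc segment of weight $k$ in a face $\tau$ entering through one edge and leaving (after turning left) through another, $Y(s)$ is the small vertex of $\tau$ whose coordinate corresponding to the exit edge is $k$, to the entry edge is $n-k$, and to the third edge is $0$ (coordinates 1,2,3 correspond to $e_1,e_2,e_3$). Then $\overline{\mathsf K}_\lambda(u,v)=\sum_{s\subset\tau\cap\widetilde Y_u}\overline{\mathsf K}_{\mathbb P_3}(Y(s),v)$ for any face $\tau$ containing $v$ (well defined). **The matrix $\mathsf K_\lambda$.** For $v=(i,j,k)$ in an attached triangle with $k\neq0$ put $p(v)=(0,n-k,k)$ in the same triangle. Let $\mathsf C: V'_\lambda\times\overline V_{\lambda^*}\to\mathbb Z$ have entries $\mathsf C(v,v)=1$ for $v\in V'_\lambda$, $\mathsf C(v,p(v))=-1$ for $v\in V'_\lambda\setminus\overline V_\lambda$, and $0$ otherwise. $\mathsf K_\lambda$ is the restriction of $\mathsf C\,\overline{\mathsf K}_{\lambda^*}$ to $V'_\lambda\times V_\lambda$. Put $\mathsf P_\lambda=\mathsf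 K_\lambda\mathsf Q_\lambda\mathsf K_\lambda^{T}$ (anti-symmetric) and $\mathcal A_{\hat q}(\Sigma,\lambda)=\mathbb T(\mathsf P_\lambda)$, with generators $a_v$ ($v\in V'_\lambda$) and normalized monomials $a^{\mathbf k}$ ($\mathbf k\in\mathbb Z^{V'_\lambda}$). *)

theory Defs
  imports
    "HOL-Algebra.QuotRing"
    "HOL-Algebra.Generated_Rings"
    "HOL-Library.Poly_Mapping"
    "HOL-Library.Numeral_Type"
    "HOL-Number_Theory.Cong"
begin

section \<open>Triangulated surfaces\<close>

text \<open>
  A surface with an ideal triangulation is given by its faces and their gluing. The index type
  \<^typ>\<open>3\<close> consists of the residues 1, 2, 3 (with 3 = 0), so that adding 1 is the cyclic shift.
  Every face is an oriented ideal triangle with ideal vertices \<open>v\<^sub>1, v\<^sub>2, v\<^sub>3\<close> in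
  clockwise order, and its \<open>c\<close>-th edge \<open>e\<^sub>c\<close> joins \<open>v\<^sub>c\<close> to \<open>v\<^sub>c\<^sub>+\<^sub>1\<close>; this is the
  chosen identification of the face with the model triangle. The pair \<open>(f, c)\<close> stands for the
  edge \<open>e\<^sub>c\<close> of \<open>f\<close>, or for the corner of \<open>f\<close> at \<open>v\<^sub>c\<close>, according to context.

  If \<open>(f, c)\<close> is glued to \<open>(g, d)\<close>, the two edges are identified in the only way compatible with
  the orientations: \<open>v\<^sub>c\<close> of \<open>f\<close> goes to \<open>v\<^sub>d\<^sub>+\<^sub>1\<close> of \<open>g\<close>, and \<open>v\<^sub>c\<^sub>+\<^sub>1\<close> of \<open>f\<close> goes to \<open>v\<^sub>d\<close> of \<open>g\<close>.
  An edge glued to nothing is a boundary edge. The surface is the result of gluing the triangles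
  with their ideal vertices removed; its compactification by the ideal vertices is the compact
  surface, and the images of the ideal vertices are the punctures. Disconnected surfaces are
  allowed.
\<close>

record 'f triangulation =
  faces :: "'f set"
  glue :: "'f \<times> 3 \<Rightarrow> ('f \<times> 3) option"

definition ideal_triangulation :: "'f triangulation \<Rightarrow> bool" where
  "ideal_triangulation T \<longleftrightarrow>
     finite (faces T) \<and>
     (\<forall>x y. glue T x = Some y \<longrightarrow>
        fst x \<in> faces T \<and> fst y \<in> faces T \<and> x \<noteq> y \<and> glue T y = Some x)"

definition boundary_edges :: "'f triangulation \<Rightarrow> ('f \<times> 3) set" where
  "boundary_edges T = {(f, c). f \<in> faces T \<and> glue T (f, c) = None}"

definition face_adj :: "'f triangulation \<Rightarrow> ('f \<times> 'f) set" where
  "face_adj T = {(f, g). \<exists>c d. glue T (f, c) = Some (g, d)}"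

text \<open>The connected components of the surface are the classes of faces under the reflexive
  transitive closure of \<^const>\<open>face_adj\<close>.\<close>

definition essentially_bordered :: "'f triangulation \<Rightarrow> bool" where
  "essentially_bordered T \<longleftrightarrow>
     (\<forall>C \<in> faces T // (face_adj T)\<^sup>*. \<exists>f\<in>C. \<exists>c. (f, c) \<in> boundary_edges T)"

definition corner_glue :: "'f triangulation \<Rightarrow> (('f \<times> 3) \<times> ('f \<times> 3)) set" where
  "corner_glue T =
     {((f, c), (g, d + 1)) | f c g d. glue T (f, c) = Some (g, d)} \<union>
     {((f, c + 1), (g, d)) | f c g d. glue T (f, c) = Some (g, d)}"

definition punctures :: "'f triangulation \<Rightarrow> ('f \<times> 3) set set" where
  "punctures T = (faces T \<times> UNIV) // (corner_glue T)\<^sup>*"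

text \<open>A puncture lies on the boundary of the compact surface iff it is an end of a boundary edge.
  The edges of a face ending at \<open>v\<^sub>c\<close> are \<open>e\<^sub>c\<close> and \<open>e\<^sub>c\<^sub>+\<^sub>2\<close>.\<close>

definition interior_puncture :: "'f triangulation \<Rightarrow> ('f \<times> 3) set \<Rightarrow> bool" where
  "interior_puncture T P \<longleftrightarrow>
     P \<in> punctures T \<and>
     (\<forall>(f, c) \<in> P. (f, c) \<notin> boundary_edges T \<and> (f, c + 2) \<notin> boundary_edges T)"

text \<open>With the surface on the left, a boundary edge \<open>(f, c)\<close> runs from \<open>v\<^sub>c\<^sub>+\<^sub>1\<close> to \<open>v\<^sub>c\<close>. The next
  boundary edge begins at the puncture where this one ends.\<close>

definition next_boundary_edge :: "'f triangulation \<Rightarrow> 'f \<times> 3 \<Rightarrow> 'f \<times> 3 \<Rightarrow> bool" where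
  "next_boundary_edge T x y \<longleftrightarrow>
     x \<in> boundary_edges T \<and> y \<in> boundary_edges T \<and>
     (x, (fst y, snd y + 1)) \<in> (corner_glue T)\<^sup>*"

text \<open>\<open>es\<close> lists the boundary edges on one boundary component of the compact surface,
  consecutively along the positive orientation. As the component is a circle, it has
  \<^term>\<open>length es\<close> punctures.\<close>

definition boundary_component :: "'f triangulation \<Rightarrow> ('f \<times> 3) list \<Rightarrow> bool" where
  "boundary_component T es \<longleftrightarrow>
     es \<noteq> [] \<and> distinct es \<and>
     (\<forall>j < length es. next_boundary_edge T (es ! j) (es ! (Suc j mod length es)))"


section \<open>Small vertices\<close>

type_synonym coords = "3 \<Rightarrow> int"

definition pt :: "int \<Rightarrow> int \<Rightarrow> int \<Rightarrow> coords" where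
  "pt i j k = (\<lambda>c. if c = 1 then i else if c = 2 then j else k)"

definition small_vertices :: "nat \<Rightarrow> coords set" where
  "small_vertices n =
     {pt i j k | i j k. 0 \<le> i \<and> 0 \<le> j \<and> 0 \<le> k \<and> i + j + k = int n} -
     {pt (int n) 0 0, pt 0 (int n) 0, pt 0 0 (int n)}"

definition on_edge :: "coords \<Rightarrow> 3 \<Rightarrow> bool" where
  "on_edge p c \<longleftrightarrow> p (c + 2) = 0"

definition arrow :: "coords \<Rightarrow> coords \<Rightarrow> bool" where
  "arrow p p' \<longleftrightarrow> (\<lambda>c. p' c - p c) \<in> {pt 0 1 (-1), pt 1 (-1) 0, pt (-1) 0 1}"

definition arrow_weight :: "coords \<Rightarrow> coords \<Rightarrow> int" where
  "arrow_weight p p' = (if \<exists>c. on_edge p c \<and> on_edge p' c then 1 else 2)"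

definition Qbar_P3 :: "coords \<Rightarrow> coords \<Rightarrow> int" where
  "Qbar_P3 p p' =
     (if arrow p p' then arrow_weight p p'
      else if arrow p' p then - arrow_weight p p'
      else 0)"

text \<open>A small vertex of a triangulation is the set of its occurrences \<open>(f, p)\<close>: a face together
  with coordinates in that face.\<close>

definition vertex_glue :: "'f triangulation \<Rightarrow> (('f \<times> coords) \<times> ('f \<times> coords)) set" where
  "vertex_glue T =
     {((f, p), (g, q)) | f p g q. \<exists>c d. glue T (f, c) = Some (g, d) \<and>
        on_edge p c \<and> on_edge q d \<and> q (d + 1) = p c \<and> q d = p (c + 1)}"

definition Vbar :: "nat \<Rightarrow> 'f triangulation \<Rightarrow> ('f \<times> coords) set set" where
  "Vbar n T = (faces T \<times> small_vertices n) // (vertex_glue T)\<^sup>*"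

definition Qbar :: "('f \<times> coords) set \<Rightarrow> ('f \<times> coords) set \<Rightarrow> int" where
  "Qbar u v = (\<Sum>x\<in>u. \<Sum>y\<in>v. if fst x = fst y then Qbar_P3 (snd x) (snd y) else 0)"


section \<open>The matrix \<open>K\<close> bar\<close>

text \<open>The value does not depend on the choice of \<open>c\<close>, see the lemma below; \<open>c = 1\<close> is the defining
  formula, and the other two values of \<open>c\<close> are its cyclic permutations.\<close>

definition Kbar_P3 :: "coords \<Rightarrow> coords \<Rightarrow> int" where
  "Kbar_P3 p p' =
     (let c = (SOME c. p' c \<le> p c \<and> p (c + 1) \<le> p' (c + 1))
      in p (c + 1) * p' (c + 2) + p (c + 2) * p' c + p' c * p (c + 1))"

lemma three_cases: "(c::3) = 1 \<or> c = 2 \<or> c = 3"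
proof (cases c)
  case (of_int z)
  then have "z = 0 \<or> z = 1 \<or> z = 2" by auto
  with of_int show ?thesis by auto
qed

lemma Kbar_P3_eq:
  assumes sum: "p 1 + p 2 + p 3 = p' 1 + p' 2 + p' 3"
    and c: "p' c \<le> p c" "p (c + 1) \<le> p' (c + 1)"
  shows "Kbar_P3 p p' = p (c + 1) * p' (c + 2) + p (c + 2) * p' c + p' c * p (c + 1)"
proof -
  let ?F = "\<lambda>c. p (c + 1) * p' (c + 2) + p (c + 2) * p' c + p' c * p (c + 1)"
  define d where "d = (SOME c. p' c \<le> p c \<and> p (c + 1) \<le> p' (c + 1))"
  have d: "p' d \<le> p d" "p (d + 1) \<le> p' (d + 1)"
    using someI[of "\<lambda>c. p' c \<le> p c \<and> p (c + 1) \<le> p' (c + 1)" c] c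
    unfolding d_def by auto
  have step: "?F e = ?F (e + 1)"
    if "p' e \<le> p e" "p (e + 1) \<le> p' (e + 1)" "p' (e + 1) \<le> p (e + 1)" for e
  proof -
    have *: "e + 1 + 1 = e + 2" "e + 1 + 2 = e" by simp_all
    have s: "p e + p (e + 1) + p (e + 2) = p' e + p' (e + 1) + p' (e + 2)"
    proof -
      have "p 4 = p 1" "p' 4 = p' 1" "p 5 = p 2" "p' 5 = p' 2"
        by (auto intro: arg_cong[of _ _ p] arg_cong[of _ _ p'])
      then show ?thesis using three_cases[of e] sum by auto
    qed
    have eq: "p (e + 1) = p' (e + 1)" using that by simp
    have p': "p' (e + 2) = p e + p (e + 2) - p' e" using s eq by simp
    show ?thesis unfolding * eq[symmetric] p' by (simp add: ring_distribs mult.commute)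
  qed
  have "d = c \<or> d = c + 1 \<or> c = d + 1"
    using three_cases[of c] three_cases[of d] by auto
  then have "?F d = ?F c"
    using step[of c] step[of d] c d by auto
  then show ?thesis by (simp add: Kbar_P3_def d_def[symmetric] Let_def)
qed

text \<open>\<open>(x, y)\<close> is in \<open>left_turn\<close> iff a path leaving a face through the edge \<open>x\<close> enters
  the next face and, turning left, leaves it through \<open>y\<close>. Seen from \<open>e\<^sub>d\<close>, the edge on the left
  is the next one clockwise.\<close>

definition left_turn :: "'f triangulation \<Rightarrow> (('f \<times> 3) \<times> ('f \<times> 3)) set" where
  "left_turn T = {(x, (g, d + 1)) | x g d. glue T x = Some (g, d)}"

text \<open>The vertex of an arc segment of weight \<open>k\<close> leaving through \<open>e\<close> (and entering through
  \<open>e + 2\<close>, which is \<open>e - 1\<close>).\<close>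

definition arc_vertex :: "nat \<Rightarrow> int \<Rightarrow> 3 \<Rightarrow> coords" where
  "arc_vertex n k e = (\<lambda>c. if c = e then k else if c = e + 2 then int n - k else 0)"

text \<open>The first argument is an occurrence \<open>(f, p)\<close> of \<open>u\<close>, the second an occurrence \<open>(t, p')\<close> of
  \<open>v\<close>. The leg through \<open>e\<^sub>c\<close> of \<open>f\<close> has weight \<open>p c\<close>. Each exit edge strictly after \<open>(f, c)\<close> on its
  elongation gives one arc segment; without interior punctures the elongation never returns to
  the same edge.\<close>

definition Kbar_occ :: "nat \<Rightarrow> 'f triangulation \<Rightarrow> 'f \<times> coords \<Rightarrow> 'f \<times> coords \<Rightarrow> int" where
  "Kbar_occ n T = (\<lambda>(f, p) (t, p').
     (if f = t then Kbar_P3 p p' else 0) +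
     (\<Sum>c | p c \<noteq> 0. \<Sum>e | ((f, c), (t, e)) \<in> (left_turn T)\<^sup>+. Kbar_P3 (arc_vertex n (p c) e) p'))"

definition Kbar ::
  "nat \<Rightarrow> 'f triangulation \<Rightarrow> ('f \<times> coords) set \<Rightarrow> ('f \<times> coords) set \<Rightarrow> int" where
  "Kbar n T u v = Kbar_occ n T (SOME x. x \<in> u) (SOME y. y \<in> v)"


section \<open>The extended surface\<close>

text \<open>The face \<^term>\<open>Inr x\<close> is the triangle attached along its first edge to the boundary
  edge \<open>x\<close>.\<close>

definition extended :: "'f triangulation \<Rightarrow> ('f + 'f \<times> 3) triangulation" where
  "extended T =
     \<lparr>faces = Inl ` faces T \<union> Inr ` boundary_edges T,
      glue = (\<lambda>(t, c). case t of
          Inl f \<Rightarrow>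
            (if (f, c) \<in> boundary_edges T then Some (Inr (f, c), 1)
             else map_option (\<lambda>(g, d). (Inl g, d)) (glue T (f, c)))
        | Inr x \<Rightarrow>
            (if x \<in> boundary_edges T \<and> c = 1 then Some (Inl (fst x), snd x) else None))\<rparr>"

type_synonym 'f ext_vertex = "(('f + 'f \<times> 3) \<times> coords) set"

definition V_ext :: "nat \<Rightarrow> 'f triangulation \<Rightarrow> 'f ext_vertex set" where
  "V_ext n T = {v \<in> Vbar n (extended T). \<forall>x p. (Inr x, p) \<in> v \<longrightarrow> \<not> on_edge p 3}"

definition V'_ext :: "nat \<Rightarrow> 'f triangulation \<Rightarrow> 'f ext_vertex set" where
  "V'_ext n T = {v \<in> Vbar n (extended T). \<forall>x p. (Inr x, p) \<in> v \<longrightarrow> \<not> on_edge p 2}"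

definition in_original :: "'f ext_vertex \<Rightarrow> bool" where
  "in_original v \<longleftrightarrow> (\<exists>f p. (Inl f, p) \<in> v)"

text \<open>\<open>w\<close> is the vertex \<open>(0, n - k, k)\<close> in the attached triangle where \<open>v\<close> is \<open>(i, j, k)\<close>.\<close>

definition is_proj :: "nat \<Rightarrow> 'f ext_vertex \<Rightarrow> 'f ext_vertex \<Rightarrow> bool" where
  "is_proj n v w \<longleftrightarrow>
     (\<exists>x p. (Inr x, p) \<in> v \<and> p 3 \<noteq> 0 \<and> (Inr x, pt 0 (int n - p 3) (p 3)) \<in> w)"

definition C_mat :: "nat \<Rightarrow> 'f ext_vertex \<Rightarrow> 'f ext_vertex \<Rightarrow> int" where
  "C_mat n v w =
     (if v = w then 1
      else if \<not> in_original v \<and> is_proj n v w then -1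
      else 0)"

definition K_mat :: "nat \<Rightarrow> 'f triangulation \<Rightarrow> 'f ext_vertex \<Rightarrow> 'f ext_vertex \<Rightarrow> int" where
  "K_mat n T v w = (\<Sum>u \<in> Vbar n (extended T). C_mat n v u * Kbar n (extended T) u w)"

definition P_mat :: "nat \<Rightarrow> 'f triangulation \<Rightarrow> 'f ext_vertex \<Rightarrow> 'f ext_vertex \<Rightarrow> int" where
  "P_mat n T v w =
     (\<Sum>x \<in> V_ext n T. \<Sum>y \<in> V_ext n T. K_mat n T v x * Qbar x y * K_mat n T w y)"

definition attached_vertex :: "nat \<Rightarrow> 'f triangulation \<Rightarrow> nat \<Rightarrow> 'f \<times> 3 \<Rightarrow> 'f ext_vertex" where
  "attached_vertex n T i x =
     (vertex_glue (extended T))\<^sup>* `` {(Inr x, pt (int i) 0 (int n - int i))}"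


section \<open>Quantum tori\<close>

datatype 'g free_word = Word (letters: "'g list")

instantiation free_word :: (type) monoid_add
begin

definition "0 = Word []"

definition "u + v = Word (letters u @ letters v)"

instance
  by standard (simp_all add: zero_free_word_def plus_free_word_def)

end

text \<open>Finitely supported functions on words, with convolution as product.\<close>

definition free_algebra :: "'g set \<Rightarrow> ('g free_word \<Rightarrow>\<^sub>0 'r::comm_ring_1) ring" where
  "free_algebra G =
     \<lparr>carrier = {a. \<forall>w \<in> Poly_Mapping.keys a. set (letters w) \<subseteq> G},
      monoid.mult = (*), one = 1, zero = 0, add = (+)\<rparr>"

datatype 'i laurent_gen = Gen 'i | Gen_inv 'i

definition letter :: "'g \<Rightarrow> 'g free_word \<Rightarrow>\<^sub>0 'r::comm_ring_1" where
  "letter g = Poly_Mapping.single (Word [g]) 1"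

definition scalar :: "'r \<Rightarrow> 'g free_word \<Rightarrow>\<^sub>0 'r::comm_ring_1" where
  "scalar r = Poly_Mapping.single 0 r"

definition unit_powi :: "'r::idom \<Rightarrow> int \<Rightarrow> 'r" where
  "unit_powi q k = (if 0 \<le> k then q ^ nat k else (THE r. q * r = 1) ^ nat (- k))"

definition qt_free :: "'i set \<Rightarrow> ('i laurent_gen free_word \<Rightarrow>\<^sub>0 'r::idom) ring" where
  "qt_free I = free_algebra (Gen ` I \<union> Gen_inv ` I)"

definition qt_relators ::
  "'r \<Rightarrow> 'i set \<Rightarrow> ('i \<Rightarrow> 'i \<Rightarrow> int) \<Rightarrow> ('i laurent_gen free_word \<Rightarrow>\<^sub>0 'r::idom) set" where
  "qt_relators q I P =
     {letter (Gen i) * letter (Gen_inv i) - 1 | i. i \<in> I} \<union>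
     {letter (Gen_inv i) * letter (Gen i) - 1 | i. i \<in> I} \<union>
     {letter (Gen i) * letter (Gen j)
        - scalar (unit_powi q (2 * P i j)) * (letter (Gen j) * letter (Gen i)) | i j. i \<in> I \<and> j \<in> I}"

definition qt_ideal ::
  "'r \<Rightarrow> 'i set \<Rightarrow> ('i \<Rightarrow> 'i \<Rightarrow> int) \<Rightarrow> ('i laurent_gen free_word \<Rightarrow>\<^sub>0 'r::idom) set" where
  "qt_ideal q I P = Idl\<^bsub>qt_free I\<^esub> (qt_relators q I P)"

definition quantum_torus ::
  "'r \<Rightarrow> 'i set \<Rightarrow> ('i \<Rightarrow> 'i \<Rightarrow> int) \<Rightarrow> ('i laurent_gen free_word \<Rightarrow>\<^sub>0 'r::idom) set ring" where
  "quantum_torus q I P = qt_free I Quot qt_ideal q I P"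

definition qt_gen ::
  "'r \<Rightarrow> 'i set \<Rightarrow> ('i \<Rightarrow> 'i \<Rightarrow> int) \<Rightarrow> 'i \<Rightarrow> ('i laurent_gen free_word \<Rightarrow>\<^sub>0 'r::idom) set" where
  "qt_gen q I P i = qt_ideal q I P +>\<^bsub>qt_free I\<^esub> letter (Gen i)"

definition qt_scalar ::
  "'r \<Rightarrow> 'i set \<Rightarrow> ('i \<Rightarrow> 'i \<Rightarrow> int) \<Rightarrow> 'r \<Rightarrow> ('i laurent_gen free_word \<Rightarrow>\<^sub>0 'r::idom) set" where
  "qt_scalar q I P r = qt_ideal q I P +>\<^bsub>qt_free I\<^esub> scalar r"

definition list_prod :: "('a, 'b) monoid_scheme \<Rightarrow> 'a list \<Rightarrow> 'a" where
  "list_prod M xs = foldr (\<otimes>\<^bsub>M\<^esub>) xs \<one>\<^bsub>M\<^esub>"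

text \<open>The normalized monomial; the list \<open>vs\<close> enumerates the index set in the chosen order.\<close>

definition qt_monomial ::
  "'r \<Rightarrow> 'i list \<Rightarrow> ('i \<Rightarrow> 'i \<Rightarrow> int) \<Rightarrow> ('i \<Rightarrow> int) \<Rightarrow> ('i laurent_gen free_word \<Rightarrow>\<^sub>0 'r::idom) set"
  where
  "qt_monomial q vs P k =
     (let A = quantum_torus q (set vs) P in
      qt_scalar q (set vs) P
        (unit_powi q (- (\<Sum>b < length vs. \<Sum>a < b. k (vs ! a) * k (vs ! b) * P (vs ! a) (vs ! b))))
      \<otimes>\<^bsub>A\<^esub> list_prod A (map (\<lambda>i. qt_gen q (set vs) P i [^]\<^bsub>A\<^esub> k i) vs))"

definition center :: "('a, 'b) monoid_scheme \<Rightarrow> 'a set" where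
  "center M = {z \<in> carrier M. \<forall>x \<in> carrier M. z \<otimes>\<^bsub>M\<^esub> x = x \<otimes>\<^bsub>M\<^esub> z}"

text \<open>An \<open>R\<close>-subalgebra is a subring containing the scalars.\<close>

definition qt_subalgebra ::
  "'r \<Rightarrow> 'i set \<Rightarrow> ('i \<Rightarrow> 'i \<Rightarrow> int) \<Rightarrow> ('i laurent_gen free_word \<Rightarrow>\<^sub>0 'r::idom) set set \<Rightarrow>
   ('i laurent_gen free_word \<Rightarrow>\<^sub>0 'r) set set" where
  "qt_subalgebra q I P S = generate_ring (quantum_torus q I P) (range (qt_scalar q I P) \<union> S)"

definition primitive_root_of_unity :: "nat \<Rightarrow> 'r::monoid_mult \<Rightarrow> bool" where
  "primitive_root_of_unity m z \<longleftrightarrow> 0 < m \<and> z ^ m = 1 \<and> (\<forall>k. 0 < k \<and> k < m \<longrightarrow> z ^ k \<noteq> 1)"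


section \<open>The algebra of a triangulated surface and its central elements\<close>

definition A_alg ::
  "'r \<Rightarrow> nat \<Rightarrow> 'f triangulation \<Rightarrow> ('f ext_vertex laurent_gen free_word \<Rightarrow>\<^sub>0 'r::idom) set ring" where
  "A_alg q n T = quantum_torus q (V'_ext n T) (P_mat n T)"

definition A_gen ::
  "'r \<Rightarrow> nat \<Rightarrow> 'f triangulation \<Rightarrow> 'f ext_vertex \<Rightarrow>
   ('f ext_vertex laurent_gen free_word \<Rightarrow>\<^sub>0 'r::idom) set" where
  "A_gen q n T v = qt_gen q (V'_ext n T) (P_mat n T) v"

definition Lambda :: "nat \<Rightarrow> 'f triangulation \<Rightarrow> nat \<Rightarrow> ('f ext_vertex \<Rightarrow> int) set" where
  "Lambda n T m = {k. \<forall>w \<in> V_ext n T. [(\<Sum>v \<in> V'_ext n T. k v * K_mat n T v w) = 0] (mod int m)}"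

definition boundary_element ::
  "'r \<Rightarrow> nat \<Rightarrow> 'f triangulation \<Rightarrow> nat \<Rightarrow> ('f \<times> 3) list \<Rightarrow> nat \<Rightarrow> nat \<Rightarrow>
   ('f ext_vertex laurent_gen free_word \<Rightarrow>\<^sub>0 'r::idom) set" where
  "boundary_element q n T m es i k =
     list_prod (A_alg q n T)
       (map (\<lambda>j. A_gen q n T (attached_vertex n T i (es ! j))
                   [^]\<^bsub>A_alg q n T\<^esub> (if even j then k else m - k))
         [0..<length es])"

end

theory Submission
  imports Defs
begin

text \<open>
  The proof rests on the identity \<open>K\<^sub>b\<^sub>a\<^sub>r Q\<^sub>b\<^sub>a\<^sub>r = n (B - 2)\<close> for an arbitrary triangulated surface, where
  the row of \<open>u\<close> in \<open>B\<close> records the boundary vertices at which the elongated legs of \<open>u\<close> leave the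
  surface. It is local: in a triangle, \<open>K\<^sub>b\<^sub>a\<^sub>r\<close> is bilinear plus \<open>n\<close> times a minimum of three affine
  functions, whose discrete Laplacian is a point mass, and the contributions of the legs to the two
  sides of a glued edge cancel.

  On the extended surface it gives \<open>P = - n K M\<^sup>T\<close> with \<open>M\<close> equal to \<open>- 2\<close> times the identity away from the edges \<open>e\<^sub>2\<close> of the
  attached triangles, so \<open>k P = 0\<close> modulo \<open>m''\<close> becomes a condition on \<open>l = k K\<close> modulo \<open>m'\<close>. At the
  vertices on the edges \<open>e\<^sub>3\<close> it says that the values of \<open>l\<close> on the edges \<open>e\<^sub>2\<close> change sign from one
  boundary edge to the next. For odd \<open>m'\<close> they vanish on boundary components with an odd number of
  edges, and elsewhere they are realised by the boundary exponents; if they all vanish then so does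
  \<open>l\<close>, as \<open>2\<close> is invertible modulo \<open>m'\<close>.

  The center of the quantum torus is spanned by its central monomials, because the words of the free
  algebra have well-defined coefficients in the twisted group algebra of the exponent lattice.
\<close>

section \<open>Triangle coordinates\<close>

text \<open>The matrix \<open>Q\<close> is a restriction of \<open>Qbar\<close>, whereas the local
  identity needs all rows of \<open>Qbar\<close>. This is what \<open>C\<close> repairs: a vertex of
  an attached triangle and its projection have legs of equal weight through \<open>e_3\<close>, and
  no other leg ends there, so \<open>K\<close> vanishes in the columns that the restriction drops.
  The alternation along the boundary has its origin in a sign. The leg of
  \<open>(i, 0, n - i)\<close> through \<open>e_1\<close> turns round a puncture and ends on
  \<open>e_2\<close> of the preceding attached triangle, while the projection contributes on its own
  \<open>e_2\<close>. In \<open>K\<close> the two contributions are subtracted; in \<open>M\<close>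
  the projection also has a diagonal term \<open>- 2 n\<close>, which turns \<open>n\<close> into
  \<open>- n\<close>, so that they add up. Hence exponents with consecutive sum \<open>m'\<close>
  are central, and yet have rows \<open>- 2 k\<close> or \<open>2 k\<close> times an edge function
  modulo \<open>m'\<close>. Those edge functions form \<open>n\<close> times an inverse Cartan
  matrix, in general not invertible modulo \<open>m'\<close>. The boundary values of a central
  exponent can be matched only because every leg produces an edge function, so that they lie in the
  integral span from the start.\<close>

definition simplex :: "nat \<Rightarrow> coords set" where
  "simplex n = {p. (\<forall>c. 0 \<le> p c) \<and> p 1 + p 2 + p 3 = int n}"

lemma add_3 [simp]: "c + 3 = (c::3)" "c + 4 = c + 1" "c + 5 = c + 2" "c + 6 = c"
  "3 + c = c" "4 + c = c + 1"
  by simp_all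

lemma all_3: "(\<forall>c::3. P c) \<longleftrightarrow> P 1 \<and> P 2 \<and> P 3"
  using three_cases by metis

lemma three_cases_from: "d = c \<or> d = c + 1 \<or> d = c + (2::3)"
  using three_cases[of c] three_cases[of d] by auto

lemma all_3_from: "(\<forall>d::3. P d) \<longleftrightarrow> P c \<and> P (c + 1) \<and> P (c + 2)"
  using three_cases_from by metis

lemma UNIV_3_from: "(UNIV::3 set) = {c, c + 1, c + 2}"
  using three_cases_from by blast

lemma neq_3 [simp]: "c \<noteq> c + 1" "c + 1 \<noteq> c" "c \<noteq> c + (2::3)" "c + 2 \<noteq> c"
  "c + 1 \<noteq> c + 2" "c + 2 \<noteq> c + 1"
  using three_cases[of c] by auto

lemma sum_3_from: "(\<Sum>d\<in>UNIV. f (d::3)) = f c + f (c + 1) + (f (c + 2) :: 'a::ab_group_add)"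
  unfolding UNIV_3_from[of c] by (simp add: add.assoc)

lemma sum_1_2_3: "f 1 + f 2 + f 3 = (\<Sum>d\<in>UNIV. f (d::3) :: 'a::ab_group_add)"
  by (simp add: sum_3_from[of _ 1])

text \<open>Counting the coordinates from an arbitrary index lets one computation cover all three
  edges, by the cyclic symmetry of the triangle.\<close>

lemma simplex_iff: "p \<in> simplex n \<longleftrightarrow> 0 \<le> p c \<and> 0 \<le> p (c + 1) \<and> 0 \<le> p (c + 2) \<and>
    p c + p (c + 1) + p (c + 2) = int n"
  by (simp add: simplex_def sum_1_2_3 sum_3_from[of _ c] all_3_from[of _ c])

lemma pt_apply [simp]: "pt i j k 1 = i" "pt i j k 2 = j" "pt i j k 3 = k" "pt i j k 0 = k"
  by (simp_all add: pt_def)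

lemma pt_eta: "pt (p 1) (p 2) (p 3) = p"
  by (rule ext) (metis three_cases pt_apply)

lemma coords_eqI: "p c = p' c \<Longrightarrow> p (c + 1) = p' (c + 1) \<Longrightarrow> p (c + 2) = p' (c + 2) \<Longrightarrow> p = (p' :: coords)"
  by (rule ext) (metis three_cases_from)

lemma simplex_eqI: "p \<in> simplex n \<Longrightarrow> p' \<in> simplex n \<Longrightarrow> p c = p' c \<Longrightarrow> p (c + 1) = p' (c + 1) \<Longrightarrow> p = p'"
  by (rule coords_eqI[of _ c]) (auto simp: simplex_iff[of _ _ c])

lemma small_vertices_eq: "small_vertices n = {p \<in> simplex n. \<forall>c. p c \<noteq> int n}"
proof (rule Set.set_eqI)
  fix p :: coords
  have eqs: "p = pt i j k \<longleftrightarrow> p 1 = i \<and> p 2 = j \<and> p 3 = k" for i j k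
    using pt_eta[of p] by auto
  have "p \<in> small_vertices n \<longleftrightarrow> p \<in> simplex n - {pt (int n) 0 0, pt 0 (int n) 0, pt 0 0 (int n)}"
    by (auto simp: small_vertices_def simplex_def eqs all_3)
  also have "\<dots> \<longleftrightarrow> p \<in> simplex n \<and> (\<forall>c. p c \<noteq> int n)"
    by (auto simp: simplex_def eqs all_3)
  finally show "p \<in> small_vertices n \<longleftrightarrow> p \<in> {p \<in> simplex n. \<forall>c. p c \<noteq> int n}" by simp
qed

lemma finite_simplex: "finite (simplex n)"
proof -
  have "simplex n \<subseteq> (\<lambda>(i, j, k). pt i j k) ` ({0..int n} \<times> {0..int n} \<times> {0..int n})"
  proof
    fix p assume "p \<in> simplex n"
    then have "(p 1, p 2, p 3) \<in> {0..int n} \<times> {0..int n} \<times> {0..int n}"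
      by (auto simp: simplex_def all_3)
    then show "p \<in> (\<lambda>(i, j, k). pt i j k) ` ({0..int n} \<times> {0..int n} \<times> {0..int n})"
      by (rule rev_image_eqI) (simp add: pt_eta)
  qed
  then show ?thesis by (rule finite_subset) auto
qed

lemma finite_small_vertices: "finite (small_vertices n)"
  by (rule finite_subset[OF _ finite_simplex]) (auto simp: small_vertices_eq)

lemma small_vertices_on_edge:
  assumes "p \<in> small_vertices n" "on_edge p c"
  shows "0 < p c" "0 < p (c + 1)" "p c < int n" "p (c + 1) < int n"
    "p (c + 1) = int n - p c" "\<not> on_edge p (c + 1)" "\<not> on_edge p (c + 2)" "p (c + 2) = 0"
  using assms by (auto simp: small_vertices_eq simplex_iff[of _ _ c] on_edge_def all_3_from[of _ c])

text \<open>Two edges meet only in a corner, and corners are excluded. This is what limits a gluing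
  class to at most two occurrences.\<close>

lemma on_edge_unique:
  "p \<in> small_vertices n \<Longrightarrow> on_edge p c \<Longrightarrow> on_edge p d \<Longrightarrow> c = d"
  using small_vertices_on_edge(6,7)[of p n c] three_cases_from[of d c] by auto

section \<open>The local matrices\<close>

text \<open>As a matrix in \<open>a\<close> and \<open>t\<close> this is \<open>n\<close> times the
  inverse Cartan matrix of type \<open>A\<close> and rank \<open>n - 1\<close>: up to the factor
  \<open>n\<close>, the Green function of the second difference on the path from 0 to
  \<open>n\<close>.\<close>

definition edge_val :: "nat \<Rightarrow> int \<Rightarrow> int \<Rightarrow> int" where
  "edge_val n a t = int n * min a t - a * t"

lemma edge_val_0 [simp]: "0 \<le> t \<Longrightarrow> edge_val n 0 t = 0"
  by (simp add: edge_val_def)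

lemma edge_val_full [simp]: "t \<le> int n \<Longrightarrow> edge_val n (int n) t = 0"
  by (simp add: edge_val_def)

text \<open>The symmetry needed for gluing: the two sides of a glued edge run through it in opposite
  directions.\<close>

lemma edge_val_compl: "edge_val n (int n - a) (int n - t) = edge_val n a t"
  by (auto simp: edge_val_def min_def algebra_simps)

text \<open>The three cyclic formulas are affine in \<open>p'\<close> and differ by \<open>n\<close>
  times an affine function that vanishes on the common wall of their cells. The minimum selects the
  formula that belongs to the cell of \<open>p'\<close>.\<close>

lemma Kbar_P3_min:
  assumes p: "p \<in> simplex n" and p': "p' \<in> simplex n"
  shows "Kbar_P3 p p' = p (c + 1) * p' (c + 2) + p (c + 2) * p' c + p' c * p (c + 1) +
    int n * min 0 (min (p' (c + 1) - p (c + 1)) (p c - p' c))"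
proof -
  have sum: "p 1 + p 2 + p 3 = p' 1 + p' 2 + p' 3" using p p' by (simp add: simplex_def)
  obtain x y z where xyz: "p c = x" "p (c + 1) = y" "p (c + 2) = z" by blast
  obtain x' y' z' where xyz': "p' c = x'" "p' (c + 1) = y'" "p' (c + 2) = z'" by blast
  note eq = Kbar_P3_eq[OF sum, of c] Kbar_P3_eq[OF sum, of "c + 1"] Kbar_P3_eq[OF sum, of "c + 2"]
  note eq = eq[simplified add.assoc, simplified, unfolded xyz xyz']
  note s = p[unfolded simplex_iff[of _ _ c] xyz] p'[unfolded simplex_iff[of _ _ c] xyz']
  have n: "int n = x + y + z" and z': "z' = x + y + z - x' - y'"
    using s by auto
  \<comment> \<open>The three coordinate differences sum to zero, so in cyclic order some
    non-negative one is followed by a non-positive one.\<close>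
  consider "x' \<le> x" "y \<le> y'" | "y' \<le> y" "z \<le> z'" | "z' \<le> z" "x \<le> x'"
    using s by linarith
  then show ?thesis
    unfolding xyz xyz'
  proof cases
    case 1
    then show "Kbar_P3 p p' = y * z' + z * x' + x' * y + int n * min 0 (min (y' - y) (x - x'))"
      using eq(1) by simp
  next
    case 2
    then have "min 0 (min (y' - y) (x - x')) = y' - y"
      using s by linarith
    then show "Kbar_P3 p p' = y * z' + z * x' + x' * y + int n * min 0 (min (y' - y) (x - x'))"
      using eq(2) 2 unfolding n by (simp add: z' algebra_simps)
  next
    case 3
    then have "min 0 (min (y' - y) (x - x')) = x - x'"
      using s by linarith
    then show "Kbar_P3 p p' = y * z' + z * x' + x' * y + int n * min 0 (min (y' - y) (x - x'))"
      using eq(3) 3 unfolding n by (simp add: z' algebra_simps)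
  qed
qed

text \<open>On the edge \<open>c\<close> only the weight \<open>p c\<close> of the leg through that
  edge is visible. Hence a value at a glued edge can be compared with the neighbouring face, where
  only this leg continues through the edge.\<close>

lemma Kbar_P3_edge:
  assumes "p \<in> simplex n" "p' \<in> simplex n" "on_edge p' c"
  shows "Kbar_P3 p p' = edge_val n (p c) (p' c)"
proof -
  obtain x y z where xyz: "p c = x" "p (c + 1) = y" "p (c + 2) = z" by blast
  obtain x' y' z' where xyz': "p' c = x'" "p' (c + 1) = y'" "p' (c + 2) = z'" by blast
  note s = assms(1)[unfolded simplex_iff[of _ _ c] xyz] assms(2)[unfolded simplex_iff[of _ _ c] xyz']
    assms(3)[unfolded on_edge_def xyz']
  have a: "z = int n - x - y" "y' = int n - x'" using s by auto
  have "min 0 (min (int n - x' - y) (x - x')) = min x x' - x'" using s by linarith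
  then have "Kbar_P3 p p' = y * 0 + (int n - x - y) * x' + x' * y + int n * (min x x' - x')"
    using Kbar_P3_min[OF assms(1,2), of c] unfolding xyz xyz' a s(3) by simp
  then show ?thesis
    unfolding edge_val_def xyz xyz' by (simp add: algebra_simps)
qed

lemma Kbar_P3_corner_right:
  assumes "p \<in> simplex n" "p' \<in> simplex n" "p' c = int n"
  shows "Kbar_P3 p p' = 0"
proof -
  have "on_edge p' c" "p c \<le> int n" using assms by (auto simp: on_edge_def simplex_iff[of _ _ c])
  then show ?thesis using Kbar_P3_edge[OF assms(1,2), of c] assms(3) by (simp add: edge_val_def)
qed

text \<open>An arc of weight 0 has a corner as its vertex; legs of weight 0 may therefore be kept in
  all sums.\<close>

lemma Kbar_P3_corner_left:
  assumes p: "p \<in> simplex n" and p': "p' \<in> simplex n" and c: "p c = int n"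
  shows "Kbar_P3 p p' = 0"
proof -
  note s = assms(1,2)[unfolded simplex_iff[of _ _ c]] c
  have z: "p (c + 1) = 0" "p (c + 2) = 0" using s by auto
  have "min 0 (min (p' (c + 1) - 0) (int n - p' c)) = 0" using s by linarith
  then show ?thesis
    unfolding Kbar_P3_min[OF assms(1,2), of c] z c by simp
qed

lemma arc_vertex_apply [simp]: "arc_vertex n k e e = k" "arc_vertex n k e (e + 2) = int n - k"
  "arc_vertex n k e (e + 1) = 0"
  by (simp_all add: arc_vertex_def)

lemma arc_vertex_simplex: "0 \<le> k \<Longrightarrow> k \<le> int n \<Longrightarrow> arc_vertex n k e \<in> simplex n"
  by (simp add: simplex_iff[of _ _ e])

text \<open>The three arrow directions, indexed so that \<open>step c\<close> is parallel to the
  edge \<open>c\<close> and points towards its first end.\<close>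

definition step :: "3 \<Rightarrow> coords" where
  "step c = (\<lambda>d. if d = c then 1 else if d = c + 1 then - 1 else 0)"

lemma step_apply [simp]: "step c c = 1" "step c (c + 1) = - 1" "step c (c + 2) = 0"
  "step (c + 1) c = 0" "step (c + 1) (c + 1) = 1" "step (c + 1) (c + 2) = -1"
  "step (c + 2) c = - 1" "step (c + 2) (c + 1) = 0" "step (c + 2) (c + 2) = 1"
  using three_cases[of c] by (auto simp: step_def)

lemma step_eqs: "step 1 = pt 1 (-1) 0" "step 2 = pt 0 1 (-1)" "step 3 = pt (-1) 0 1"
  by (simp_all add: step_def pt_def fun_eq_iff all_3)

lemma arrow_iff: "arrow p p' \<longleftrightarrow> (\<exists>c. p' = (\<lambda>d. p d + step c d))"
proof -
  have 1: "(\<exists>c. P c) \<longleftrightarrow> P 2 \<or> P 1 \<or> P 3" for P :: "3 \<Rightarrow> bool"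
    using three_cases by metis
  have "(\<lambda>d. p' d - p d) = step c \<longleftrightarrow> p' = (\<lambda>d. p d + step c d)" for c
    by (auto simp: fun_eq_iff algebra_simps)
  then show ?thesis
    unfolding arrow_def 1 step_eqs[symmetric] by simp
qed


lemma arrow_asym: "arrow p p' \<Longrightarrow> \<not> arrow p' p"
proof
  assume "arrow p p'" "arrow p' p"
  then obtain c d where "p' = (\<lambda>e. p e + step c e)" "p = (\<lambda>e. p' e + step d e)"
    unfolding arrow_iff by blast
  then have "step c e + step d e = 0" for e
    by (auto simp: fun_eq_iff add.commute)
  from this[of c] this[of "c + 1"] this[of "c + 2"] show False
    using three_cases_from[of d c] by auto
qed

lemma arrow_weight_commute: "arrow_weight p p' = arrow_weight p' p"
  by (auto simp: arrow_weight_def)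

lemma Qbar_P3_antisym: "Qbar_P3 p p' = - Qbar_P3 p' p"
  using arrow_asym[of p p'] arrow_asym[of p' p] arrow_weight_commute[of p p'] by (auto simp: Qbar_P3_def)

lemma step_inj: "step c = step d \<Longrightarrow> c = d"
  by (metis step_apply three_cases_from one_neq_neg_one zero_neq_one)

text \<open>For a fixed second argument the possible sources and targets of arrows are the six
  neighbours in the hexagon, and at most one of the six indicators is nonzero. In this form the
  matrix acts as a difference operator.\<close>

lemma Qbar_P3_sum:
  "Qbar_P3 p p' = arrow_weight p p' *
     (\<Sum>c\<in>UNIV. of_bool (p = (\<lambda>d. p' d - step c d)) - of_bool (p = (\<lambda>d. p' d + step c d)))"
proof -
  have inj: "c = d" if "(\<lambda>e. p' e - step c e) = (\<lambda>e. p' e - step d e)" for c d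
    using that step_inj[of c d] by (auto simp: fun_eq_iff)
  have inj': "c = d" if "(\<lambda>e. p' e + step c e) = (\<lambda>e. p' e + step d e)" for c d
    using that step_inj[of c d] by (auto simp: fun_eq_iff)
  have a: "arrow p p' \<longleftrightarrow> (\<exists>c. p = (\<lambda>d. p' d - step c d))"
    unfolding arrow_iff by (auto simp: fun_eq_iff algebra_simps) (metis add.commute diff_add_cancel add_diff_cancel_left')+
  have a': "arrow p' p \<longleftrightarrow> (\<exists>c. p = (\<lambda>d. p' d + step c d))"
    by (rule arrow_iff)
  have 1: "(\<Sum>c\<in>UNIV. of_bool (p = (\<lambda>d. p' d - step c d))) = (of_bool (arrow p p') :: int)"
  proof (cases "arrow p p'")
    case True
    then obtain c where c: "p = (\<lambda>d. p' d - step c d)" using a by blast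
    have "(p = (\<lambda>d. p' d - step e d)) = (e = c)" for e using c inj by blast
    then show ?thesis using True by (simp add: of_bool_def)
  qed (use a in auto)
  have 2: "(\<Sum>c\<in>UNIV. of_bool (p = (\<lambda>d. p' d + step c d))) = (of_bool (arrow p' p) :: int)"
  proof (cases "arrow p' p")
    case True
    then obtain c where c: "p = (\<lambda>d. p' d + step c d)" using a' by blast
    have "(p = (\<lambda>d. p' d + step e d)) = (e = c)" for e using c inj' by blast
    then show ?thesis using True by (simp add: of_bool_def)
  qed (use a' in auto)
  show ?thesis
    using arrow_asym[of p p'] by (simp add: sum_subtractf 1 2 Qbar_P3_def)
qed

text \<open>Extension by zero, so that all six neighbours of a vertex can be summed over even if
  some lie outside the triangle. Corners are allowed because the value there is zero anyway.\<close>

definition Kext :: "nat \<Rightarrow> coords \<Rightarrow> coords \<Rightarrow> int" where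
  "Kext n p p' = (if p' \<in> simplex n then Kbar_P3 p p' else 0)"

lemma Kext_eq:
  assumes "p \<in> simplex n"
  shows "Kext n p p' = (if p' \<in> small_vertices n then Kbar_P3 p p' else 0)"
  using Kbar_P3_corner_right[OF assms, of p'] by (auto simp: Kext_def small_vertices_eq)

section \<open>The product of the two matrices inside one triangle\<close>

lemma local_sum_neighbours:
  assumes p: "p \<in> simplex n"
  shows "(\<Sum>p'\<in>small_vertices n. Kbar_P3 p p' * Qbar_P3 p' r) =
    (\<Sum>c\<in>UNIV. arrow_weight (\<lambda>d. r d - step c d) r * Kext n p (\<lambda>d. r d - step c d)
             - arrow_weight (\<lambda>d. r d + step c d) r * Kext n p (\<lambda>d. r d + step c d))"
proof -
  have 1: "(\<Sum>p'\<in>small_vertices n. Kbar_P3 p p' * (arrow_weight p' r * of_bool (p' = s))) =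
      arrow_weight s r * Kext n p s" for s
  proof -
    have "(\<Sum>p'\<in>small_vertices n. Kbar_P3 p p' * (arrow_weight p' r * of_bool (p' = s))) =
        (\<Sum>p'\<in>small_vertices n. if p' = s then Kbar_P3 p s * arrow_weight s r else 0)"
      by (intro sum.cong) auto
    then show ?thesis by (simp add: finite_small_vertices Kext_eq[OF p])
  qed
  have "(\<Sum>p'\<in>small_vertices n. Kbar_P3 p p' * Qbar_P3 p' r) =
    (\<Sum>p'\<in>small_vertices n. \<Sum>c\<in>UNIV. 
      Kbar_P3 p p' * (arrow_weight p' r * of_bool (p' = (\<lambda>d. r d - step c d))) -
      Kbar_P3 p p' * (arrow_weight p' r * of_bool (p' = (\<lambda>d. r d + step c d))))"
    by (intro sum.cong refl) (simp add: Qbar_P3_sum sum_distrib_left right_diff_distrib)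
  then show ?thesis
    unfolding sum.swap[of _ UNIV] sum_subtractf by (simp only: 1)
qed

text \<open>The part of \<open>Kbar_P3\<close> that is linear in the second argument drops out
  because the three steps sum to zero; only the minimum in \<open>Kbar_P3_min\<close> is left, with
  the factor 2 from the weight of inner arrows.\<close>

lemma local_sum_interior:
  assumes p: "p \<in> simplex n" and r: "r \<in> simplex n" and int: "\<forall>c. \<not> on_edge r c"
  shows "(\<Sum>p'\<in>small_vertices n. Kbar_P3 p p' * Qbar_P3 p' r) = - 2 * int n * of_bool (p = r)"
proof -
  have pos: "0 < r c" for c
    using int[unfolded all_3_from[of _ "c + 1"]] r by (auto simp: on_edge_def simplex_iff[of _ _ c] add.assoc)
  have w: "arrow_weight s r = 2" for s using int by (simp add: arrow_weight_def)
  have "(\<lambda>d. r d - step c d) \<in> simplex n" "(\<lambda>d. r d + step c d) \<in> simplex n" for c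
    using r pos[of c] pos[of "c + 1"] by (auto simp: simplex_iff[of _ _ c])
  note mem = this(1)[of 1] this(2)[of 1] this(1)[of 2] this(2)[of 2] this(1)[of 3] this(2)[of 3]
  have e: "p = r \<longleftrightarrow> p 1 = r 1 \<and> p 2 = r 2"
    using simplex_eqI[OF p r, of 1] by auto
  have st: "step 1 1 = 1" "step 1 2 = - 1" "step 1 3 = 0"
      "step 2 1 = 0" "step 2 2 = 1" "step 2 3 = - 1"
      "step 3 1 = - 1" "step 3 2 = 0" "step 3 3 = 1"
    by (simp_all add: step_eqs)
  define x where "x = p 1 - r 1"
  define y where "y = r 2 - p 2"
  \<comment> \<open>The alternating sum over the hexagon kills functions that are affine or bent
    along a straight line through its centre. What it detects is the single point where the three
    bending rays of the minimum meet.\<close>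
  have min: "min 0 (min (y + 1) (x + 1)) - min 0 (min (y - 1) (x - 1))
     + min 0 (min (y - 1) x) - min 0 (min (y + 1) x)
     + min 0 (min y (x - 1)) - min 0 (min y (x + 1)) = - of_bool (x = 0 \<and> y = 0)"
    by (cases "x < 0"; cases "x = 0"; cases "y < 0"; cases "y = 0"; simp add: min_def)
  have k1: "Kext n p (\<lambda>d. r d - step 1 d) =
      p 2 * (r 3) + p 3 * (r 1 - 1) + (r 1 - 1) * p 2 + int n * min 0 (min (y + 1) (x + 1))"
    using mem(1) Kbar_P3_min[OF p mem(1), of 1]
    by (simp add: Kext_def st x_def y_def algebra_simps)
  have k2: "Kext n p (\<lambda>d. r d + step 1 d) =
      p 2 * (r 3) + p 3 * (r 1 + 1) + (r 1 + 1) * p 2 + int n * min 0 (min (y - 1) (x - 1))"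
    using mem(2) Kbar_P3_min[OF p mem(2), of 1]
    by (simp add: Kext_def st x_def y_def algebra_simps)
  have k3: "Kext n p (\<lambda>d. r d - step 2 d) =
      p 2 * (r 3 + 1) + p 3 * (r 1) + (r 1) * p 2 + int n * min 0 (min (y - 1) (x))"
    using mem(3) Kbar_P3_min[OF p mem(3), of 1]
    by (simp add: Kext_def st x_def y_def algebra_simps)
  have k4: "Kext n p (\<lambda>d. r d + step 2 d) =
      p 2 * (r 3 - 1) + p 3 * (r 1) + (r 1) * p 2 + int n * min 0 (min (y + 1) (x))"
    using mem(4) Kbar_P3_min[OF p mem(4), of 1]
    by (simp add: Kext_def st x_def y_def algebra_simps)
  have k5: "Kext n p (\<lambda>d. r d - step 3 d) =
      p 2 * (r 3 - 1) + p 3 * (r 1 + 1) + (r 1 + 1) * p 2 + int n * min 0 (min (y) (x - 1))"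
    using mem(5) Kbar_P3_min[OF p mem(5), of 1]
    by (simp add: Kext_def st x_def y_def algebra_simps)
  have k6: "Kext n p (\<lambda>d. r d + step 3 d) =
      p 2 * (r 3 + 1) + p 3 * (r 1 - 1) + (r 1 - 1) * p 2 + int n * min 0 (min (y) (x + 1))"
    using mem(6) Kbar_P3_min[OF p mem(6), of 1]
    by (simp add: Kext_def st x_def y_def algebra_simps)
  have "(\<Sum>p'\<in>small_vertices n. Kbar_P3 p p' * Qbar_P3 p' r) = 2 * int n *
     (min 0 (min (y + 1) (x + 1)) - min 0 (min (y - 1) (x - 1))
     + min 0 (min (y - 1) x) - min 0 (min (y + 1) x)
     + min 0 (min y (x - 1)) - min 0 (min y (x + 1)))"
    unfolding local_sum_neighbours[OF p] sum_3_from[of _ 1] w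
    by (simp add: k1 k2 k3 k4 k5 k6) (simp add: algebra_simps)
  then show ?thesis
    unfolding min e by (auto simp: x_def y_def)
qed

text \<open>Two of the six neighbours are missing and the arrows along the edge have weight 1, so a
  bending ray that ends on the edge is detected as well. The resulting term depends on
  \<open>p\<close> only through \<open>p c\<close>, which is what allows it to cancel against the
  other side of a glued edge.\<close>

lemma local_sum_edge:
  assumes p: "p \<in> simplex n" and r': "r \<in> small_vertices n" and edge: "on_edge r c"
  shows "(\<Sum>p'\<in>small_vertices n. Kbar_P3 p p' * Qbar_P3 p' r) =
    int n * of_bool (p c = r c) - 2 * int n * of_bool (p = r)"
proof -
  note r = small_vertices_on_edge[OF r' edge]
  have rs: "r \<in> simplex n" using r' by (simp add: small_vertices_eq)
  have mem: "(\<lambda>d. r d - step c d) \<in> simplex n" "(\<lambda>d. r d + step c d) \<in> simplex n"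
      "(\<lambda>d. r d - step (c + 1) d) \<in> simplex n" "(\<lambda>d. r d + step (c + 2) d) \<in> simplex n"
      "(\<lambda>d. r d + step (c + 1) d) \<notin> simplex n" "(\<lambda>d. r d - step (c + 2) d) \<notin> simplex n"
    using r by (auto simp: simplex_iff[of _ _ c])
  have w1: "arrow_weight (\<lambda>d. r d - step c d) r = 1" "arrow_weight (\<lambda>d. r d + step c d) r = 1"
    using edge by (auto simp: arrow_weight_def on_edge_def intro!: exI[of _ c])
  have unique: "on_edge r d \<longleftrightarrow> d = c" for d
    using on_edge_unique[OF r' edge] edge by blast
  have w2: "arrow_weight (\<lambda>d. r d - step (c + 1) d) r = 2" "arrow_weight (\<lambda>d. r d + step (c + 2) d) r = 2"
    using r(8) by (auto simp: arrow_weight_def unique) (auto simp: on_edge_def)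
  have k0: "Kext n p (\<lambda>d. r d + step (c + 1) d) = 0" "Kext n p (\<lambda>d. r d - step (c + 2) d) = 0"
    using mem by (simp_all add: Kext_def)
  define x where "x = p c - r c"
  define y where "y = r (c + 1) - p (c + 1)"
  \<comment> \<open>The difference \<open>y - x\<close> is \<open>p (c + 2)\<close>.\<close>
  have xy: "x \<le> y" using p r(5) by (auto simp: simplex_iff[of _ _ c] x_def y_def)
  have e: "p = r \<longleftrightarrow> x = 0 \<and> y = 0"
    using simplex_eqI[OF p rs, of c] by (auto simp: x_def y_def)
  have min: "min 0 (min (y + 1) (x + 1)) - min 0 (min (y - 1) (x - 1))
     + 2 * min 0 (min (y - 1) x) - 2 * min 0 (min y (x + 1)) = of_bool (x = 0) - 2 * of_bool (x = 0 \<and> y = 0)"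
    using xy by (auto simp: min_def)
  have k1: "Kext n p (\<lambda>d. r d - step c d) =
      p (c + 1) * (0) + p (c + 2) * (r c - 1) + (r c - 1) * p (c + 1) + int n * min 0 (min (y + 1) (x + 1))"
    using mem(1) Kbar_P3_min[OF p mem(1), of c]
    by (simp only: Kext_def if_True step_apply r(8) x_def y_def) (simp add: algebra_simps)
  have k2: "Kext n p (\<lambda>d. r d + step c d) =
      p (c + 1) * (0) + p (c + 2) * (r c + 1) + (r c + 1) * p (c + 1) + int n * min 0 (min (y - 1) (x - 1))"
    using mem(2) Kbar_P3_min[OF p mem(2), of c]
    by (simp only: Kext_def if_True step_apply r(8) x_def y_def) (simp add: algebra_simps)
  have k3: "Kext n p (\<lambda>d. r d - step (c + 1) d) =
      p (c + 1) * (1) + p (c + 2) * (r c) + (r c) * p (c + 1) + int n * min 0 (min (y - 1) (x))"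
    using mem(3) Kbar_P3_min[OF p mem(3), of c]
    by (simp only: Kext_def if_True step_apply r(8) x_def y_def) (simp add: algebra_simps)
  have k4: "Kext n p (\<lambda>d. r d + step (c + 2) d) =
      p (c + 1) * (1) + p (c + 2) * (r c - 1) + (r c - 1) * p (c + 1) + int n * min 0 (min (y) (x + 1))"
    using mem(4) Kbar_P3_min[OF p mem(4), of c]
    by (simp only: Kext_def if_True step_apply r(8) x_def y_def) (simp add: algebra_simps)
  have "(\<Sum>p'\<in>small_vertices n. Kbar_P3 p p' * Qbar_P3 p' r) = int n *
     (min 0 (min (y + 1) (x + 1)) - min 0 (min (y - 1) (x - 1))
     + 2 * min 0 (min (y - 1) x) - 2 * min 0 (min y (x + 1)))"
    unfolding local_sum_neighbours[OF p] sum_3_from[of _ c] w1 w2 k0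
    by (simp add: k1 k2 k3 k4) (simp add: algebra_simps)
  then show ?thesis
    unfolding min e by (auto simp: x_def algebra_simps)
qed

section \<open>Surfaces without closed left-turning paths\<close>

lemma left_turn_iff: "(x, (g, e)) \<in> left_turn S \<longleftrightarrow> glue S x = Some (g, e + 2)"
proof
  assume "(x, (g, e)) \<in> left_turn S"
  then show "glue S x = Some (g, e + 2)" by (auto simp: left_turn_def add.assoc)
next
  assume "glue S x = Some (g, e + 2)"
  then have "(x, (g, e + 2 + 1)) \<in> left_turn S" unfolding left_turn_def by blast
  then show "(x, (g, e)) \<in> left_turn S" by (simp add: add.assoc)
qed

lemma vertex_glue_iff: "((f, p), (g, q)) \<in> vertex_glue S \<longleftrightarrow>
    (\<exists>c d. glue S (f, c) = Some (g, d) \<and> on_edge p c \<and> on_edge q d \<and> q (d + 1) = p c \<and> q d = p (c + 1))"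
  by (simp add: vertex_glue_def)

section \<open>Left turns as a partial injection on the edges of faces\<close>

locale triangulated =
  fixes S :: "'f triangulation"
  assumes triangulation: "ideal_triangulation S"
begin

abbreviation LT where "LT \<equiv> left_turn S"

lemma glue_sym: "glue S x = Some y \<Longrightarrow> glue S y = Some x"
  and glue_faces: "glue S x = Some y \<Longrightarrow> fst x \<in> faces S" "glue S x = Some y \<Longrightarrow> fst y \<in> faces S"
  and glue_neq: "glue S x = Some y \<Longrightarrow> x \<noteq> y"
  and finite_faces: "finite (faces S)"
  using triangulation unfolding ideal_triangulation_def by blast+

lemma LT_functional: "(x, y) \<in> LT \<Longrightarrow> (x, z) \<in> LT \<Longrightarrow> y = z"
  by (cases y; cases z) (auto simp: left_turn_iff)

lemma LT_injective: "(x, z) \<in> LT \<Longrightarrow> (y, z) \<in> LT \<Longrightarrow> x = y"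
  by (cases z) (metis left_turn_iff glue_sym option.inject)

end

text \<open>Acyclicity of left turns replaces the absence of interior punctures, because it passes
  directly to the extended surface. It makes a leg use each exit edge at most once, so that arcs are
  counted by truth values.\<close>

locale surface = triangulated S for n :: nat and S :: "'f triangulation" +
  assumes no_cycle: "(x, x) \<notin> (left_turn S)\<^sup>+"
begin

abbreviation VG where "VG \<equiv> vertex_glue S"
abbreviation occ where "occ \<equiv> faces S \<times> small_vertices n"

lemma finite_occ: "finite occ"
  by (simp add: finite_faces finite_small_vertices)

lemma LT_trancl_from:
  assumes "(x, y) \<in> LT"
  shows "(x, z) \<in> LT\<^sup>+ \<longleftrightarrow> z = y \<or> (y, z) \<in> LT\<^sup>+"
proof
  assume "(x, z) \<in> LT\<^sup>+"
  then obtain y' where "(x, y') \<in> LT" "(y', z) \<in> LT\<^sup>*" by (meson tranclD)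
  then show "z = y \<or> (y, z) \<in> LT\<^sup>+" using LT_functional[OF assms] by (metis rtranclD)
qed (use assms in \<open>auto intro: trancl_into_trancl2\<close>)

text \<open>An exit edge determines its entry edge under a left turn: a leg can leave
  \<open>s\<close> through \<open>d + 1\<close> only after entering through \<open>d\<close>, that
  is, after leaving through \<open>x\<close>. This matches arcs on the two sides of a glued
  edge.\<close>

lemma LT_trancl_to:
  assumes "glue S x = Some (s, d)"
  shows "(z, (s, d + 1)) \<in> LT\<^sup>+ \<longleftrightarrow> (z, x) \<in> LT\<^sup>*"
proof -
  have *: "(x, (s, d + 1)) \<in> LT" using assms by (simp add: left_turn_iff add.assoc)
  show ?thesis
  proof
    assume "(z, (s, d + 1)) \<in> LT\<^sup>+"
    then obtain y where "(z, y) \<in> LT\<^sup>*" "(y, (s, d + 1)) \<in> LT" by (meson tranclD2)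
    then show "(z, x) \<in> LT\<^sup>*" using LT_injective[OF * ] by metis
  qed (use * in \<open>auto intro: rtrancl_into_trancl1\<close>)
qed

lemma LT_trancl_to_boundary:
  assumes "glue S (s, d) = None"
  shows "(z, (s, d + 1)) \<notin> LT\<^sup>+"
proof
  assume "(z, (s, d + 1)) \<in> LT\<^sup>+"
  then obtain y where "(y, (s, d + 1)) \<in> LT" by (meson tranclD2)
  then show False using assms glue_sym[of y "(s, d)"] by (auto simp: left_turn_iff add.assoc)
qed

lemma LT_rtrancl_bool: "of_bool ((x, y) \<in> LT\<^sup>*) = (of_bool (x = y) + of_bool ((x, y) \<in> LT\<^sup>+) :: int)"
  using no_cycle[of x] by (auto simp: rtrancl_eq_or_trancl)

subsection \<open>Small vertices as classes of occurrences\<close>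

lemma VG_sym:
  assumes "(x, y) \<in> VG"
  shows "(y, x) \<in> VG"
proof -
  obtain f p g q where xy: "x = (f, p)" "y = (g, q)" by (meson surj_pair)
  have "\<exists>c d. glue S (f, c) = Some (g, d) \<and> on_edge p c \<and> on_edge q d \<and> q (d + 1) = p c \<and> q d = p (c + 1)"
    using assms unfolding xy vertex_glue_iff .
  then obtain c d where *: "glue S (f, c) = Some (g, d)" "on_edge p c" "on_edge q d" "q (d + 1) = p c" "q d = p (c + 1)"
    by blast
  have "glue S (g, d) = Some (f, c)" "p (c + 1) = q d" "p c = q (d + 1)"
    using glue_sym[OF *(1)] * by simp_all
  then show ?thesis using *(2,3) unfolding xy vertex_glue_iff by metis
qed

lemma VG_E:
  assumes "(x, y) \<in> VG" "x \<in> occ"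
  obtains f p g q c d where "x = (f, p)" "y = (g, q)" "glue S (f, c) = Some (g, d)" "on_edge p c"
    "on_edge q d" "q (d + 1) = p c" "q d = p (c + 1)" "f \<in> faces S" "g \<in> faces S"
    "p \<in> small_vertices n" "q \<in> small_vertices n"
proof -
  obtain f p g q where xy: "x = (f, p)" "y = (g, q)" by (meson surj_pair)
  have "\<exists>c d. glue S (f, c) = Some (g, d) \<and> on_edge p c \<and> on_edge q d \<and> q (d + 1) = p c \<and> q d = p (c + 1)"
    using assms(1) unfolding xy vertex_glue_iff .
  then obtain c d where *: "glue S (f, c) = Some (g, d)" "on_edge p c" "on_edge q d" "q (d + 1) = p c" "q d = p (c + 1)"
    by blast
  have p: "p \<in> small_vertices n" using assms(2) xy(1) by simp
  note s = small_vertices_on_edge[OF p *(2)]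
  have "q (d + 2) = 0" using *(3) by (simp add: on_edge_def)
  then have "q \<in> small_vertices n"
    using s *(4,5) by (auto simp: small_vertices_eq simplex_iff[of _ _ d] all_3_from[of _ d])
  then show ?thesis using that[OF xy * _ _ p] glue_faces[OF *(1)] by simp
qed

lemma VG_occ: "(x, y) \<in> VG \<Longrightarrow> x \<in> occ \<Longrightarrow> y \<in> occ"
  by (erule VG_E) auto

lemma VG_functional:
  assumes "(x, y) \<in> VG" "(x, z) \<in> VG" "x \<in> occ"
  shows "y = z"
proof -
  obtain f p g q c d where 1: "x = (f, p)" "y = (g, q)" "glue S (f, c) = Some (g, d)" "on_edge p c"
    "on_edge q d" "q (d + 1) = p c" "q d = p (c + 1)" "p \<in> small_vertices n"
    using VG_E[OF assms(1,3)] by metis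
  obtain f' p' g' q' c' d' where 2: "x = (f', p')" "z = (g', q')" "glue S (f', c') = Some (g', d')" "on_edge p' c'"
    "on_edge q' d'" "q' (d' + 1) = p' c'" "q' d' = p' (c' + 1)"
    using VG_E[OF assms(2,3)] by metis
  have "c' = c" using on_edge_unique[of p n c' c] 1 2 by auto
  then have "d' = d" "g' = g" using 1 2 by auto
  moreover have "q' = q"
    by (rule coords_eqI[of _ d]) (use 1 2 \<open>c' = c\<close> \<open>d' = d\<close> in \<open>auto simp: on_edge_def\<close>)
  ultimately show ?thesis using 1 2 by simp
qed

text \<open>The gluing of occurrences is a partial involution, so the closure adds at most one
  element.\<close>

lemma class_eq: "x \<in> occ \<Longrightarrow> VG\<^sup>* `` {x} = insert x (VG `` {x})"
proof -
  assume x: "x \<in> occ"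
  have "y = x \<or> (x, y) \<in> VG" if "(x, y) \<in> VG\<^sup>*" for y
    using that
  proof induction
    case (step y z)
    then show ?case using x VG_functional[of y z x] VG_sym[of x y] VG_occ[of x y] by auto
  qed simp
  then show ?thesis by auto
qed

lemma equiv_VG: "equiv UNIV (VG\<^sup>*)"
proof (rule equivI)
  show "sym (VG\<^sup>*)" by (rule sym_rtrancl) (auto intro: symI VG_sym)
qed (auto simp: refl_on_def trans_rtrancl)

lemma Vbar_class: "x \<in> occ \<Longrightarrow> VG\<^sup>* `` {x} \<in> Vbar n S"
  by (auto simp: Vbar_def quotient_def)

lemma Vbar_eq_class: "u \<in> Vbar n S \<Longrightarrow> x \<in> u \<Longrightarrow> u = VG\<^sup>* `` {x}"
  unfolding Vbar_def using equiv_class_eq[OF equiv_VG] by (fastforce elim!: quotientE)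

lemma Vbar_occ: "u \<in> Vbar n S \<Longrightarrow> u \<subseteq> occ"
proof
  fix y assume "u \<in> Vbar n S" "y \<in> u"
  then obtain x where x: "x \<in> occ" "u = VG\<^sup>* `` {x}" unfolding Vbar_def by (auto elim: quotientE)
  then show "y \<in> occ" using \<open>y \<in> u\<close> class_eq[OF x(1)] VG_occ[of x y] by auto
qed

lemma Vbar_nonempty: "u \<in> Vbar n S \<Longrightarrow> \<exists>x. x \<in> u"
  unfolding Vbar_def by (auto elim!: quotientE)

lemma Vbar_eqI: "u \<in> Vbar n S \<Longrightarrow> v \<in> Vbar n S \<Longrightarrow> x \<in> u \<Longrightarrow> x \<in> v \<Longrightarrow> u = v"
  using Vbar_eq_class by metis

lemma Union_Vbar: "\<Union>(Vbar n S) = occ"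
  using Vbar_occ Vbar_class by blast

lemma finite_Vbar: "finite (Vbar n S)"
  using finite_occ finite_UnionD Union_Vbar by metis

lemma finite_class: "u \<in> Vbar n S \<Longrightarrow> finite u"
  using Vbar_occ finite_occ finite_subset by blast

lemma boundary_class:
  assumes "x \<in> Vbar n S" "(t, r) \<in> x" "on_edge r e" "glue S (t, e) = None"
  shows "x = {(t, r)}"
proof -
  have o: "(t, r) \<in> occ" using assms Vbar_occ by blast
  have "VG `` {(t, r)} = {}"
  proof (rule ccontr)
    assume "VG `` {(t, r)} \<noteq> {}"
    then obtain y where "((t, r), y) \<in> VG" by auto
    then show False
    proof (rule VG_E[OF _ o])
      fix f p g q c d
      assume "(t, r) = (f, p)" "glue S (f, c) = Some (g, d)" "on_edge p c" "p \<in> small_vertices n"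
      then show False using assms(4) on_edge_unique[OF _ assms(3), of n c] by auto
    qed
  qed
  then show ?thesis using Vbar_eq_class[OF assms(1,2)] class_eq[OF o] by auto
qed

lemma Vbar_cases:
  assumes "x \<in> Vbar n S" "\<forall>t r e. (t, r) \<in> x \<longrightarrow> on_edge r e \<longrightarrow> glue S (t, e) \<noteq> None"
  obtains t r where "x = {(t, r)}" "\<forall>e. \<not> on_edge r e" "t \<in> faces S" "r \<in> small_vertices n"
  | t r s q c d where "x = {(t, r), (s, q)}" "(t, r) \<noteq> (s, q)" "glue S (t, c) = Some (s, d)" "on_edge r c"
    "on_edge q d" "q (d + 1) = r c" "q d = r (c + 1)" "t \<in> faces S" "s \<in> faces S"
    "r \<in> small_vertices n" "q \<in> small_vertices n"
proof -
  obtain t r where tr: "(t, r) \<in> x" using Vbar_nonempty[OF assms(1)] by auto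
  then have o: "(t, r) \<in> occ" using Vbar_occ assms by blast
  have x: "x = insert (t, r) (VG `` {(t, r)})" using Vbar_eq_class[OF assms(1) tr] class_eq[OF o] by simp
  show ?thesis
  proof (cases "\<exists>c. on_edge r c")
    case False
    then have "VG `` {(t, r)} = {}" by (auto simp: vertex_glue_iff)
    then show ?thesis using that(1)[of t r] x False o by auto
  next
    case True
    then obtain c where c: "on_edge r c" by blast
    then obtain s d where sd: "glue S (t, c) = Some (s, d)" using assms(2) tr c by fast
    \<comment> \<open>The same point seen from the other face, where the two coordinates along the
      edge are exchanged.\<close>
    define q where "q = (\<lambda>e. if e = d then r (c + 1) else if e = d + 1 then r c else 0)"
    have q: "q d = r (c + 1)" "q (d + 1) = r c" "on_edge q d" by (auto simp: q_def on_edge_def)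
    have vg: "((t, r), (s, q)) \<in> VG" unfolding vertex_glue_iff using sd c q by metis
    then have "VG `` {(t, r)} = {(s, q)}" using vg VG_functional[OF vg _ o] by blast
    moreover have "(t, r) \<noteq> (s, q)"
      using glue_neq[OF sd] on_edge_unique[of r n c d] o c q by auto
    moreover have "(s, q) \<in> occ" using VG_occ[OF vg o] .
    ultimately show ?thesis using that(2)[of t r s q c d] x sd c q o by auto
  qed
qed

subsection \<open>The matrix K bar on occurrences\<close>

definition arcs :: "'f \<times> 3 \<Rightarrow> int \<Rightarrow> 'f \<times> coords \<Rightarrow> int" where
  "arcs x k = (\<lambda>(t, p'). \<Sum>e\<in>UNIV. of_bool ((x, (t, e)) \<in> LT\<^sup>+) * Kbar_P3 (arc_vertex n k e) p')"

lemma arcs_0: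
  assumes "p' \<in> simplex n"
  shows "arcs x 0 (t, p') = 0"
proof -
  have "Kbar_P3 (arc_vertex n 0 e) p' = 0" for e
    using Kbar_P3_corner_left[OF arc_vertex_simplex assms, of 0 e "e + 2"] by simp
  then show ?thesis by (simp add: arcs_def)
qed

text \<open>Left turns are unique, so the first arc can be split off; by acyclicity its exit edge is
  not met again and is not counted twice.\<close>

lemma arcs_step:
  assumes "(x, (g, e)) \<in> LT"
  shows "arcs x k (t, p') = of_bool (g = t) * Kbar_P3 (arc_vertex n k e) p' + arcs (g, e) k (t, p')"
proof -
  have "of_bool ((x, (t, e')) \<in> LT\<^sup>+) = of_bool (g = t \<and> e = e') + (of_bool (((g, e), (t, e')) \<in> LT\<^sup>+) :: int)" for e'
    using LT_trancl_from[OF assms, of "(t, e')"] no_cycle[of "(g, e)"] by auto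
  then have "arcs x k (t, p') = (\<Sum>e'\<in>UNIV. of_bool (g = t \<and> e = e') * Kbar_P3 (arc_vertex n k e') p') + arcs (g, e) k (t, p')"
    by (simp add: arcs_def distrib_right sum.distrib del: sum_of_bool_mult_eq)
  moreover have "of_bool (g = t \<and> e = e') * Kbar_P3 (arc_vertex n k e') p' =
      (if e = e' then of_bool (g = t) * Kbar_P3 (arc_vertex n k e) p' else 0)" for e'
    by auto
  ultimately show ?thesis by (simp del: sum_of_bool_mult_eq)
qed

lemma Kbar_occ_arcs:
  assumes "p' \<in> simplex n"
  shows "Kbar_occ n S (f, p) (t, p') =
    of_bool (f = t) * Kbar_P3 p p' + (\<Sum>c\<in>UNIV. arcs (f, c) (p c) (t, p'))"
proof -
  have "(\<Sum>c | p c \<noteq> 0. \<Sum>e | ((f, c), (t, e)) \<in> LT\<^sup>+. Kbar_P3 (arc_vertex n (p c) e) p') =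
    (\<Sum>c | p c \<noteq> 0. arcs (f, c) (p c) (t, p'))"
    by (intro sum.cong refl) (simp add: arcs_def)
  also have "\<dots> = (\<Sum>c\<in>UNIV. arcs (f, c) (p c) (t, p'))"
    by (rule sum.mono_neutral_left) (auto simp: arcs_0 assms)
  finally show ?thesis by (simp add: Kbar_occ_def)
qed

text \<open>A leg is visible at the edge \<open>c\<close> in two ways. Arcs leaving through
  \<open>c\<close> have weight \<open>p d\<close> there, and the reflexive closure includes the main
  segment among them; arcs that entered through \<open>c\<close> leave through \<open>c + 1\<close>
  and have weight \<open>n - p d\<close> there. Arcs leaving through \<open>c + 2\<close> avoid the
  edge.\<close>

lemma Kbar_occ_edge:
  assumes p: "p \<in> simplex n" and r: "r \<in> small_vertices n" "on_edge r c"
  shows "Kbar_occ n S (f, p) (t, r) =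
    (\<Sum>d\<in>UNIV. of_bool (((f, d), (t, c)) \<in> LT\<^sup>*) * edge_val n (p d) (r c) +
       of_bool (((f, d), (t, c + 1)) \<in> LT\<^sup>+) * edge_val n (int n - p d) (r c))"
proof -
  have rs: "r \<in> simplex n" and r0: "0 \<le> r c" using r small_vertices_on_edge(1)[OF r] by (auto simp: small_vertices_eq)
  have pd: "0 \<le> p d" "p d \<le> int n" for d using p by (auto simp: simplex_iff[of _ _ d])
  have arcv: "arc_vertex n (p d) c c = p d" "arc_vertex n (p d) (c + 1) c = int n - p d" "arc_vertex n (p d) (c + 2) c = 0" for d
    by (simp_all add: arc_vertex_def add.assoc)
  have "arcs (f, d) (p d) (t, r) = of_bool (((f, d), (t, c)) \<in> LT\<^sup>+) * edge_val n (p d) (r c) +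
      of_bool (((f, d), (t, c + 1)) \<in> LT\<^sup>+) * edge_val n (int n - p d) (r c)" for d
    unfolding arcs_def using r0 pd[of d]
    by (simp add: sum_3_from[of _ c] Kbar_P3_edge[OF arc_vertex_simplex rs r(2)] arcv)
  moreover have "of_bool (f = t) * Kbar_P3 p r = (\<Sum>d\<in>UNIV. of_bool ((f, d) = (t, c)) * edge_val n (p d) (r c))"
    by (simp add: Kbar_P3_edge[OF p rs r(2)] sum_3_from[of _ c])
  ultimately show ?thesis
    unfolding Kbar_occ_arcs[OF rs] LT_rtrancl_bool by (simp add: sum.distrib distrib_right add_ac)
qed

text \<open>Passing to the other face exchanges the two kinds of arcs at the edge, since what leaves
  one face enters the other; \<open>edge_val_compl\<close> shows that their values are exchanged as
  well.\<close>

lemma Kbar_occ_glue_right: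
  assumes x: "x \<in> occ" and y: "y \<in> occ" and yz: "(y, z) \<in> VG"
  shows "Kbar_occ n S x y = Kbar_occ n S x z"
proof -
  obtain f p where fp: "x = (f, p)" by (cases x)
  have p: "p \<in> simplex n" using x fp by (auto simp: small_vertices_eq)
  obtain t r s q c d where y: "y = (t, r)" "z = (s, q)" and g: "glue S (t, c) = Some (s, d)"
    and e: "on_edge r c" "on_edge q d" and eq: "q (d + 1) = r c" "q d = r (c + 1)"
    and sv: "r \<in> small_vertices n" "q \<in> small_vertices n"
    using VG_E[OF yz y] by metis
  have q: "q d = int n - r c" using small_vertices_on_edge[OF sv(1) e(1)] eq by simp
  have "edge_val n k (int n - a) = edge_val n (int n - k) a" for k a
    using edge_val_compl[of n "int n - k" a] by simp
  moreover have "edge_val n (int n - k) (int n - a) = edge_val n k a" for k a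
    by (rule edge_val_compl)
  ultimately show ?thesis
    unfolding fp y Kbar_occ_edge[OF p sv(1) e(1)] Kbar_occ_edge[OF p sv(2) e(2)]
      LT_trancl_to[OF g] LT_trancl_to[OF glue_sym[OF g]] q
    by (simp add: add.commute)
qed

text \<open>A tripod based on an edge has a leg of weight 0, and each of its two descriptions
  contains the other: the first arc beyond the edge is the main segment seen from the neighbouring
  face.\<close>

lemma Kbar_occ_glue_left:
  assumes x: "x \<in> occ" and xy: "(x, y) \<in> VG" and p': "p' \<in> simplex n"
  shows "Kbar_occ n S x (t, p') = Kbar_occ n S y (t, p')"
proof -
  obtain f p g q c d where y: "x = (f, p)" "y = (g, q)" and g: "glue S (f, c) = Some (g, d)"
    and e: "on_edge p c" "on_edge q d" and eq: "q (d + 1) = p c" "q d = p (c + 1)"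
    and sv: "p \<in> small_vertices n" "q \<in> small_vertices n"
    using VG_E[OF xy x] by metis
  note sp = small_vertices_on_edge[OF sv(1) e(1)] and sq = small_vertices_on_edge[OF sv(2) e(2)]
  have LT: "((f, c), (g, d + 1)) \<in> LT" "((g, d), (f, c + 1)) \<in> LT"
    using g glue_sym[OF g] by (auto simp: left_turn_iff add.assoc)
  \<comment> \<open>The leg of \<open>p\<close> that crosses the edge has its first arc based at
    \<open>q\<close>, and conversely.\<close>
  have av: "arc_vertex n (p c) (d + 1) = q"
    by (rule coords_eqI[of _ d]) (use sp(5) sq(8) eq in \<open>auto simp: arc_vertex_def add.assoc\<close>)
  have av': "arc_vertex n (q d) (c + 1) = p"
    by (rule coords_eqI[of _ c]) (use sp(5,8) sq(8) eq in \<open>auto simp: arc_vertex_def add.assoc\<close>)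
  have "Kbar_occ n S (f, p) (t, p') = of_bool (f = t) * Kbar_P3 p p' + arcs (f, c) (p c) (t, p') + arcs (f, c + 1) (p (c + 1)) (t, p')"
    by (simp add: Kbar_occ_arcs[OF p'] sum_3_from[of _ c] sp(8) arcs_0[OF p'])
  also have "\<dots> = of_bool (f = t) * Kbar_P3 p p' + of_bool (g = t) * Kbar_P3 q p' + arcs (g, d + 1) (q (d + 1)) (t, p') + arcs (f, c + 1) (q d) (t, p')"
    using arcs_step[OF LT(1), of "p c"] by (simp add: av eq)
  also have "\<dots> = of_bool (g = t) * Kbar_P3 q p' + arcs (g, d) (q d) (t, p') + arcs (g, d + 1) (q (d + 1)) (t, p')"
    using arcs_step[OF LT(2), of "q d"] by (simp add: av')
  also have "\<dots> = Kbar_occ n S (g, q) (t, p')"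
    by (simp add: Kbar_occ_arcs[OF p'] sum_3_from[of _ d] sq(8) arcs_0[OF p'])
  finally show ?thesis using y by simp
qed

lemma Kbar_rep:
  assumes "u \<in> Vbar n S" "v \<in> Vbar n S" "x \<in> u" "y \<in> v"
  shows "Kbar n S u v = Kbar_occ n S x y"
proof -
  define x' where "x' = (SOME x. x \<in> u)"
  define y' where "y' = (SOME y. y \<in> v)"
  have x': "x' \<in> u" and y': "y' \<in> v" using assms by (auto simp: x'_def y'_def intro: someI)
  have o: "x \<in> occ" "y \<in> occ" "x' \<in> occ" "y' \<in> occ" using assms x' y' Vbar_occ by blast+
  have "x' = x \<or> (x, x') \<in> VG" using x' Vbar_eq_class[OF assms(1,3)] class_eq[OF o(1)] by auto
  moreover have "snd y' \<in> simplex n" using o by (auto simp: small_vertices_eq)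
  ultimately have "Kbar_occ n S x' y' = Kbar_occ n S x y'"
    using Kbar_occ_glue_left[OF o(1), of x' "snd y'" "fst y'"] by auto
  moreover have "y' = y \<or> (y, y') \<in> VG" using y' Vbar_eq_class[OF assms(2,4)] class_eq[OF o(2)] by auto
  then have "Kbar_occ n S x y' = Kbar_occ n S x y"
    using Kbar_occ_glue_right[OF o(1,2), of y'] by auto
  ultimately show ?thesis by (simp add: Kbar_def x'_def y'_def)
qed

subsection \<open>The product of K bar and Q bar\<close>

definition KQ :: "('f \<times> coords) set \<Rightarrow> ('f \<times> coords) set \<Rightarrow> int" where
  "KQ u x = (\<Sum>y\<in>Vbar n S. Kbar n S u y * Qbar y x)"

definition KQ_occ :: "'f \<times> coords \<Rightarrow> 'f \<times> coords \<Rightarrow> int" where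
  "KQ_occ a = (\<lambda>(t, r). \<Sum>p'\<in>small_vertices n. Kbar_occ n S a (t, p') * Qbar_P3 p' r)"

text \<open>The classes partition the occurrences, so the sum over vertices becomes a sum over all
  occurrences, of which only those in the face of \<open>b\<close> contribute.\<close>

lemma KQ_eq:
  assumes "u \<in> Vbar n S" "x \<in> Vbar n S" "a \<in> u"
  shows "KQ u x = (\<Sum>b\<in>x. KQ_occ a b)"
proof -
  let ?h = "\<lambda>o' b. Kbar_occ n S a o' * (if fst o' = fst b then Qbar_P3 (snd o') (snd b) else 0)"
  have "KQ u x = (\<Sum>y\<in>Vbar n S. \<Sum>o'\<in>y. \<Sum>b\<in>x. ?h o' b)"
    unfolding KQ_def Qbar_def sum_distrib_left
    by (intro sum.cong refl) (simp add: Kbar_rep[OF assms(1) _ assms(3)])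
  also have "\<dots> = (\<Sum>o'\<in>\<Union>(Vbar n S). \<Sum>b\<in>x. ?h o' b)"
    by (rule sum.Union_disjoint[symmetric, unfolded comp_def]) (use finite_class Vbar_eqI in blast)+
  also have "\<dots> = (\<Sum>b\<in>x. \<Sum>o'\<in>occ. ?h o' b)"
    unfolding Union_Vbar by (rule sum.swap)
  also have "\<dots> = (\<Sum>b\<in>x. KQ_occ a b)"
  proof (rule sum.cong[OF refl])
    fix b assume "b \<in> x"
    then have b: "fst b \<in> faces S" using Vbar_occ assms by fastforce
    have "(\<Sum>o'\<in>occ. ?h o' b) = (\<Sum>t\<in>faces S. \<Sum>p'\<in>small_vertices n. ?h (t, p') b)"
      by (simp only: sum.cartesian_product case_prod_unfold fst_conv snd_conv prod.collapse)
    also have "\<dots> = (\<Sum>t\<in>faces S. if t = fst b then KQ_occ a b else 0)"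
      by (intro sum.cong refl) (auto simp: KQ_occ_def split: prod.splits)
    also have "\<dots> = KQ_occ a b" using b finite_faces by simp
    finally show "(\<Sum>o'\<in>occ. ?h o' b) = KQ_occ a b" .
  qed
  finally show ?thesis .
qed

lemma KQ_occ_local:
  "KQ_occ (f, p) (t, r) = of_bool (f = t) * (\<Sum>p'\<in>small_vertices n. Kbar_P3 p p' * Qbar_P3 p' r) +
    (\<Sum>c\<in>UNIV. \<Sum>e\<in>UNIV. of_bool (((f, c), (t, e)) \<in> LT\<^sup>+) *
       (\<Sum>p'\<in>small_vertices n. Kbar_P3 (arc_vertex n (p c) e) p' * Qbar_P3 p' r))"
proof -
  have "KQ_occ (f, p) (t, r) = (\<Sum>p'\<in>small_vertices n. of_bool (f = t) * (Kbar_P3 p p' * Qbar_P3 p' r)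
     + (\<Sum>c\<in>UNIV. \<Sum>e\<in>UNIV. of_bool (((f, c), (t, e)) \<in> LT\<^sup>+) * (Kbar_P3 (arc_vertex n (p c) e) p' * Qbar_P3 p' r)))"
    unfolding KQ_occ_def prod.case
    by (intro sum.cong refl)
      (simp add: Kbar_occ_arcs small_vertices_eq arcs_def distrib_right sum_distrib_right mult.assoc)
  then show ?thesis
    by (simp add: sum.distrib sum_distrib_left sum.swap[of _ UNIV "small_vertices n"] del: sum_of_bool_mult_eq)
qed

text \<open>Arc vertices lie on edges and hence differ from an interior point; only the main segment
  is left.\<close>

lemma KQ_occ_interior:
  assumes "p \<in> simplex n" "r \<in> small_vertices n" "\<forall>c. \<not> on_edge r c"
  shows "KQ_occ (f, p) (t, r) = - 2 * int n * of_bool ((f, p) = (t, r))"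
proof -
  have rs: "r \<in> simplex n" using assms by (auto simp: small_vertices_eq)
  have p: "0 \<le> p d" "p d \<le> int n" for d using assms(1) by (auto simp: simplex_iff[of _ _ d])
  have "on_edge (arc_vertex n k e) (e + 2)" for k e by (simp add: on_edge_def add.assoc)
  then have "arc_vertex n k e \<noteq> r" for k e using assms(3) by metis
  then show ?thesis
    unfolding KQ_occ_local local_sum_interior[OF assms(1) rs assms(3)]
    using local_sum_interior[OF arc_vertex_simplex rs assms(3)] p by simp
qed

text \<open>An arc leaving through \<open>c\<close> is based at a point other than \<open>r\<close>
  and contributes \<open>n\<close> if the weights agree. An arc that entered through
  \<open>c\<close> is then based at \<open>r\<close> itself, and the diagonal term turns
  \<open>n\<close> into \<open>- n\<close>. These opposite signs cancel across a glued edge.\<close>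

lemma KQ_occ_edge:
  assumes p: "p \<in> simplex n" and r: "r \<in> small_vertices n" "on_edge r c"
  shows "KQ_occ (f, p) (t, r) = - 2 * int n * of_bool ((f, p) = (t, r)) +
    int n * (\<Sum>d\<in>UNIV. of_bool (((f, d), (t, c)) \<in> LT\<^sup>* \<and> p d = r c) -
        of_bool (((f, d), (t, c + 1)) \<in> LT\<^sup>+ \<and> int n - p d = r c))"
proof -
  note s = small_vertices_on_edge[OF r]
  have pd: "0 \<le> p d" "p d \<le> int n" for d using p by (auto simp: simplex_iff[of _ _ d])
  note L = local_sum_edge[OF arc_vertex_simplex[OF pd] r]
  have arcv: "arc_vertex n k c c = k" "arc_vertex n k (c + 1) c = int n - k" "arc_vertex n k (c + 2) c = 0"
    "arc_vertex n k c (c + 1) = 0"  for k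
    by (simp_all add: arc_vertex_def add.assoc)
  have ne: "arc_vertex n k c \<noteq> r" "arc_vertex n k (c + 2) \<noteq> r" for k
    using s arcv(3,4)[of k] by auto
  have eq: "arc_vertex n k (c + 1) = r \<longleftrightarrow> int n - k = r c" for k
  proof
    assume "int n - k = r c"
    then show "arc_vertex n k (c + 1) = r"
      by (intro coords_eqI[of _ c]) (use s in \<open>auto simp: arc_vertex_def add.assoc\<close>)
  qed (use arcv(2)[of k] in auto)
  have arc: "(\<Sum>e\<in>UNIV. of_bool (((f, d), (t, e)) \<in> LT\<^sup>+) *
       (\<Sum>p'\<in>small_vertices n. Kbar_P3 (arc_vertex n (p d) e) p' * Qbar_P3 p' r)) =
     int n * (of_bool (((f, d), (t, c)) \<in> LT\<^sup>+ \<and> p d = r c) - of_bool (((f, d), (t, c + 1)) \<in> LT\<^sup>+ \<and> int n - p d = r c))" for d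
    unfolding L sum_3_from[of _ c] arcv eq using s(1) ne by auto
  have "of_bool (f = t) * (of_bool (p c = r c)) = (\<Sum>d\<in>UNIV. of_bool ((f, d) = (t, c) \<and> p d = r c) :: int)"
    by (simp add: sum_3_from[of _ c])
  moreover have "of_bool (((f, d), (t, c)) \<in> LT\<^sup>* \<and> p d = r c) =
      of_bool ((f, d) = (t, c) \<and> p d = r c) + (of_bool (((f, d), (t, c)) \<in> LT\<^sup>+ \<and> p d = r c) :: int)" for d
    using LT_rtrancl_bool[of "(f, d)" "(t, c)"] by (auto simp: of_bool_conj)
  ultimately have *: "(\<Sum>d\<in>UNIV. of_bool (((f, d), (t, c)) \<in> LT\<^sup>* \<and> p d = r c) -
        of_bool (((f, d), (t, c + 1)) \<in> LT\<^sup>+ \<and> int n - p d = r c)) =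
     of_bool (f = t) * (of_bool (p c = r c)) + (\<Sum>d\<in>UNIV. of_bool (((f, d), (t, c)) \<in> LT\<^sup>+ \<and> p d = r c) -
        of_bool (((f, d), (t, c + 1)) \<in> LT\<^sup>+ \<and> int n - p d = r c) :: int)"
    by (simp add: sum.distrib sum_subtractf)
  show ?thesis
    unfolding KQ_occ_local local_sum_edge[OF p r] arc * sum_distrib_left[symmetric] distrib_left
    by (cases "f = t"; cases "p = r") (simp_all del: sum_of_bool_mult_eq sum_of_bool_eq)
qed

lemma KQ_inner:
  assumes u: "u \<in> Vbar n S" and x: "x \<in> Vbar n S"
    and inner: "\<forall>t r e. (t, r) \<in> x \<longrightarrow> on_edge r e \<longrightarrow> glue S (t, e) \<noteq> None"
  shows "KQ u x = - 2 * int n * of_bool (u = x)"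
proof -
  obtain f p where fp: "(f, p) \<in> u" using Vbar_nonempty[OF u] by auto
  then have p: "p \<in> simplex n" using Vbar_occ[OF u] by (auto simp: small_vertices_eq)
  have ux: "u = x \<longleftrightarrow> (f, p) \<in> x" using fp u x Vbar_eqI by blast
  show ?thesis
  proof (cases rule: Vbar_cases[OF x inner])
    case (1 t r)
    then show ?thesis unfolding KQ_eq[OF u x fp] ux by (simp add: KQ_occ_interior[OF p 1(4,2)])
  next
    case (2 t r s q c d)
    have q: "q d = int n - r c" using small_vertices_on_edge[OF 2(10,4)] 2 by simp
    have "int n - p e = q d \<longleftrightarrow> p e = r c" "int n - p e = r c \<longleftrightarrow> p e = q d" for e using q by auto
    \<comment> \<open>By \<open>LT_trancl_to\<close> the legs leaving one face through the edge are
      those counted with the opposite sign in the other face, and their weights match because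
      \<open>q d = n - r c\<close>.\<close>
    then have "KQ_occ (f, p) (t, r) + KQ_occ (f, p) (s, q) = - 2 * int n * (of_bool ((f, p) = (t, r)) + of_bool ((f, p) = (s, q)))"
      unfolding KQ_occ_edge[OF p 2(10,4)] KQ_occ_edge[OF p 2(11,5)]
        LT_trancl_to[OF 2(3)] LT_trancl_to[OF glue_sym[OF 2(3)]]
      by (simp add: sum_subtractf algebra_simps)
    then show ?thesis unfolding KQ_eq[OF u x fp] ux using 2(1,2) by auto
  qed
qed

text \<open>Nothing enters through a boundary edge, so the terms of outgoing legs have no
  counterpart to cancel with. They form the matrix \<open>B\<close> of the overview.\<close>

lemma KQ_boundary:
  assumes u: "u \<in> Vbar n S" and x: "x \<in> Vbar n S" and fp: "(f, p) \<in> u"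
    and tr: "(t, r) \<in> x" and e: "on_edge r e" "glue S (t, e) = None"
  shows "KQ u x = - 2 * int n * of_bool (u = x) +
    int n * (\<Sum>d\<in>UNIV. of_bool (((f, d), (t, e)) \<in> LT\<^sup>* \<and> p d = r e))"
proof -
  have p: "p \<in> simplex n" using fp Vbar_occ[OF u] by (auto simp: small_vertices_eq)
  have r: "r \<in> small_vertices n" using tr Vbar_occ[OF x] by auto
  have ux: "u = x \<longleftrightarrow> (f, p) = (t, r)" using fp u x Vbar_eqI boundary_class[OF x tr e] by blast
  have "KQ u x = KQ_occ (f, p) (t, r)"
    using KQ_eq[OF u x fp] boundary_class[OF x tr e] by simp
  then show ?thesis
    unfolding ux KQ_occ_edge[OF p r e(1)] by (simp add: LT_trancl_to_boundary[OF e(2)])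
qed

lemma Kbar_boundary:
  assumes u: "u \<in> Vbar n S" and x: "x \<in> Vbar n S" and fp: "(f, p) \<in> u"
    and tr: "(t, r) \<in> x" and e: "on_edge r e" "glue S (t, e) = None"
  shows "Kbar n S u x = (\<Sum>d\<in>UNIV. of_bool (((f, d), (t, e)) \<in> LT\<^sup>*) * edge_val n (p d) (r e))"
proof -
  have p: "p \<in> simplex n" using fp Vbar_occ[OF u] by (auto simp: small_vertices_eq)
  have r: "r \<in> small_vertices n" using tr Vbar_occ[OF x] by auto
  show ?thesis
    unfolding Kbar_rep[OF u x fp tr]
    by (simp add: Kbar_occ_edge[OF p r e(1)] LT_trancl_to_boundary[OF e(2)])
qed

end

lemma Qbar_antisym: "Qbar u v = - Qbar v u"
proof -
  have "Qbar u v = (\<Sum>y\<in>v. \<Sum>x\<in>u. if fst x = fst y then Qbar_P3 (snd x) (snd y) else 0)"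
    unfolding Qbar_def by (rule sum.swap)
  also have "\<dots> = (\<Sum>y\<in>v. \<Sum>x\<in>u. - (if fst y = fst x then Qbar_P3 (snd y) (snd x) else 0))"
    by (intro sum.cong refl) (auto simp: Qbar_P3_antisym[of "snd _" "snd _", symmetric] intro: Qbar_P3_antisym)
  finally show ?thesis by (simp add: Qbar_def sum_negf)
qed

section \<open>The boundary and the extended surface\<close>

text \<open>A left turn cuts off the corner where the entry and exit edges meet. This corner bears
  the same name as the exit edge, so a path of left turns, read as a sequence of corners, circles
  round one puncture.\<close>

lemma corner_glue_eq:
  assumes "ideal_triangulation T"
  shows "corner_glue T = left_turn T \<union> (left_turn T)\<inverse>"
proof -
  interpret triangulated T using assms by unfold_locales
  have "{((f, c + 1), (g, d)) | f c g d. glue T (f, c) = Some (g, d)} = (left_turn T)\<inverse>"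
  proof (intro Set.set_eqI iffI)
    fix z assume "z \<in> {((f, c + 1), (g, d)) | f c g d. glue T (f, c) = Some (g, d)}"
    then obtain f c g d where z: "z = ((f, c + 1), (g, d))" "glue T (f, c) = Some (g, d)" by blast
    from glue_sym[OF z(2)] show "z \<in> (left_turn T)\<inverse>" by (simp add: z(1) left_turn_iff add.assoc)
  next
    fix z assume z: "z \<in> (left_turn T)\<inverse>"
    obtain g d f e where "z = ((f, e), (g, d))" by (metis surj_pair)
    moreover from this z have "glue T (g, d) = Some (f, e + 2)" by (simp add: left_turn_iff)
    then have "glue T (f, e + 2) = Some (g, d)" by (rule glue_sym)
    moreover have "e = e + 2 + 1" by (simp add: add.assoc)
    ultimately show "z \<in> {((f, c + 1), (g, d)) | f c g d. glue T (f, c) = Some (g, d)}" by blast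
  qed
  moreover have "{((f, c), (g, d + 1)) | f c g d. glue T (f, c) = Some (g, d)} = left_turn T"
    unfolding left_turn_def by auto
  ultimately show ?thesis unfolding corner_glue_def by simp
qed

locale bordered = triangulated T for T :: "'f triangulation" +
  assumes no_interior_puncture: "\<nexists>P. interior_puncture T P"
begin

lemma LT_succ: "(x, y) \<in> LT\<^sup>+ \<Longrightarrow> glue T x \<noteq> None"
  by (drule tranclD, elim exE conjE) (metis left_turn_iff surj_pair option.distinct(1))

lemma LT_pred:
  assumes "(y, (f, c)) \<in> LT\<^sup>+"
  shows "glue T (f, c + 2) \<noteq> None"
proof -
  obtain z where "(z, (f, c)) \<in> LT" using tranclD2[OF assms] by blast
  then have "glue T z = Some (f, c + 2)" by (simp add: left_turn_iff)
  from glue_sym[OF this] show ?thesis by simp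
qed

lemma LT_faces:
  assumes "(x, y) \<in> LT"
  shows "fst x \<in> faces T \<and> fst y \<in> faces T"
proof -
  have "glue T x = Some (fst y, snd y + 2)" using assms by (cases y) (simp add: left_turn_iff)
  from glue_faces[OF this] show ?thesis by simp
qed

text \<open>Otherwise the corners on a cycle of left turns would form an interior puncture.\<close>

lemma LT_no_cycle: "(x, x) \<notin> LT\<^sup>+"
proof
  assume x: "(x, x) \<in> LT\<^sup>+"
  have cyc: "(x, y) \<in> LT\<^sup>+ \<and> (y, x) \<in> LT\<^sup>+" if "(x, y) \<in> (corner_glue T)\<^sup>*" for y
    using that
  proof induction
    case base
    then show ?case using x by simp
  next
    case (step y z)
    then consider "(y, z) \<in> LT" | "(z, y) \<in> LT" by (auto simp: corner_glue_eq[OF triangulation])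
    then show ?case
    proof cases
      case 1
      obtain w where "(y, w) \<in> LT" "(w, x) \<in> LT\<^sup>*" using step.IH by (meson tranclD)
      then have "(z, x) \<in> LT\<^sup>*" using 1 LT_functional by metis
      then show ?thesis using step.IH 1 x by (metis rtranclD trancl.trancl_into_trancl)
    next
      case 2
      obtain w where "(x, w) \<in> LT\<^sup>*" "(w, y) \<in> LT" using step.IH by (meson tranclD2)
      then have "(x, z) \<in> LT\<^sup>*" using 2 LT_injective by metis
      then show ?thesis using step.IH 2 x by (metis rtranclD trancl_into_trancl2)
    qed
  qed
  define P where "P = (corner_glue T)\<^sup>* `` {x}"
  obtain w where "(x, w) \<in> LT" using tranclD[OF x] by blast
  then have "x \<in> faces T \<times> UNIV" using LT_faces[of x w] by (cases x) auto
  then have "P \<in> punctures T" unfolding punctures_def P_def by (rule quotientI)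
  moreover have "(f, c) \<notin> boundary_edges T \<and> (f, c + 2) \<notin> boundary_edges T" if "(f, c) \<in> P" for f c
  proof -
    have "(x, (f, c)) \<in> LT\<^sup>+" "((f, c), x) \<in> LT\<^sup>+" using cyc that by (auto simp: P_def)
    then show ?thesis using LT_succ[of "(f, c)" x] LT_pred[of x f c] by (auto simp: boundary_edges_def)
  qed
  ultimately have "interior_puncture T P" unfolding interior_puncture_def by blast
  then show False using no_interior_puncture by blast
qed

subsection \<open>Consecutive boundary edges\<close>

abbreviation bd where "bd \<equiv> boundary_edges T"

abbreviation nbe where "nbe \<equiv> next_boundary_edge T"

lemma finite_bd: "finite bd"
proof (rule finite_subset)
  show "bd \<subseteq> faces T \<times> UNIV" by (auto simp: boundary_edges_def)
qed (simp add: finite_faces)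

lemma bd_LT: "y \<in> bd \<Longrightarrow> (y, z) \<notin> LT"
  by (cases z) (auto simp: boundary_edges_def left_turn_iff)

lemma bd_LT_rtrancl: "y \<in> bd \<Longrightarrow> (y, z) \<in> LT\<^sup>* \<Longrightarrow> z = y"
  using bd_LT by (metis converse_rtranclE)

lemma bd_LT_to: "x \<in> bd \<Longrightarrow> (z, (fst x, snd x + 1)) \<notin> LT\<^sup>+"
  using LT_pred[of z "fst x" "snd x + 1"] by (auto simp: boundary_edges_def add.assoc)

text \<open>The corners at a boundary puncture form one chain of left turns, from the edge that
  begins there to the edge that ends there. No left turn continues beyond \<open>y\<close>, so a
  walk in both directions from \<open>y\<close> can only reach corners that precede it.\<close>

lemma nbe_iff: "nbe y x \<longleftrightarrow> x \<in> bd \<and> y \<in> bd \<and> ((fst x, snd x + 1), y) \<in> LT\<^sup>*"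
proof -
  have "(z, y) \<in> LT\<^sup>*" if "y \<in> bd" "(y, z) \<in> (corner_glue T)\<^sup>*" for z
    using that(2)
  proof induction
    case (step z w)
    then consider "(z, w) \<in> LT" | "(w, z) \<in> LT" by (auto simp: corner_glue_eq[OF triangulation])
    then show ?case
    proof cases
      case 1
      from step.IH show ?thesis
      proof (cases rule: converse_rtranclE)
        case base
        then show ?thesis using 1 bd_LT[OF that(1)] by simp
      next
        case (step w')
        then show ?thesis using LT_functional[OF 1] by metis
      qed
    next
      case 2
      then show ?thesis using step.IH by simp
    qed
  qed simp
  moreover have "(y, z) \<in> (corner_glue T)\<^sup>*" if "(z, y) \<in> LT\<^sup>*" for z
  proof -
    have "(y, z) \<in> (LT\<inverse>)\<^sup>*" using that by (simp add: rtrancl_converse)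
    moreover have "LT\<inverse> \<subseteq> corner_glue T" by (auto simp: corner_glue_eq[OF triangulation])
    ultimately show ?thesis using rtrancl_mono by blast
  qed
  ultimately show ?thesis unfolding next_boundary_edge_def by blast
qed

lemma LT_rtrancl_cases:
  "(x, y) \<in> LT\<^sup>* \<Longrightarrow> (x, z) \<in> LT\<^sup>* \<Longrightarrow> (y, z) \<in> LT\<^sup>* \<or> (z, y) \<in> LT\<^sup>*"
proof (induction rule: rtrancl_induct)
  case (step y w)
  then consider "(y, z) \<in> LT\<^sup>*" | "(z, y) \<in> LT\<^sup>*" by blast
  then show ?case
  proof cases
    case 1
    then show ?thesis using step.hyps(2) LT_functional by (metis converse_rtranclE rtrancl.simps)
  next
    case 2
    then show ?thesis using step.hyps(2) by (meson rtrancl.rtrancl_into_rtrancl)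
  qed
qed simp

lemma LT_rtrancl_cases': "(y, x) \<in> LT\<^sup>* \<Longrightarrow> (z, x) \<in> LT\<^sup>* \<Longrightarrow> (y, z) \<in> LT\<^sup>* \<or> (z, y) \<in> LT\<^sup>*"
proof (induction rule: converse_rtrancl_induct)
  case (step y w)
  then consider "(w, z) \<in> LT\<^sup>*" | "(z, w) \<in> LT\<^sup>*" by blast
  then show ?case
  proof cases
    case 1
    then show ?thesis using step.hyps by (meson converse_rtrancl_into_rtrancl)
  next
    case 2
    then show ?thesis using step.hyps LT_injective by (metis converse_rtrancl_into_rtrancl rtrancl.simps)
  qed
qed simp

lemma nbe_left_unique:
  assumes "nbe y x" "nbe y' x"
  shows "y = y'"
proof -
  have "(y, y') \<in> LT\<^sup>* \<or> (y', y) \<in> LT\<^sup>*"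
    using assms LT_rtrancl_cases unfolding nbe_iff by blast
  then show ?thesis using bd_LT_rtrancl[of y y'] bd_LT_rtrancl[of y' y] assms by (auto simp: nbe_iff)
qed

lemma nbe_right_unique:
  assumes "nbe y x" "nbe y x'"
  shows "x = x'"
proof -
  have "((fst x, snd x + 1), (fst x', snd x' + 1)) \<in> LT\<^sup>* \<or> ((fst x', snd x' + 1), (fst x, snd x + 1)) \<in> LT\<^sup>*"
    using assms LT_rtrancl_cases' unfolding nbe_iff by blast
  then have "(fst x, snd x + 1) = (fst x', snd x' + 1)"
    using bd_LT_to[of x] bd_LT_to[of x'] assms by (metis nbe_iff rtranclD)
  then show ?thesis by (simp add: prod_eq_iff)
qed

text \<open>Left turns on finitely many edges without cycles must stop, and they stop only at a
  boundary edge.\<close>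

lemma nbe_left_ex:
  assumes "x \<in> bd"
  shows "\<exists>y. nbe y x"
proof -
  let ?a = "(fst x, snd x + 1)"
  have "LT \<subseteq> (faces T \<times> UNIV) \<times> (faces T \<times> UNIV)" using LT_faces by fastforce
  then have "finite LT" by (rule finite_subset) (simp add: finite_faces)
  then have "wf (LT\<inverse>)" using LT_no_cycle by (intro finite_acyclic_wf_converse) (auto simp: acyclic_def)
  then obtain z where z: "(?a, z) \<in> LT\<^sup>*" "\<And>w. (w, z) \<in> LT\<inverse> \<Longrightarrow> (?a, w) \<notin> LT\<^sup>*"
    using wfE_min[of "LT\<inverse>" ?a "{z. (?a, z) \<in> LT\<^sup>*}"] by auto
  then have no: "(z, w) \<notin> LT" for w by (meson converseI rtrancl.rtrancl_into_rtrancl)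
  have "fst z \<in> faces T"
    using z(1) LT_faces assms by (cases rule: rtranclE) (auto simp: boundary_edges_def)
  moreover have "glue T z = None"
  proof (cases "glue T z")
    case (Some y)
    then have "(z, (fst y, snd y + 1)) \<in> LT" by (simp add: left_turn_iff add.assoc)
    then show ?thesis using no by blast
  qed simp
  ultimately have "z \<in> bd" by (cases z) (simp add: boundary_edges_def)
  then show ?thesis using z(1) assms nbe_iff by blast
qed

lemma nbe_bd: "nbe y x \<Longrightarrow> y \<in> bd" "nbe y x \<Longrightarrow> x \<in> bd"
  by (simp_all add: nbe_iff)

text \<open>The predecessor map is an injection of the finite set \<open>bd\<close> into itself,
  hence onto.\<close>

lemma nbe_right_ex:
  assumes "y \<in> bd"
  shows "\<exists>x. nbe y x"
proof -
  define prev where "prev = (\<lambda>x. SOME y. nbe y x)"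
  have p: "nbe (prev x) x" if "x \<in> bd" for x
    using nbe_left_ex[OF that] unfolding prev_def by (rule someI_ex)
  have "inj_on prev bd" using p nbe_right_unique by (metis inj_onI)
  moreover have "prev ` bd \<subseteq> bd" using p nbe_bd by blast
  ultimately have "prev ` bd = bd" by (simp add: endo_inj_surj finite_bd)
  then show ?thesis using assms p by (metis imageE)
qed

lemma boundary_component_ex:
  assumes "x \<in> bd"
  obtains es where "boundary_component T es" "es ! 0 = x"
proof -
  \<comment> \<open>Continued by the identity outside \<open>bd\<close>, so that the map is
    injective on the whole type and its orbits of finite range are periodic.\<close>
  define nxt where "nxt = (\<lambda>y. if y \<in> bd then SOME x. nbe y x else y)"
  have nxt: "nbe y (nxt y)" if "y \<in> bd" for y
    using someI_ex[OF nbe_right_ex[OF that]] that by (simp add: nxt_def)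
  have nxt_bd: "nxt y \<in> bd \<longleftrightarrow> y \<in> bd" for y using nxt[of y] nbe_bd(2)[of y "nxt y"] by (auto simp: nxt_def)
  have inj: "inj nxt"
  proof (rule injI)
    fix y z assume eq: "nxt y = nxt z"
    show "y = z"
    proof (cases "y \<in> bd")
      case True
      then have "z \<in> bd" using eq nxt_bd by metis
      then show ?thesis using nxt[OF True] nxt[of z] eq nbe_left_unique by metis
    next
      case False
      then have "z \<notin> bd" using eq nxt_bd by metis
      then show ?thesis using eq False by (simp add: nxt_def)
    qed
  qed
  have iter: "(nxt ^^ k) x \<in> bd" for k by (induction k) (simp_all add: nxt_bd assms)
  then have "finite {y. \<exists>k. y = (nxt ^^ k) x}" by (intro finite_subset[OF _ finite_bd]) auto
  then obtain m where m: "0 < m" "(nxt ^^ m) x = x" using funpow_inj_finite[OF inj] by blast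
  \<comment> \<open>The least period, so that the list of iterates is distinct and closes up after
    its last entry.\<close>
  define r where "r = (LEAST r. 0 < r \<and> (nxt ^^ r) x = x)"
  have r: "0 < r" "(nxt ^^ r) x = x" using LeastI[of "\<lambda>r. 0 < r \<and> (nxt ^^ r) x = x" m] m by (simp_all add: r_def)
  have least: "(nxt ^^ k) x \<noteq> x" if "0 < k" "k < r" for k
    using not_less_Least[of k "\<lambda>r. 0 < r \<and> (nxt ^^ r) x = x"] that by (auto simp: r_def)
  define es where "es = map (\<lambda>k. (nxt ^^ k) x) [0..<r]"
  have es: "length es = r" "\<And>j. j < r \<Longrightarrow> es ! j = (nxt ^^ j) x" by (simp_all add: es_def)
  have "distinct es"
    unfolding es_def distinct_map using inj_on_funpow_least[OF r(2) least] by simp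
  moreover have "nbe (es ! j) (es ! (Suc j mod length es))" if "j < r" for j
  proof -
    have "es ! (Suc j mod length es) = (nxt ^^ Suc j) x"
      using that r es by (cases "Suc j = r") auto
    then show ?thesis using nxt[OF iter[of j]] es(2)[OF that] by simp
  qed
  ultimately have "boundary_component T es"
    using r(1) es by (auto simp: boundary_component_def)
  then show ?thesis using that es(2)[of 0] r(1) by simp
qed

subsection \<open>The extended surface\<close>

abbreviation S where "S \<equiv> extended T"

lemma glue_ext:
  "glue S (Inl f, c) = (if (f, c) \<in> bd then Some (Inr (f, c), 1) else map_option (\<lambda>(g, d). (Inl g, d)) (glue T (f, c)))"
  "glue S (Inr x, c) = (if x \<in> bd \<and> c = 1 then Some (Inl (fst x), snd x) else None)"
  "faces S = Inl ` faces T \<union> Inr ` bd"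
  by (simp_all add: extended_def)

lemma bd_iff: "(f, c) \<in> bd \<longleftrightarrow> f \<in> faces T \<and> glue T (f, c) = None"
  by (simp add: boundary_edges_def)

lemma triangulation_ext: "ideal_triangulation S"
proof -
  have "fst x \<in> faces S \<and> fst y \<in> faces S \<and> x \<noteq> y \<and> glue S y = Some x" if g: "glue S x = Some y" for x y
  proof (cases "fst x")
    case (Inl f)
    then obtain c where x: "x = (Inl f, c)" by (cases x) auto
    show ?thesis
    proof (cases "(f, c) \<in> bd")
      case True
      then show ?thesis using g by (auto simp: x glue_ext bd_iff)
    next
      case False
      then obtain h d where hd: "glue T (f, c) = Some (h, d)" "y = (Inl h, d)"
        using g by (auto simp: x glue_ext)
      then show ?thesis using glue_sym[OF hd(1)] glue_faces[OF hd(1)] glue_neq[OF hd(1)]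
        by (auto simp: x glue_ext bd_iff)
    qed
  next
    case (Inr b)
    then obtain c where x: "x = (Inr b, c)" by (cases x) auto
    then show ?thesis using g by (cases b) (auto simp: glue_ext bd_iff split: if_splits)
  qed
  moreover have "finite (faces S)" by (simp add: glue_ext finite_faces finite_bd)
  ultimately show ?thesis unfolding ideal_triangulation_def by blast
qed

abbreviation LTS where "LTS \<equiv> left_turn S"

text \<open>An attached triangle can be entered only through its edge 1, from which a left turn
  leads out through edge 2.\<close>

lemma LTS_iff:
  "((Inl f, c), (Inl g, e)) \<in> LTS \<longleftrightarrow> ((f, c), (g, e)) \<in> LT"
  "((Inl f, c), (Inr x, e)) \<in> LTS \<longleftrightarrow> x = (f, c) \<and> x \<in> bd \<and> e = 2"
  "((Inr x, c), (Inl g, e)) \<in> LTS \<longleftrightarrow> x \<in> bd \<and> c = 1 \<and> (g, e) = (fst x, snd x + 1)"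
  "((Inr x, c), (Inr y, e)) \<notin> LTS"
proof -
  have e: "e + 2 = 1 \<longleftrightarrow> e = 2" using three_cases[of e] by auto
  have e': "d = e + 2 \<longleftrightarrow> e = d + 1" for d using three_cases[of e] three_cases[of d] by (elim disjE) simp_all
  show "((Inl f, c), (Inl g, e)) \<in> LTS \<longleftrightarrow> ((f, c), (g, e)) \<in> LT"
    by (auto simp: left_turn_iff glue_ext bd_iff)
  show "((Inl f, c), (Inr x, e)) \<in> LTS \<longleftrightarrow> x = (f, c) \<and> x \<in> bd \<and> e = 2"
    using e by (auto simp: left_turn_iff glue_ext)
  show "((Inr x, c), (Inl g, e)) \<in> LTS \<longleftrightarrow> x \<in> bd \<and> c = 1 \<and> (g, e) = (fst x, snd x + 1)"
    using e'[of "snd x"] by (auto simp: left_turn_iff glue_ext)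
  show "((Inr x, c), (Inr y, e)) \<notin> LTS"
    by (auto simp: left_turn_iff glue_ext)
qed

lemma LTS_Inr: "c \<noteq> 1 \<Longrightarrow> ((Inr x, c), z) \<notin> LTS"
  by (cases z; cases "fst z") (auto simp: LTS_iff)

lemma LTS_lift: "((f, c), (g, e)) \<in> LT\<^sup>* \<Longrightarrow> ((Inl f, c), (Inl g, e)) \<in> LTS\<^sup>*"
proof (induction rule: rtrancl_induct2)
  case (step g e h d)
  then show ?case using LTS_iff(1)[of g e h d] by (meson rtrancl.rtrancl_into_rtrancl)
qed simp

lemma LTS_trancl_Inl:
  assumes "((Inl f, c), z) \<in> LTS\<^sup>+"
  shows "(\<exists>g e. ((f, c), (g, e)) \<in> LT\<^sup>+ \<and> z = (Inl g, e)) \<or> (\<exists>x\<in>bd. ((f, c), x) \<in> LT\<^sup>* \<and> z = (Inr x, 2))"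
  using assms
proof induction
  case (base y)
  obtain t e where y: "y = (t, e)" by (cases y)
  show ?case
  proof (cases t)
    case (Inl g)
    then have "((f, c), (g, e)) \<in> LT" using base y by (simp add: LTS_iff)
    then show ?thesis using y Inl by blast
  next
    case (Inr x)
    then show ?thesis using base y by (auto simp: LTS_iff)
  qed
next
  case (step y z)
  from step.IH show ?case
  proof (elim disjE exE bexE conjE)
    fix g e assume y: "((f, c), (g, e)) \<in> LT\<^sup>+" "y = (Inl g, e)"
    obtain t d where z: "z = (t, d)" by (cases z)
    show ?thesis
    proof (cases t)
      case (Inl h)
      then have "((g, e), (h, d)) \<in> LT" using step.hyps y z by (simp add: LTS_iff)
      then have "((f, c), (h, d)) \<in> LT\<^sup>+" using y(1) by simp
      then show ?thesis using z Inl by blast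
    next
      case (Inr x)
      then show ?thesis using step.hyps y z by (auto simp: LTS_iff trancl_into_rtrancl)
    qed
  next
    fix x assume "y = (Inr x, 2)"
    then show ?thesis using step.hyps LTS_Inr[of 2 x z] by simp
  qed
qed

lemma LTS_Inl_Inr2: "((Inl f, c), (Inr x, 2)) \<in> LTS\<^sup>* \<longleftrightarrow> x \<in> bd \<and> ((f, c), x) \<in> LT\<^sup>*"
proof
  assume "((Inl f, c), (Inr x, 2)) \<in> LTS\<^sup>*"
  then show "x \<in> bd \<and> ((f, c), x) \<in> LT\<^sup>*"
    using LTS_trancl_Inl[of f c "(Inr x, 2)"] by (auto simp: rtrancl_eq_or_trancl)
next
  assume x: "x \<in> bd \<and> ((f, c), x) \<in> LT\<^sup>*"
  then have "((Inl f, c), (Inl (fst x), snd x)) \<in> LTS\<^sup>*" by (intro LTS_lift) simp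
  moreover have "((Inl (fst x), snd x), (Inr x, 2)) \<in> LTS" using x by (simp add: LTS_iff)
  ultimately show "((Inl f, c), (Inr x, 2)) \<in> LTS\<^sup>*" by simp
qed

text \<open>A left turn inside an attached triangle leads to edge 2, never to edge 3.\<close>

lemma LTS_Inl_Inr3: "((Inl f, c), (Inr x, 3)) \<notin> LTS\<^sup>*"
  using LTS_trancl_Inl[of f c "(Inr x, 3)"] by (auto simp: rtrancl_eq_or_trancl)

lemma LTS_Inr_not1: "c \<noteq> 1 \<Longrightarrow> ((Inr x, c), z) \<in> LTS\<^sup>* \<longleftrightarrow> z = (Inr x, c)"
  using LTS_Inr by (metis converse_rtranclE rtrancl.rtrancl_refl)

lemma LTS_Inr1:
  assumes "x \<in> bd" "e \<noteq> 1"
  shows "((Inr x, 1), (Inr y, e)) \<in> LTS\<^sup>* \<longleftrightarrow> ((Inl (fst x), snd x + 1), (Inr y, e)) \<in> LTS\<^sup>*"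
proof
  assume "((Inr x, 1), (Inr y, e)) \<in> LTS\<^sup>*"
  then show "((Inl (fst x), snd x + 1), (Inr y, e)) \<in> LTS\<^sup>*"
  proof (cases rule: converse_rtranclE)
    case (step z)
    obtain t d where "z = (t, d)" by (cases z)
    then show ?thesis using step by (cases t) (auto simp: LTS_iff)
  qed (use assms in auto)
next
  assume "((Inl (fst x), snd x + 1), (Inr y, e)) \<in> LTS\<^sup>*"
  moreover have "((Inr x, 1), (Inl (fst x), snd x + 1)) \<in> LTS" using assms by (simp add: LTS_iff)
  ultimately show "((Inr x, 1), (Inr y, e)) \<in> LTS\<^sup>*" by (meson converse_rtrancl_into_rtrancl)
qed

text \<open>The leg leaving the triangle at \<open>x\<close> through edge 1 turns round the puncture
  where \<open>x\<close> begins and comes out at the preceding boundary edge. In this way the cyclic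
  order of the boundary enters the matrices.\<close>

lemma LTS_Inr1_Inr2: "x \<in> bd \<Longrightarrow> ((Inr x, 1), (Inr y, 2)) \<in> LTS\<^sup>* \<longleftrightarrow> nbe y x"
  by (auto simp: LTS_Inr1 LTS_Inl_Inr2 nbe_iff)

lemma LTS_Inr1_Inr3: "x \<in> bd \<Longrightarrow> ((Inr x, 1), (Inr y, 3)) \<notin> LTS\<^sup>*"
  by (simp add: LTS_Inr1 LTS_Inl_Inr3)

text \<open>A path that enters an attached triangle ends at its edge 2, so a cycle would already be
  one in \<open>T\<close>.\<close>

lemma LTS_no_cycle: "(z, z) \<notin> LTS\<^sup>+"
proof
  assume z: "(z, z) \<in> LTS\<^sup>+"
  obtain t c where tc: "z = (t, c)" by (cases z)
  show False
  proof (cases t)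
    case (Inl f)
    then show ?thesis using LTS_trancl_Inl[of f c z] z tc LT_no_cycle by auto
  next
    case (Inr x)
    obtain w where w: "(z, w) \<in> LTS" "(w, z) \<in> LTS\<^sup>*" using z by (meson tranclD)
    then have c: "c = 1" using LTS_Inr[of c x w] tc Inr by auto
    obtain g e where "w = (Inl g, e)" using w(1) tc Inr LTS_iff(4) by (metis surj_pair sum.exhaust)
    then have "((Inl g, e), z) \<in> LTS\<^sup>+" using w(2) tc Inr by (auto simp: rtrancl_eq_or_trancl)
    then show ?thesis using LTS_trancl_Inl[of g e z] tc Inr c by auto
  qed
qed

end

section \<open>The matrices of the extended surface\<close>

lemma on_edge_simps [simp]: "on_edge p 1 \<longleftrightarrow> p 3 = 0" "on_edge p 2 \<longleftrightarrow> p 1 = 0" "on_edge p 3 \<longleftrightarrow> p 2 = 0"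
proof -
  have eqs: "(1::3) + 2 = 3" "(2::3) + 2 = 1" "(3::3) + 2 = 2" by simp_all
  then show "on_edge p 1 \<longleftrightarrow> p 3 = 0" "on_edge p 2 \<longleftrightarrow> p 1 = 0" "on_edge p 3 \<longleftrightarrow> p 2 = 0"
    unfolding on_edge_def by (simp_all only: eqs)
qed

lemma pt_small_vertex:
  assumes "0 < i" "i < int n"
  shows "pt 0 i (int n - i) \<in> small_vertices n" "pt i 0 (int n - i) \<in> small_vertices n"
  using assms by (auto simp: small_vertices_eq simplex_def all_3)

lemma sum_3: "(\<Sum>d\<in>UNIV. f (d::3)) = f 1 + f 2 + (f 3 :: 'a::ab_group_add)"
  by (simp add: sum_1_2_3)

locale bordered_n = bordered T for n :: nat and T :: "'f triangulation" +
  assumes n2: "2 \<le> n"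

sublocale bordered_n \<subseteq> ext: surface n "extended T"
  by unfold_locales (rule triangulation_ext, rule LTS_no_cycle)

context bordered_n
begin

section \<open>Vertices of the extended surface\<close>

abbreviation W where "W \<equiv> Vbar n (extended T)"
abbreviation V where "V \<equiv> V_ext n T"
abbreviation V' where "V' \<equiv> V'_ext n T"

text \<open>The parameters on edges 2 and 3 are chosen so that \<open>e2 x i\<close> is the
  projection of \<open>e3 x i\<close>: both have last coordinate \<open>n - i\<close>.\<close>

definition e2 :: "'f \<times> 3 \<Rightarrow> int \<Rightarrow> 'f ext_vertex" where
  "e2 x i = {(Inr x, pt 0 i (int n - i))}"

definition e3 :: "'f \<times> 3 \<Rightarrow> int \<Rightarrow> 'f ext_vertex" where
  "e3 x i = {(Inr x, pt i 0 (int n - i))}"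

lemma e2_eq_iff [simp]: "e2 x i = e2 y j \<longleftrightarrow> x = y \<and> i = j"
  by (metis e2_def singleton_inject prod.inject sum.inject(2) pt_apply(2))

lemma e3_neq_e2: "0 < i \<Longrightarrow> e3 x i \<noteq> e2 y j"
  by (metis e2_def e3_def singleton_inject prod.inject pt_apply(1) less_irrefl)

lemma V_subset: "V \<subseteq> W" and V'_subset: "V' \<subseteq> W"
  by (auto simp: V_ext_def V'_ext_def)

lemma V_I: "v \<in> W \<Longrightarrow> (\<And>x p. (Inr x, p) \<in> v \<Longrightarrow> p 2 \<noteq> 0) \<Longrightarrow> v \<in> V"
  and V_D: "v \<in> V \<Longrightarrow> (Inr x, p) \<in> v \<Longrightarrow> p 2 \<noteq> 0"
  and V'_I: "v \<in> W \<Longrightarrow> (\<And>x p. (Inr x, p) \<in> v \<Longrightarrow> p 1 \<noteq> 0) \<Longrightarrow> v \<in> V'"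
  and V'_D: "v \<in> V' \<Longrightarrow> (Inr x, p) \<in> v \<Longrightarrow> p 1 \<noteq> 0"
  unfolding V_ext_def V'_ext_def on_edge_simps by blast+

lemma finite_V: "finite V" and finite_V': "finite V'"
  using V_subset V'_subset ext.finite_Vbar finite_subset by blast+

lemma Inr_class:
  assumes "v \<in> W" "(Inr x, p) \<in> v"
  shows "x \<in> bd" "p \<in> small_vertices n" "p \<in> simplex n"
proof -
  have "(Inr x, p) \<in> faces S \<times> small_vertices n" using assms ext.Vbar_occ by blast
  then show "x \<in> bd" "p \<in> small_vertices n" "p \<in> simplex n" by (auto simp: glue_ext small_vertices_eq)
qed

lemma glue_Inr: "c \<noteq> 1 \<Longrightarrow> glue S (Inr x, c) = None"
  by (simp add: glue_ext)

lemma attached_class: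
  assumes "x \<in> bd" "p \<in> small_vertices n" "on_edge p c" "c \<noteq> 1"
  shows "(vertex_glue S)\<^sup>* `` {(Inr x, p)} = {(Inr x, p)}" "{(Inr x, p)} \<in> W"
proof -
  have W: "(vertex_glue S)\<^sup>* `` {(Inr x, p)} \<in> W"
    using assms by (intro ext.Vbar_class) (simp add: glue_ext)
  show "(vertex_glue S)\<^sup>* `` {(Inr x, p)} = {(Inr x, p)}"
    by (rule ext.boundary_class[OF W _ assms(3) glue_Inr[OF assms(4)]]) simp
  then show "{(Inr x, p)} \<in> W" using W by simp
qed

lemma attached_vertex_eq: "x \<in> bd \<Longrightarrow> 0 < i \<Longrightarrow> i < n \<Longrightarrow> attached_vertex n T i x = e3 x (int i)"
  unfolding attached_vertex_def e3_def
  by (rule attached_class(1)[where c = 3]) (auto intro: pt_small_vertex)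

lemma e2_W: "x \<in> bd \<Longrightarrow> 0 < i \<Longrightarrow> i < int n \<Longrightarrow> e2 x i \<in> W"
  unfolding e2_def by (rule attached_class(2)[where c = 2]) (auto intro: pt_small_vertex)

lemma e3_W: "x \<in> bd \<Longrightarrow> 0 < i \<Longrightarrow> i < int n \<Longrightarrow> e3 x i \<in> W"
  unfolding e3_def by (rule attached_class(2)[where c = 3]) (auto intro: pt_small_vertex)

lemma e2_V: "x \<in> bd \<Longrightarrow> 0 < i \<Longrightarrow> i < int n \<Longrightarrow> e2 x i \<in> V"
  using e2_W by (intro V_I) (auto simp: e2_def)

lemma e3_V': "x \<in> bd \<Longrightarrow> 0 < i \<Longrightarrow> i < int n \<Longrightarrow> e3 x i \<in> V'"
  using e3_W by (intro V'_I) (auto simp: e3_def)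

lemma e3_not_V: "e3 x i \<notin> V"
  using V_D[of "e3 x i" x "pt i 0 (int n - i)"] by (auto simp: e3_def)

lemma on_edge_2_e2:
  assumes "v \<in> W" "(Inr x, p) \<in> v" "on_edge p 2"
  shows "x \<in> bd" "0 < p 2" "p 2 < int n" "v = e2 x (p 2)"
proof -
  note p = Inr_class[OF assms(1,2)]
  show "x \<in> bd" by (rule p)
  note s = small_vertices_on_edge[OF p(2) assms(3)]
  show "0 < p 2" "p 2 < int n" using s by auto
  have "p 1 = 0" "p 3 = int n - p 2" using assms(3) p(3) by (auto simp: simplex_def)
  then have "p = pt 0 (p 2) (int n - p 2)" using pt_eta[of p] by simp
  moreover have "v = {(Inr x, p)}"
    by (rule ext.boundary_class[OF assms glue_Inr]) simp
  ultimately show "v = e2 x (p 2)" unfolding e2_def by simp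
qed

definition inner :: "'f ext_vertex \<Rightarrow> bool" where
  "inner v \<longleftrightarrow> (\<forall>t r e. (t, r) \<in> v \<longrightarrow> on_edge r e \<longrightarrow> glue S (t, e) \<noteq> None)"

lemma e2_not_inner: "\<not> inner (e2 x i)"
  unfolding inner_def e2_def using glue_Inr[of 2 x] by (auto intro!: exI[of _ 2])

text \<open>Every boundary edge of the extended surface is edge 2 or edge 3 of an attached triangle,
  and \<open>V\<close> leaves out the vertices on edge 3.\<close>

lemma V_cases:
  assumes "v \<in> V"
  obtains "inner v" | x i where "x \<in> bd" "0 < i" "i < int n" "v = e2 x i"
proof (cases "inner v")
  case False
  then obtain t r e where tr: "(t, r) \<in> v" "on_edge r e" "glue S (t, e) = None"
    unfolding inner_def by blast
  have v: "v \<in> W" using assms V_subset by blast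
  show ?thesis
  proof (cases t)
    case (Inl f)
    have "(t, r) \<in> faces S \<times> small_vertices n" using v tr(1) ext.Vbar_occ by blast
    then have "f \<in> faces T" using Inl by (auto simp: glue_ext)
    then show ?thesis using tr(3) Inl by (auto simp: glue_ext bd_iff split: if_splits)
  next
    case (Inr x)
    then have "e \<noteq> 1" "e \<noteq> 3"
      using tr V_D[OF assms, of x r] Inr_class(1)[OF v, of x r] by (auto simp: glue_ext)
    then have "e = 2" using three_cases[of e] by auto
    then show ?thesis using on_edge_2_e2[OF v, of x r] tr Inr that(2) by blast
  qed
qed (use that in blast)

lemma not_in_original:
  assumes v: "v \<in> W" and no: "\<not> in_original v"
  obtains x p where "v = {(Inr x, p)}" "x \<in> bd" "p \<in> small_vertices n" "p 3 \<noteq> 0"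
proof -
  obtain t p where tp: "(t, p) \<in> v" using ext.Vbar_nonempty[OF v] by auto
  then obtain x where t: "t = Inr x" using no by (cases t) (auto simp: in_original_def)
  note p = Inr_class[OF v tp[unfolded t]]
  have o: "(Inr x, p) \<in> faces S \<times> small_vertices n" using p by (auto simp: glue_ext)
  have cls: "v = insert (Inr x, p) (vertex_glue S `` {(Inr x, p)})"
    using ext.Vbar_eq_class[OF v tp] ext.class_eq[OF o] t by simp
  have p3: "p 3 \<noteq> 0"
  proof
    assume p3: "p 3 = 0"
    define q where "q = (\<lambda>e. if e = snd x then p 2 else if e = snd x + 1 then p 1 else 0)"
    have q: "q (snd x) = p (1 + 1)" "q (snd x + 1) = p 1" "on_edge q (snd x)" "on_edge p 1" 
      using p3 by (auto simp: q_def on_edge_def)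
    have g: "glue S (Inr x, 1) = Some (Inl (fst x), snd x)" using p by (simp add: glue_ext)
    have "((Inr x, p), (Inl (fst x), q)) \<in> vertex_glue S"
      unfolding vertex_glue_iff using g q by blast
    then have "(Inl (fst x), q) \<in> v" using cls by blast
    then show False using no by (auto simp: in_original_def)
  qed
  have "y \<notin> vertex_glue S `` {(Inr x, p)}" for y
  proof
    assume "y \<in> vertex_glue S `` {(Inr x, p)}"
    moreover obtain g q where "y = (g, q)" by (cases y)
    ultimately obtain c d where "glue S (Inr x, c) = Some (g, d)" "on_edge p c"
      by (auto simp: vertex_glue_iff)
    then show False using p3 glue_Inr[of c x] by (cases "c = 1") auto
  qed
  then have "v = {(Inr x, p)}" using cls by blast
  then show ?thesis using that p p3 by blast
qed

section \<open>Sums against the rows of \<open>C\<close>\<close>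

lemma C_sum_original:
  assumes "w \<in> V'" "in_original w"
  shows "(\<Sum>u\<in>W. C_mat n w u * g u) = g w"
proof -
  have "(\<Sum>u\<in>W. C_mat n w u * g u) = (\<Sum>u\<in>W. if w = u then g w else 0)"
    using assms by (intro sum.cong) (auto simp: C_mat_def)
  then show ?thesis using assms V'_subset by (simp add: ext.finite_Vbar subset_iff)
qed

lemma C_sum_attached:
  assumes w: "{(Inr x, p)} \<in> V'" and p3: "p 3 \<noteq> 0"
  shows "(\<Sum>u\<in>W. C_mat n {(Inr x, p)} u * g u) = g {(Inr x, p)} - g (e2 x (int n - p 3))"
    "x \<in> bd" "0 < int n - p 3" "int n - p 3 < int n"
proof -
  let ?w = "{(Inr x, p)} :: 'f ext_vertex"
  have wW: "?w \<in> W" using w V'_subset by blast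
  note p = Inr_class[OF wW, of x p, simplified]
  have p1: "p 1 \<noteq> 0" using V'_D[OF w] by simp
  show x: "x \<in> bd" and i: "0 < int n - p 3" "int n - p 3 < int n" using p p1 p3 by (auto simp: simplex_def all_3)
  let ?e = "e2 x (int n - p 3)"
  have proj: "is_proj n ?w u \<longleftrightarrow> u = ?e" if "u \<in> W" for u
  proof -
    have "is_proj n ?w u \<longleftrightarrow> (Inr x, pt 0 (int n - p 3) (p 3)) \<in> u"
      using p3 by (auto simp: is_proj_def)
    also have "\<dots> \<longleftrightarrow> u = ?e"
    proof -
      have "(Inr x, pt 0 (int n - p 3) (p 3)) \<in> ?e" by (simp add: e2_def)
      then show ?thesis using ext.Vbar_eqI[OF that e2_W[OF x i]] by blast
    qed
    finally show ?thesis .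
  qed
  have ne: "?w \<noteq> ?e" using p1 by (metis e2_def singleton_inject prod.inject pt_apply(1))
  have no: "\<not> in_original ?w" by (auto simp: in_original_def)
  have "(\<Sum>u\<in>W. C_mat n ?w u * g u) = (\<Sum>u\<in>W. (if ?w = u then g ?w else 0) - (if ?e = u then g ?e else 0))"
    using ne no by (intro sum.cong) (auto simp: C_mat_def proj)
  then show "(\<Sum>u\<in>W. C_mat n ?w u * g u) = g ?w - g ?e"
    using wW e2_W[OF x i] by (simp add: sum_subtractf ext.finite_Vbar)
qed

lemma C_sum_cases:
  assumes "w \<in> V'"
  obtains "in_original w" "\<And>g :: 'f ext_vertex \<Rightarrow> int. (\<Sum>u\<in>W. C_mat n w u * g u) = g w"
  | x p where "w = {(Inr x, p)}" "x \<in> bd" "p 3 \<noteq> 0" "0 < int n - p 3" "int n - p 3 < int n"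
     "\<And>g :: 'f ext_vertex \<Rightarrow> int. (\<Sum>u\<in>W. C_mat n w u * g u) = g w - g (e2 x (int n - p 3))"
proof (cases "in_original w")
  case True
  then show ?thesis using that(1) C_sum_original[OF assms] by blast
next
  case False
  obtain x p where "w = {(Inr x, p)}" "p 3 \<noteq> 0"
    using not_in_original[of w] False assms V'_subset by blast
  then show ?thesis using that(2) C_sum_attached[of x p] assms by blast
qed

lemma C_sum_e3:
  fixes g :: "'f ext_vertex \<Rightarrow> int"
  assumes "x \<in> bd" "0 < i" "i < int n"
  shows "(\<Sum>u\<in>W. C_mat n (e3 x i) u * g u) = g (e3 x i) - g (e2 x i)"
  using C_sum_attached(1)[of x "pt i 0 (int n - i)" g] e3_V'[OF assms] assms by (simp add: e3_def)

subsection \<open>The matrix K\<close>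

lemma Kbar_e2:
  assumes "u \<in> W" "(f, p) \<in> u" "b \<in> bd" "0 < t" "t < int n"
  shows "Kbar n S u (e2 b t) = (\<Sum>d\<in>UNIV. of_bool (((f, d), (Inr b, 2)) \<in> LTS\<^sup>*) * edge_val n (p d) t)"
  using ext.Kbar_boundary[OF assms(1) e2_W[OF assms(3-5)] assms(2), of "Inr b" "pt 0 t (int n - t)" 2]
    glue_Inr[of 2 b] by (simp add: e2_def)

lemma KQ_e2:
  assumes "u \<in> W" "(f, p) \<in> u" "b \<in> bd" "0 < t" "t < int n"
  shows "ext.KQ u (e2 b t) = - 2 * int n * of_bool (u = e2 b t) +
    int n * (\<Sum>d\<in>UNIV. of_bool (((f, d), (Inr b, 2)) \<in> LTS\<^sup>* \<and> p d = t))"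
  using ext.KQ_boundary[OF assms(1) e2_W[OF assms(3-5)] assms(2), of "Inr b" "pt 0 t (int n - t)" 2]
    glue_Inr[of 2 b] by (simp add: e2_def)

text \<open>Edge 3 of an attached triangle is met only by the leg through edge 3 of a tripod in that
  triangle. The projection keeps the third coordinate, so \<open>C\<close> subtracts an equal value.
  This allows sums over \<open>V\<close> to be extended to all vertices.\<close>

lemma K_mat_outside:
  assumes v: "v \<in> V'" and w: "w \<in> W" "w \<notin> V"
  shows "K_mat n T v w = 0"
proof -
  obtain x p where p: "(Inr x, p) \<in> w" "on_edge p 3" using w V_I unfolding on_edge_simps by blast
  have K: "Kbar n S u w = (\<Sum>d\<in>UNIV. of_bool (((f, d), (Inr x, 3)) \<in> LTS\<^sup>*) * edge_val n (q d) (p 3))"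
    if "u \<in> W" "(f, q) \<in> u" for u f q
    using ext.Kbar_boundary[OF that(1) w(1) that(2) p] glue_Inr[of 3 x] by simp
  have Kr: "Kbar n S {(Inr y, q)} w = of_bool (x = y) * edge_val n (q 3) (p 3)" if "{(Inr y, q)} \<in> W" "y \<in> bd" for y q
    using K[OF that(1), of "Inr y" q] LTS_Inr1_Inr3[OF that(2), of x]
    by (auto simp: sum_3 LTS_Inr_not1 simp del: sum_of_bool_mult_eq)
  from v show ?thesis
  proof (cases rule: C_sum_cases)
    case 1
    then obtain f q where fq: "(Inl f, q) \<in> v" unfolding in_original_def by blast
    have "Kbar n S v w = 0"
      using K[OF _ fq] v V'_subset by (auto simp: LTS_Inl_Inr3)
    then show ?thesis using 1 by (simp add: K_mat_def)
  next
    case (2 y q)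
    \<comment> \<open>The third coordinate of the projection is \<open>n - (n - q 3)\<close>, that
      is \<open>q 3\<close> again.\<close>
    have "Kbar n S v w = Kbar n S (e2 y (int n - q 3)) w"
      using Kr[of y q] Kr[of y "pt 0 (int n - q 3) (int n - (int n - q 3))"] e2_W[OF 2(2,4,5)] 2 v V'_subset
      by (auto simp: e2_def)
    then show ?thesis using 2(6) by (simp add: K_mat_def)
  qed
qed

text \<open>The leg of \<open>e3 x i\<close> through edge 1 has weight \<open>i\<close> and ends at
  \<open>y\<close>; the projection has a leg of the same weight \<open>i\<close> ending at
  \<open>x\<close>, which is subtracted. Compare the plus sign in \<open>M_mat_e3\<close>.\<close>

lemma K_mat_e3:
  assumes "nbe y x" "0 < i" "i < int n" "b \<in> bd" "0 < t" "t < int n"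
  shows "K_mat n T (e3 x i) (e2 b t) = edge_val n i t * (of_bool (b = y) - of_bool (b = x))"
proof -
  have x: "x \<in> bd" using nbe_bd assms(1) by blast
  have y: "nbe b x \<longleftrightarrow> b = y" using assms(1) nbe_left_unique by blast
  have "Kbar n S (e3 x i) (e2 b t) = of_bool (b = y) * edge_val n i t"
    using Kbar_e2[OF e3_W[OF x assms(2,3)], of "Inr x" "pt i 0 (int n - i)" b t] assms
      LTS_Inr1_Inr2[OF x, of b]
    by (simp add: e3_def sum_3 LTS_Inr_not1 y del: sum_of_bool_mult_eq)
  moreover have "Kbar n S (e2 x i) (e2 b t) = of_bool (b = x) * edge_val n i t"
    using Kbar_e2[OF e2_W[OF x assms(2,3)], of "Inr x" "pt 0 i (int n - i)" b t] assms
    by (simp add: e2_def sum_3 LTS_Inr_not1 del: sum_of_bool_mult_eq)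
  ultimately show ?thesis
    using C_sum_e3[OF x assms(2,3), of "\<lambda>u. Kbar n S u (e2 b t)"]
    by (simp add: K_mat_def algebra_simps)
qed

text \<open>The matrix of the edge functions has determinant a power of \<open>n\<close>, so modulo
  \<open>m\<close> a given family of values need not be a combination of them. Membership in the
  integral span is therefore carried along.\<close>

definition edge_span :: "(int \<Rightarrow> int) \<Rightarrow> bool" where
  "edge_span f \<longleftrightarrow> (\<exists>c. \<forall>t. 0 < t \<longrightarrow> t < int n \<longrightarrow> f t = (\<Sum>i\<in>{0<..<n}. c i * edge_val n (int i) t))"

lemma edge_span_0: "edge_span (\<lambda>t. 0)"
  unfolding edge_span_def by (rule exI[of _ "\<lambda>_. 0"]) simp

lemma edge_span_add: "edge_span f \<Longrightarrow> edge_span g \<Longrightarrow> edge_span (\<lambda>t. f t + g t)"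
  unfolding edge_span_def
proof (elim exE)
  fix c d
  assume "\<forall>t>0. t < int n \<longrightarrow> f t = (\<Sum>i\<in>{0<..<n}. c i * edge_val n (int i) t)"
    "\<forall>t>0. t < int n \<longrightarrow> g t = (\<Sum>i\<in>{0<..<n}. d i * edge_val n (int i) t)"
  then show "\<exists>c. \<forall>t>0. t < int n \<longrightarrow> f t + g t = (\<Sum>i\<in>{0<..<n}. c i * edge_val n (int i) t)"
    by (intro exI[of _ "\<lambda>i. c i + d i"]) (simp add: distrib_right sum.distrib)
qed

lemma edge_span_mult: "edge_span f \<Longrightarrow> edge_span (\<lambda>t. a * f t)"
  unfolding edge_span_def
proof (elim exE)
  fix c
  assume "\<forall>t>0. t < int n \<longrightarrow> f t = (\<Sum>i\<in>{0<..<n}. c i * edge_val n (int i) t)"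
  then show "\<exists>c. \<forall>t>0. t < int n \<longrightarrow> a * f t = (\<Sum>i\<in>{0<..<n}. c i * edge_val n (int i) t)"
    by (intro exI[of _ "\<lambda>i. a * c i"]) (simp add: sum_distrib_left mult.assoc)
qed

lemma edge_span_sum: "(\<And>x. x \<in> A \<Longrightarrow> edge_span (f x)) \<Longrightarrow> edge_span (\<lambda>t. \<Sum>x\<in>A. f x t)"
  by (induction A rule: infinite_finite_induct) (auto simp: edge_span_0 intro: edge_span_add)

lemma edge_span_edge_val:
  assumes "0 \<le> a" "a \<le> int n"
  shows "edge_span (edge_val n a)"
proof (cases "a = 0 \<or> a = int n")
  case True
  then have "edge_val n a t = 0" if "0 < t" "t < int n" for t using that by auto
  then show ?thesis unfolding edge_span_def by (intro exI[of _ "\<lambda>_. 0"]) simp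
next
  case False
  then have "nat a \<in> {0<..<n}" using assms by auto
  have *: "of_bool (i = nat a) * edge_val n (int i) t = (if i = nat a then edge_val n a t else 0)" for i t
    using assms by auto
  show ?thesis unfolding edge_span_def
    by (rule exI[of _ "\<lambda>i. of_bool (i = nat a)"]) (use \<open>nat a \<in> {0<..<n}\<close> in \<open>simp add: * del: sum_of_bool_mult_eq\<close>)
qed

text \<open>Each leg that ends at \<open>b\<close> contributes the edge function of its
  weight.\<close>

lemma edge_span_Kbar:
  assumes "u \<in> W" "b \<in> bd"
  shows "edge_span (\<lambda>t. Kbar n S u (e2 b t))"
proof -
  obtain f p where fp: "(f, p) \<in> u" using ext.Vbar_nonempty[OF assms(1)] by auto
  then have "p \<in> simplex n" using ext.Vbar_occ[OF assms(1)] by (auto simp: small_vertices_eq)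
  then have p: "0 \<le> p d" "p d \<le> int n" for d by (auto simp: simplex_iff[of _ _ d])
  have "edge_span (\<lambda>t. \<Sum>d\<in>UNIV. of_bool (((f, d), (Inr b, 2)) \<in> LTS\<^sup>*) * edge_val n (p d) t)"
    by (intro edge_span_sum edge_span_mult edge_span_edge_val p)
  then show ?thesis using Kbar_e2[OF assms(1) fp assms(2)] unfolding edge_span_def by simp
qed

lemma edge_span_K_mat:
  assumes "v \<in> V'" "b \<in> bd"
  shows "edge_span (\<lambda>t. K_mat n T v (e2 b t))"
  unfolding K_mat_def by (intro edge_span_sum edge_span_mult edge_span_Kbar assms)

subsection \<open>The matrix P\<close>

definition M_mat :: "'f ext_vertex \<Rightarrow> 'f ext_vertex \<Rightarrow> int" where
  "M_mat w x = (\<Sum>u\<in>W. C_mat n w u * ext.KQ u x)"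

text \<open>The correction in \<open>C\<close> only involves vertices on edges 2, which are not
  inner, so in an inner column \<open>C\<close> acts as the identity.\<close>

lemma M_mat_inner:
  assumes w: "w \<in> V'" and x: "x \<in> W" "inner x"
  shows "M_mat w x = - 2 * int n * of_bool (w = x)"
proof -
  have KQ: "ext.KQ u x = - 2 * int n * of_bool (u = x)" if "u \<in> W" for u
    using ext.KQ_inner[OF that x(1)] x(2) unfolding inner_def by blast
  have "M_mat w x = (\<Sum>u\<in>W. C_mat n w u * (- 2 * int n * of_bool (u = x)))"
    unfolding M_mat_def by (intro sum.cong refl) (simp only: KQ)
  moreover have "e2 y i \<noteq> x" for y i using x(2) e2_not_inner by blast
  moreover have "(\<Sum>u\<in>W. C_mat n w u * g u) = g w" if "\<And>y i. g (e2 y i) = 0" for g :: "'f ext_vertex \<Rightarrow> int"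
    by (cases rule: C_sum_cases[OF w]) (simp_all only: that diff_0_right)
  note this[of "\<lambda>u. - 2 * int n * of_bool (u = x)"]
  ultimately show ?thesis by simp
qed

lemma M_mat_dvd:
  assumes w: "w \<in> V'" and x: "x \<in> V"
  shows "int n dvd M_mat w x"
  using x
proof (cases rule: V_cases)
  case 1
  then show ?thesis using M_mat_inner[OF w] x V_subset by auto
next
  case (2 b t)
  have "int n dvd ext.KQ u x" if u: "u \<in> W" for u
  proof -
    obtain f p where "(f, p) \<in> u" using ext.Vbar_nonempty[OF u] by auto
    then show ?thesis using KQ_e2[OF u _ 2(1-3)] 2(4) by (simp del: sum_of_bool_eq)
  qed
  then show ?thesis unfolding M_mat_def by (intro dvd_sum dvd_mult) auto
qed

text \<open>At \<open>x\<close> the projection contributes \<open>n\<close> from its leg and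
  \<open>- 2 n\<close> from the diagonal; subtracting the resulting \<open>- n\<close> gives a plus
  sign, in contrast to \<open>K_mat_e3\<close>.\<close>

lemma M_mat_e3:
  assumes "nbe y x" "0 < i" "i < int n" "z \<in> V"
  shows "M_mat (e3 x i) z = int n * (of_bool (z = e2 y i) + of_bool (z = e2 x i))"
  using assms(4)
proof (cases rule: V_cases)
  case 1
  have "e3 x i \<noteq> z" using assms(4) e3_not_V by blast
  moreover have "z \<noteq> e2 y' i'" for y' i' using 1 e2_not_inner by blast
  moreover have "e3 x i \<in> V'" using e3_V' assms nbe_bd by blast
  ultimately show ?thesis using M_mat_inner[of "e3 x i" z] 1 assms(4) V_subset by auto
next
  case (2 b t)
  have x: "x \<in> bd" using nbe_bd assms(1) by blast
  have y: "nbe b x \<longleftrightarrow> b = y" using assms(1) nbe_left_unique by blast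
  have "ext.KQ (e3 x i) (e2 b t) = int n * of_bool (b = y \<and> i = t)"
    using KQ_e2[OF e3_W[OF x assms(2,3)], of "Inr x" "pt i 0 (int n - i)" b t] assms 2
      LTS_Inr1_Inr2[OF x, of b] e3_neq_e2[OF assms(2), of x b t]
    by (simp add: e3_def sum_3 LTS_Inr_not1 y del: sum_of_bool_eq)
  moreover have "ext.KQ (e2 x i) (e2 b t) = int n * of_bool (b = x \<and> i = t) - 2 * int n * of_bool (b = x \<and> i = t)"
    using KQ_e2[OF e2_W[OF x assms(2,3)], of "Inr x" "pt 0 i (int n - i)" b t] assms 2
    by (simp add: sum_3 LTS_Inr_not1 del: sum_of_bool_eq) (auto simp: e2_def)
  ultimately show ?thesis
    using C_sum_e3[OF x assms(2,3), of "\<lambda>u. ext.KQ u (e2 b t)"] unfolding 2(4) M_mat_def by auto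
qed

lemma P_mat_antisym: "P_mat n T v w = - P_mat n T w v"
proof -
  have "P_mat n T v w = (\<Sum>y\<in>V. \<Sum>x\<in>V. K_mat n T v x * Qbar x y * K_mat n T w y)"
    unfolding P_mat_def by (rule sum.swap)
  also have "\<dots> = (\<Sum>y\<in>V. \<Sum>x\<in>V. - (K_mat n T w y * Qbar y x * K_mat n T v x))"
  proof (intro sum.cong refl)
    fix x y
    show "K_mat n T v x * Qbar x y * K_mat n T w y = - (K_mat n T w y * Qbar y x * K_mat n T v x)"
      using Qbar_antisym[of x y] by simp
  qed
  finally show ?thesis by (simp add: P_mat_def sum_negf)
qed

text \<open>By antisymmetry of \<open>Qbar\<close> the product with the transpose of
  \<open>K\<close> is minus the transpose of \<open>K\<close> times \<open>Qbar\<close>.\<close>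

lemma P_mat_eq:
  assumes v: "v \<in> V'" and w: "w \<in> V'"
  shows "P_mat n T v w = - (\<Sum>x\<in>V. K_mat n T v x * M_mat w x)"
proof -
  have inner: "(\<Sum>y\<in>V. Qbar x y * K_mat n T w y) = - M_mat w x" for x
  proof -
    \<comment> \<open>The columns added here vanish by \<open>K_mat_outside\<close>; only now does
      the full product with \<open>Qbar\<close> appear.\<close>
    have "(\<Sum>y\<in>V. Qbar x y * K_mat n T w y) = (\<Sum>y\<in>W. Qbar x y * K_mat n T w y)"
      by (rule sum.mono_neutral_left) (use ext.finite_Vbar V_subset K_mat_outside[OF w] in auto)
    also have "\<dots> = (\<Sum>y\<in>W. \<Sum>u\<in>W. - (C_mat n w u * (Kbar n S u y * Qbar y x)))"
    proof (intro sum.cong refl)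
      fix y
      show "Qbar x y * K_mat n T w y = (\<Sum>u\<in>W. - (C_mat n w u * (Kbar n S u y * Qbar y x)))"
        unfolding K_mat_def sum_distrib_left
        by (intro sum.cong refl) (simp add: Qbar_antisym[of x y])
    qed
    also have "\<dots> = (\<Sum>u\<in>W. \<Sum>y\<in>W. - (C_mat n w u * (Kbar n S u y * Qbar y x)))"
      by (rule sum.swap)
    also have "\<dots> = - M_mat w x"
      by (simp add: M_mat_def ext.KQ_def sum_negf sum_distrib_left)
    finally show ?thesis .
  qed
  have "P_mat n T v w = (\<Sum>x\<in>V. K_mat n T v x * (\<Sum>y\<in>V. Qbar x y * K_mat n T w y))"
    by (simp add: P_mat_def sum_distrib_left mult.assoc)
  then show ?thesis by (simp add: inner sum_negf)
qed

end

section \<open>Central exponents\<close>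

lemma sum_rotate:
  fixes f :: "nat \<Rightarrow> 'a::comm_monoid_add"
  assumes "0 < r"
  shows "(\<Sum>j<r. f (Suc j mod r)) = (\<Sum>j<r. f j)"
proof -
  obtain q where q: "r = Suc q" using assms by (cases r) auto
  have "(\<Sum>j<q. f (Suc j mod Suc q)) = (\<Sum>j<q. f (Suc j))" by (intro sum.cong) auto
  then show ?thesis unfolding q sum.lessThan_Suc_shift[of f] by (simp add: add.commute)
qed

context bordered_n
begin

section \<open>Exponents and their rows\<close>

definition row :: "('f ext_vertex \<Rightarrow> int) \<Rightarrow> 'f ext_vertex \<Rightarrow> int" where
  "row k x = (\<Sum>v\<in>V'. k v * K_mat n T v x)"

definition central :: "nat \<Rightarrow> ('f ext_vertex \<Rightarrow> int) \<Rightarrow> bool" where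
  "central m k \<longleftrightarrow> (\<forall>w\<in>V'. int m dvd (\<Sum>v\<in>V'. k v * P_mat n T v w))"

text \<open>Positions are counted from 0, so the even \<open>j\<close> are the first, third, ...
  edges of the component.\<close>

definition bcoef :: "nat \<Rightarrow> nat \<Rightarrow> nat \<Rightarrow> int" where
  "bcoef m c j = (if even j then int c else int (m - c))"

definition bexp :: "nat \<Rightarrow> ('f \<times> 3) list \<Rightarrow> nat \<Rightarrow> nat \<Rightarrow> 'f ext_vertex \<Rightarrow> int" where
  "bexp m es i c = (\<lambda>v. \<Sum>j<length es. of_bool (v = e3 (es ! j) (int i)) * bcoef m c j)"

text \<open>Sums of exponents correspond to products of monomials. Differences are left out, since a
  subalgebra need not contain the inverses of its generators.\<close>

inductive_set central_exps :: "nat \<Rightarrow> ('f ext_vertex \<Rightarrow> int) set" for m where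
  Lambda: "k \<in> Lambda n T m \<Longrightarrow> k \<in> central_exps m"
| boundary: "boundary_component T es \<Longrightarrow> even (length es) \<Longrightarrow> 1 \<le> i \<Longrightarrow> i \<le> n - 1 \<Longrightarrow> c \<le> m \<Longrightarrow>
    bexp m es i c \<in> central_exps m"
| add: "k \<in> central_exps m \<Longrightarrow> l \<in> central_exps m \<Longrightarrow> (\<lambda>v. k v + l v) \<in> central_exps m"

lemma Lambda_iff: "k \<in> Lambda n T m \<longleftrightarrow> (\<forall>x\<in>V. int m dvd row k x)"
  by (simp add: Lambda_def row_def cong_0_iff)

lemma central_exps_sum:
  "finite A \<Longrightarrow> (\<And>a. a \<in> A \<Longrightarrow> f a \<in> central_exps m) \<Longrightarrow> (\<lambda>v. \<Sum>a\<in>A. f a v) \<in> central_exps m"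
proof (induction A rule: finite_induct)
  case empty
  show ?case by (rule central_exps.Lambda) (simp add: Lambda_iff row_def)
next
  case (insert a A)
  then show ?case using central_exps.add[of "f a" m "\<lambda>v. \<Sum>a\<in>A. f a v"] by simp
qed

lemma row_diff: "row (\<lambda>v. k v - l v) x = row k x - row l x"
  by (simp add: row_def left_diff_distrib sum_subtractf)

lemma row_sum: "row (\<lambda>v. \<Sum>a\<in>A. f a v) x = (\<Sum>a\<in>A. row (f a) x)"
  unfolding row_def sum_distrib_right by (rule sum.swap)

lemma central_add: "central m k \<Longrightarrow> central m l \<Longrightarrow> central m (\<lambda>v. k v + l v)"
  and central_diff: "central m k \<Longrightarrow> central m l \<Longrightarrow> central m (\<lambda>v. k v - l v)"
  by (simp_all add: central_def algebra_simps sum.distrib sum_subtractf)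

lemma P_sum_eq:
  assumes "w \<in> V'"
  shows "(\<Sum>v\<in>V'. k v * P_mat n T v w) = - (\<Sum>x\<in>V. row k x * M_mat w x)"
proof -
  have "(\<Sum>v\<in>V'. k v * P_mat n T v w) = (\<Sum>v\<in>V'. \<Sum>x\<in>V. - (k v * K_mat n T v x * M_mat w x))"
    by (intro sum.cong refl) (simp add: P_mat_eq assms sum_distrib_left sum_negf mult.assoc)
  also have "\<dots> = (\<Sum>x\<in>V. \<Sum>v\<in>V'. - (k v * K_mat n T v x * M_mat w x))"
    by (rule sum.swap)
  finally show ?thesis by (simp add: row_def sum_distrib_right sum_negf)
qed

lemma edge_span_row:
  assumes "b \<in> bd"
  shows "edge_span (\<lambda>t. row k (e2 b t))"
  unfolding row_def by (intro edge_span_sum edge_span_mult edge_span_K_mat assms)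

lemma bexp_sum:
  assumes "set es \<subseteq> bd" "0 < i" "i < n"
  shows "(\<Sum>v\<in>V'. bexp m es i c v * g v) = (\<Sum>j<length es. bcoef m c j * g (e3 (es ! j) (int i)))"
proof -
  have "(\<Sum>v\<in>V'. bexp m es i c v * g v) =
      (\<Sum>j<length es. \<Sum>v\<in>V'. of_bool (v = e3 (es ! j) (int i)) * bcoef m c j * g v)"
    unfolding bexp_def sum_distrib_right by (rule sum.swap)
  also have "\<dots> = (\<Sum>j<length es. bcoef m c j * g (e3 (es ! j) (int i)))"
  proof (rule sum.cong[OF refl])
    fix j assume "j \<in> {..<length es}"
    then have "e3 (es ! j) (int i) \<in> V'" using assms by (intro e3_V') auto
    moreover have "of_bool (v = e3 (es ! j) (int i)) * bcoef m c j * g v =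
      (if v = e3 (es ! j) (int i) then bcoef m c j * g (e3 (es ! j) (int i)) else 0)" for v by simp
    ultimately show "(\<Sum>v\<in>V'. of_bool (v = e3 (es ! j) (int i)) * bcoef m c j * g v) = bcoef m c j * g (e3 (es ! j) (int i))"
      by (simp add: finite_V' del: sum_of_bool_mult_eq)
  qed
  finally show ?thesis .
qed

lemma boundary_componentD:
  assumes "boundary_component T es"
  shows "0 < length es" "distinct es" "set es \<subseteq> bd"
    "\<And>j. j < length es \<Longrightarrow> nbe (es ! j) (es ! (Suc j mod length es))"
proof -
  show nb: "\<And>j. j < length es \<Longrightarrow> nbe (es ! j) (es ! (Suc j mod length es))"
    and "0 < length es" "distinct es"
    using assms by (auto simp: boundary_component_def)
  show "set es \<subseteq> bd" using nb nbe_bd(1) by (metis in_set_conv_nth subsetI)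
qed

text \<open>Even length makes the parity alternate also at the step from the last edge back to the
  first.\<close>

lemma bcoef_rotate:
  assumes "even r" "j < r" "c \<le> m"
  shows "bcoef m c (Suc j mod r) = int m - bcoef m c j"
proof -
  have "even (Suc j mod r) \<longleftrightarrow> odd j" using assms by (cases "Suc j = r") auto
  then show ?thesis using assms(3) by (simp add: bcoef_def of_nat_diff)
qed

text \<open>Each vertex on an edge 2 receives the coefficients of two consecutive boundary edges
  with equal signs, and these add up to \<open>m\<close>.\<close>

lemma bexp_M_sum:
  assumes es: "boundary_component T es" "even (length es)" and i: "0 < i" "i < n" and c: "c \<le> m" and z: "z \<in> V"
  shows "(\<Sum>j<length es. bcoef m c j * M_mat (e3 (es ! j) (int i)) z) =
    int n * int m * (\<Sum>j<length es. of_bool (z = e2 (es ! j) (int i)))"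
proof -
  note es' = boundary_componentD[OF es(1)]
  let ?r = "length es"
  let ?b = "\<lambda>j. of_bool (z = e2 (es ! j) (int i)) :: int"
  have "(\<Sum>j<?r. bcoef m c j * M_mat (e3 (es ! j) (int i)) z) =
    (\<Sum>j<?r. bcoef m c (Suc j mod ?r) * M_mat (e3 (es ! (Suc j mod ?r)) (int i)) z)"
    by (rule sum_rotate[OF es'(1), symmetric])
  also have "\<dots> = (\<Sum>j<?r. int n * ((int m - bcoef m c j) * ?b j) + int n * (bcoef m c (Suc j mod ?r) * ?b (Suc j mod ?r)))"
  proof (rule sum.cong[OF refl])
    fix j assume "j \<in> {..<?r}"
    then have j: "j < ?r" by simp
    show "bcoef m c (Suc j mod ?r) * M_mat (e3 (es ! (Suc j mod ?r)) (int i)) z =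
       int n * ((int m - bcoef m c j) * ?b j) + int n * (bcoef m c (Suc j mod ?r) * ?b (Suc j mod ?r))"
      using M_mat_e3[OF es'(4)[OF j] _ _ z, of "int i"] i bcoef_rotate[OF es(2) j c] by (simp add: distrib_left del: mult_minus_left)
  qed
  also have "\<dots> = (\<Sum>j<?r. int n * ((int m - bcoef m c j) * ?b j)) + (\<Sum>j<?r. int n * (bcoef m c j * ?b j))"
    unfolding sum.distrib using sum_rotate[OF es'(1), of "\<lambda>j. int n * (bcoef m c j * ?b j)"] by simp
  also have "\<dots> = (\<Sum>j<?r. int n * int m * ?b j)"
    unfolding sum.distrib[symmetric] by (intro sum.cong refl) (simp add: algebra_simps)
  finally show ?thesis by (simp add: sum_distrib_left)
qed

text \<open>Here the two consecutive coefficients are subtracted. Modulo \<open>m\<close> this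
  leaves minus or plus twice the free parameter, enough freedom to prescribe boundary values when 2
  is invertible.\<close>

lemma row_bexp:
  assumes es: "boundary_component T es" "even (length es)" and i: "0 < i" "i < n" and c: "c \<le> m"
    and b: "b \<in> bd" and t: "0 < t" "t < int n"
  shows "row (bexp m es i c) (e2 b t) =
    edge_val n (int i) t * (\<Sum>j<length es. (int m - 2 * bcoef m c j) * of_bool (b = es ! j))"
proof -
  note es' = boundary_componentD[OF es(1)]
  let ?r = "length es"
  let ?b = "\<lambda>j. of_bool (b = es ! j) :: int"
  let ?g = "edge_val n (int i) t"
  have "row (bexp m es i c) (e2 b t) = (\<Sum>j<?r. bcoef m c j * K_mat n T (e3 (es ! j) (int i)) (e2 b t))"
    unfolding row_def by (rule bexp_sum[OF es'(3) i])
  also have "\<dots> = (\<Sum>j<?r. bcoef m c (Suc j mod ?r) * K_mat n T (e3 (es ! (Suc j mod ?r)) (int i)) (e2 b t))"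
    by (rule sum_rotate[OF es'(1), symmetric])
  also have "\<dots> = (\<Sum>j<?r. ?g * ((int m - bcoef m c j) * ?b j) - ?g * (bcoef m c (Suc j mod ?r) * ?b (Suc j mod ?r)))"
  proof (rule sum.cong[OF refl])
    fix j assume "j \<in> {..<?r}"
    then have j: "j < ?r" by simp
    show "bcoef m c (Suc j mod ?r) * K_mat n T (e3 (es ! (Suc j mod ?r)) (int i)) (e2 b t) =
       ?g * ((int m - bcoef m c j) * ?b j) - ?g * (bcoef m c (Suc j mod ?r) * ?b (Suc j mod ?r))"
      using K_mat_e3[OF es'(4)[OF j] _ _ b t, of "int i"] i bcoef_rotate[OF es(2) j c] by (simp add: right_diff_distrib)
  qed
  also have "\<dots> = (\<Sum>j<?r. ?g * ((int m - bcoef m c j) * ?b j)) - (\<Sum>j<?r. ?g * (bcoef m c j * ?b j))"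
    unfolding sum_subtractf using sum_rotate[OF es'(1), of "\<lambda>j. ?g * (bcoef m c j * ?b j)"] by simp
  also have "\<dots> = (\<Sum>j<?r. ?g * ((int m - 2 * bcoef m c j) * ?b j))"
    unfolding sum_subtractf[symmetric] by (intro sum.cong refl) (simp add: algebra_simps)
  finally show ?thesis by (simp only: sum_distrib_left)
qed

end

locale bordered_root = bordered_n n T for n :: nat and T :: "'f triangulation" +
  fixes m m'' :: nat
  assumes m: "m = m'' div gcd n m''" and odd_m'': "odd m''"
begin

text \<open>With \<open>g\<close> the gcd, \<open>m'' = m * g\<close> and \<open>n = n' * g\<close>
  with \<open>n'\<close> prime to \<open>m\<close>. Hence a factor \<open>n\<close> lowers the
  modulus from \<open>m''\<close> to \<open>m\<close>.\<close>

lemma m_pos: "0 < m" and odd_m: "odd m" and m''_dvd: "int m'' dvd int n * int m"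
  and m_dvd: "int m'' dvd int n * a \<Longrightarrow> int m dvd a"
proof -
  have "0 < m''" using odd_m'' by (cases m'') auto
  obtain g where g: "g = gcd n m''" by blast
  have g0: "0 < g" using \<open>0 < m''\<close> g by simp
  have mg: "m'' = m * g" using g m by (simp add: gcd_dvd2)
  obtain n' where n': "n = n' * g" using g by (metis dvd_def gcd_dvd1 mult.commute)
  show "0 < m" using mg \<open>0 < m''\<close> by (cases m) auto
  show "odd m" using odd_m'' mg by auto
  have "int n * int m = int m'' * int n'" by (simp add: mg n')
  then show "int m'' dvd int n * int m" by simp
  have "coprime n' m"
    using g0 g unfolding mg n' by (metis gcd_mult_distrib_nat mult.commute mult_cancel2 mult_1 coprime_iff_gcd_eq_1 not_gr_zero)
  then have cop: "coprime (int m) (int n')" by (simp add: coprime_commute)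
  assume "int m'' dvd int n * a"
  then have "int g * int m dvd int g * (int n' * a)" by (simp add: mg n' mult_ac)
  then have "int m dvd int n' * a" using g0 by simp
  then show "int m dvd a" using cop by (simp add: coprime_dvd_mult_right_iff)
qed

lemma central_Lambda: "k \<in> Lambda n T m \<Longrightarrow> central m'' k"
  unfolding central_def
proof
  fix w assume k: "k \<in> Lambda n T m" and w: "w \<in> V'"
  have "int m'' dvd row k x * M_mat w x" if "x \<in> V" for x
  proof -
    have "int m * int n dvd row k x * M_mat w x"
      using k that M_mat_dvd[OF w that] by (intro mult_dvd_mono) (auto simp: Lambda_iff)
    then show ?thesis using m''_dvd by (metis dvd_trans mult.commute)
  qed
  then show "int m'' dvd (\<Sum>v\<in>V'. k v * P_mat n T v w)"
    unfolding P_sum_eq[OF w] by (simp add: dvd_sum)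
qed

lemma central_bexp:
  assumes es: "boundary_component T es" "even (length es)" and i: "0 < i" "i < n" and c: "c \<le> m"
  shows "central m'' (bexp m es i c)"
  unfolding central_def
proof
  fix w assume w: "w \<in> V'"
  note es' = boundary_componentD[OF es(1)]
  have "(\<Sum>v\<in>V'. bexp m es i c v * P_mat n T v w) = (\<Sum>j<length es. bcoef m c j * P_mat n T (e3 (es ! j) (int i)) w)"
    by (rule bexp_sum[OF es'(3) i])
  also have "\<dots> = (\<Sum>j<length es. \<Sum>x\<in>V. K_mat n T w x * (bcoef m c j * M_mat (e3 (es ! j) (int i)) x))"
  proof (rule sum.cong[OF refl])
    fix j assume "j \<in> {..<length es}"
    then have e: "e3 (es ! j) (int i) \<in> V'" using es' i by (intro e3_V') auto
    show "bcoef m c j * P_mat n T (e3 (es ! j) (int i)) w =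
       (\<Sum>x\<in>V. K_mat n T w x * (bcoef m c j * M_mat (e3 (es ! j) (int i)) x))"
      by (subst P_mat_antisym) (simp add: P_mat_eq[OF w e] sum_distrib_left mult.left_commute)
  qed
  also have "\<dots> = (\<Sum>x\<in>V. \<Sum>j<length es. K_mat n T w x * (bcoef m c j * M_mat (e3 (es ! j) (int i)) x))"
    by (rule sum.swap)
  also have "\<dots> = (\<Sum>x\<in>V. K_mat n T w x * (\<Sum>j<length es. bcoef m c j * M_mat (e3 (es ! j) (int i)) x))"
    by (simp add: sum_distrib_left)
  also have "int m'' dvd \<dots>"
    using bexp_M_sum[OF es i c] m''_dvd by (intro dvd_sum) (simp del: sum_of_bool_eq)
  finally show "int m'' dvd (\<Sum>v\<in>V'. bexp m es i c v * P_mat n T v w)" .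
qed

lemma central_exps_central: "k \<in> central_exps m \<Longrightarrow> central m'' k"
  by (induction rule: central_exps.induct) (auto intro: central_Lambda central_bexp central_add)

text \<open>Centrality tested against the generator at \<open>e3 x i\<close>, whose row in
  \<open>M\<close> is supported on the two vertices in question.\<close>

lemma central_neighbours:
  assumes k: "central m'' k" and nb: "nbe y x" and i: "0 < i" "i < int n"
  shows "int m dvd row k (e2 y i) + row k (e2 x i)"
proof -
  have e: "e2 y i \<in> V" "e2 x i \<in> V" "e3 x i \<in> V'" using nbe_bd[OF nb] i by (auto intro: e2_V e3_V')
  have *: "row k z * M_mat (e3 x i) z = int n * (if z = e2 y i then row k (e2 y i) else 0) + int n * (if z = e2 x i then row k (e2 x i) else 0)"
    if "z \<in> V" for z
    using M_mat_e3[OF nb i that] by (auto simp: algebra_simps)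
  have "(\<Sum>z\<in>V. row k z * M_mat (e3 x i) z) = int n * (row k (e2 y i) + row k (e2 x i))"
    using e by (simp add: * sum.distrib finite_V distrib_left flip: sum_distrib_left cong: sum.cong)
  then have "int m'' dvd int n * (row k (e2 y i) + row k (e2 x i))"
    using k e(3) P_sum_eq[OF e(3), of k] unfolding central_def by auto
  then show ?thesis by (rule m_dvd)
qed

text \<open>Centrality tested against an inner vertex isolates the value of the row there, with a
  factor \<open>2 n\<close>; the factor \<open>n\<close> is absorbed by the change of modulus and 2
  is cancelled because \<open>m\<close> is odd.\<close>

lemma central_boundary_zero:
  assumes k: "central m'' k" and zero: "\<And>x i. x \<in> bd \<Longrightarrow> 0 < i \<Longrightarrow> i < int n \<Longrightarrow> int m dvd row k (e2 x i)"
  shows "k \<in> Lambda n T m"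
  unfolding Lambda_iff
proof
  fix w assume w: "w \<in> V"
  then show "int m dvd row k w"
  proof (cases rule: V_cases)
    case 1
    have wW: "w \<in> W" using w V_subset by blast
    \<comment> \<open>An inner vertex does not lie on any edge 2, so it also indexes a generator and
      can be tested against.\<close>
    have w': "w \<in> V'"
    proof (rule V'_I[OF wW])
      fix x p assume "(Inr x, p) \<in> w"
      then show "p 1 \<noteq> 0" using on_edge_2_e2(4)[OF wW, of x p] 1 e2_not_inner on_edge_simps(2) by metis
    qed
    \<comment> \<open>Only the column \<open>w\<close> survives modulo \<open>m''\<close>: the other
      inner entries vanish, and a term at a vertex on edge 2 has a factor \<open>m\<close> by
      assumption and a factor \<open>n\<close> from \<open>M_mat_dvd\<close>.\<close>
    have "int m'' dvd row k z * M_mat w z - (if z = w then - 2 * int n * row k w else 0)" if z: "z \<in> V" for z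
      using z
    proof (cases rule: V_cases)
      case 1
      then show ?thesis using M_mat_inner[OF w' subsetD[OF V_subset z] 1] by (cases "w = z") simp_all
    next
      case (2 x i)
      have zw: "z \<noteq> w" using 1 2(4) e2_not_inner by blast
      have "int m * int n dvd row k z * M_mat w z"
        using zero[OF 2(1-3)] M_mat_dvd[OF w' z] 2(4) by (intro mult_dvd_mono) auto
      moreover have "int m'' dvd int m * int n" using m''_dvd by (simp add: mult.commute)
      ultimately have "int m'' dvd row k z * M_mat w z" by (meson dvd_trans)
      then show ?thesis using zw by simp
    qed
    then have "int m'' dvd (\<Sum>z\<in>V. row k z * M_mat w z - (if z = w then - 2 * int n * row k w else 0))"
      by (rule dvd_sum)
    then have "int m'' dvd (\<Sum>z\<in>V. row k z * M_mat w z) + 2 * int n * row k w"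
      using w by (simp add: sum_subtractf finite_V)
    moreover have "int m'' dvd (\<Sum>z\<in>V. row k z * M_mat w z)"
      using k w' P_sum_eq[OF w', of k] unfolding central_def by auto
    ultimately have "int m'' dvd 2 * int n * row k w" by (simp add: dvd_add_right_iff)
    then have "int m dvd 2 * row k w" by (intro m_dvd) (simp add: mult_ac)
    moreover have "coprime (int m) 2" using odd_m by simp
    ultimately show ?thesis by (simp add: coprime_dvd_mult_right_iff)
  qed (use zero in blast)
qed

text \<open>Along a boundary component the boundary rows of a central exponent alternate in sign, and
  each of them is an integer combination of the rows \<^const>\<open>edge_val\<close>; hence they are matched by
  boundary exponents.\<close>

lemma central_alternating:
  assumes k: "central m'' k" and es: "boundary_component T es" and t: "0 < t" "t < int n"
  shows "j < length es \<Longrightarrow> [row k (e2 (es ! j) t) = (- 1) ^ j * row k (e2 (es ! 0) t)] (mod int m)"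
proof (induction j)
  case (Suc j)
  note es' = boundary_componentD[OF es]
  have "int m dvd row k (e2 (es ! j) t) + row k (e2 (es ! Suc j) t)"
    using central_neighbours[OF k es'(4)[of j] t] Suc.prems by simp
  then have "[row k (e2 (es ! Suc j) t) = - row k (e2 (es ! j) t)] (mod int m)"
    by (simp add: cong_iff_dvd_diff add.commute)
  moreover have "[- row k (e2 (es ! j) t) = - ((- 1) ^ j * row k (e2 (es ! 0) t))] (mod int m)"
    using Suc by (simp add: cong_minus_minus_iff)
  ultimately show ?case using cong_trans by fastforce
qed simp

text \<open>Going once round an odd cycle makes the value equal to its own negative, hence zero for
  odd \<open>m\<close>.\<close>

lemma central_even_length:
  assumes k: "central m'' k" and es: "boundary_component T es" and t: "0 < t" "t < int n"
    and nz: "\<not> int m dvd row k (e2 (es ! 0) t)"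
  shows "even (length es)"
proof (rule ccontr)
  assume odd: "odd (length es)"
  note es' = boundary_componentD[OF es]
  let ?j = "length es - 1"
  have "[row k (e2 (es ! ?j) t) = row k (e2 (es ! 0) t)] (mod int m)"
    using central_alternating[OF k es t, of ?j] es'(1) odd by simp
  moreover have "int m dvd row k (e2 (es ! ?j) t) + row k (e2 (es ! 0) t)"
    using central_neighbours[OF k es'(4)[of ?j] t] es'(1) by simp
  ultimately have "int m dvd (row k (e2 (es ! ?j) t) + row k (e2 (es ! 0) t)) - (row k (e2 (es ! ?j) t) - row k (e2 (es ! 0) t))"
    unfolding cong_iff_dvd_diff by (rule dvd_diff[rotated])
  then have "int m dvd 2 * row k (e2 (es ! 0) t)" by simp
  moreover have "coprime (int m) 2" using odd_m by simp
  ultimately show False using nz by (simp add: coprime_dvd_mult_right_iff)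
qed

lemma central_correction:
  assumes k: "central m'' k" and es: "boundary_component T es" "even (length es)"
  obtains l where "l \<in> central_exps m" "central m'' l"
    "\<And>x t. x \<in> bd \<Longrightarrow> x \<notin> set es \<Longrightarrow> 0 < t \<Longrightarrow> t < int n \<Longrightarrow> row l (e2 x t) = 0"
    "\<And>x t. x \<in> set es \<Longrightarrow> 0 < t \<Longrightarrow> t < int n \<Longrightarrow> [row l (e2 x t) = row k (e2 x t)] (mod int m)"
proof -
  note es' = boundary_componentD[OF es(1)]
  have "es ! 0 \<in> bd" using es' by auto
  then obtain c where c: "\<And>t. 0 < t \<Longrightarrow> t < int n \<Longrightarrow> row k (e2 (es ! 0) t) = (\<Sum>i\<in>{0<..<n}. c i * edge_val n (int i) t)"
    using edge_span_row[of "es ! 0" k] unfolding edge_span_def by blast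
  \<comment> \<open>Since \<open>- 2 * s\<close> is 1 modulo \<open>m\<close>, the equation
    \<open>- 2 * d = c i\<close> is solved by \<open>s * c i\<close>; its residue is an admissible
    exponent between 0 and \<open>m\<close>.\<close>
  obtain s where s: "int m = 2 * s + 1" using odd_m by (metis even_of_nat oddE)
  define d where "d = (\<lambda>i. nat (s * c i mod int m))"
  have d: "d i \<le> m" "int (d i) = s * c i mod int m" for i
    using m_pos by (simp_all add: d_def nat_le_iff order.strict_implies_order)
  have d2: "[- 2 * int (d i) = c i] (mod int m)" for i
  proof -
    have "[- 2 * int (d i) = - 2 * (s * c i)] (mod int m)"
      unfolding d(2) by (intro cong_mult cong_refl) simp
    also have "- 2 * (s * c i) = c i - int m * c i" unfolding s by (simp add: algebra_simps)
    also have "[c i - int m * c i = c i] (mod int m)" by (simp add: cong_iff_dvd_diff)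
    finally show ?thesis .
  qed
  define l where "l = (\<lambda>v. \<Sum>i\<in>{0<..<n}. bexp m es i (d i) v)"
  have 1: "l \<in> central_exps m" unfolding l_def
    by (rule central_exps_sum) (use es d(1) in \<open>auto intro!: central_exps.boundary\<close>)
  have row_l: "row l (e2 x t) = (\<Sum>i\<in>{0<..<n}. edge_val n (int i) t *
      (\<Sum>j<length es. (int m - 2 * bcoef m (d i) j) * of_bool (x = es ! j)))"
    if "x \<in> bd" "0 < t" "t < int n" for x t
    unfolding l_def row_sum using row_bexp[OF es _ _ d(1) that] by (intro sum.cong) auto
  have 2: "row l (e2 x t) = 0" if "x \<in> bd" "x \<notin> set es" "0 < t" "t < int n" for x t
  proof -
    have "x \<noteq> es ! j" if "j < length es" for j using that \<open>x \<notin> set es\<close> by auto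
    then show ?thesis unfolding row_l[OF that(1,3,4)] by (intro sum.neutral) auto
  qed
  have 3: "[row l (e2 x t) = row k (e2 x t)] (mod int m)" if x_es: "x \<in> set es" and "0 < t" "t < int n" for x t
  proof -
    obtain a where a: "a < length es" "x = es ! a" using x_es by (auto simp: in_set_conv_nth)
    have eq: "(\<Sum>j<length es. (int m - 2 * bcoef m (d i) j) * of_bool (x = es ! j)) = int m - 2 * bcoef m (d i) a" for i
    proof -
      have "(\<Sum>j<length es. (int m - 2 * bcoef m (d i) j) * of_bool (x = es ! j)) =
        (\<Sum>j<length es. if j = a then int m - 2 * bcoef m (d i) a else 0)"
        using a es'(2) by (intro sum.cong) (auto simp: nth_eq_iff_index_eq)
      then show ?thesis using a by simp
    qed
    have x: "x \<in> bd" using x_es es' by blast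
    have "row l (e2 x t) = (\<Sum>i\<in>{0<..<n}. edge_val n (int i) t * (int m - 2 * bcoef m (d i) a))"
      unfolding row_l[OF x that(2,3)] eq ..
    also have "[\<dots> = (\<Sum>i\<in>{0<..<n}. (- 1) ^ a * (c i * edge_val n (int i) t))] (mod int m)"
    proof (rule cong_sum)
      fix i
      \<comment> \<open>At odd positions the coefficient is \<open>m - d i\<close>, which reverses
        the sign; this is the same alternation as that of the rows of \<open>k\<close>.\<close>
      have "[int m - 2 * bcoef m (d i) a = (- 1) ^ a * c i] (mod int m)"
      proof (cases "even a")
        case True
        have "[int m + - 2 * int (d i) = 0 + c i] (mod int m)"
          by (intro cong_add d2) (simp add: cong_def)
        then show ?thesis using True by (simp add: bcoef_def)
      next
        case False
        have "[- int m - (- 2 * int (d i)) = 0 - c i] (mod int m)"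
          by (intro cong_diff d2) (simp add: cong_def)
        then show ?thesis using False d(1)[of i] by (simp add: bcoef_def of_nat_diff algebra_simps)
      qed
      then have "[edge_val n (int i) t * (int m - 2 * bcoef m (d i) a) = edge_val n (int i) t * ((- 1) ^ a * c i)] (mod int m)"
        by (intro cong_mult cong_refl)
      then show "[edge_val n (int i) t * (int m - 2 * bcoef m (d i) a) = (- 1) ^ a * (c i * edge_val n (int i) t)] (mod int m)"
        by (simp add: mult_ac)
    qed
    also have "(\<Sum>i\<in>{0<..<n}. (- 1) ^ a * (c i * edge_val n (int i) t)) = (- 1) ^ a * row k (e2 (es ! 0) t)"
      using c[OF that(2,3)] by (simp add: sum_distrib_left)
    also have "[\<dots> = row k (e2 x t)] (mod int m)"
      using central_alternating[OF k es(1) that(2,3) a(1)] unfolding a(2) by (rule cong_sym)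
    finally show ?thesis .
  qed
  show ?thesis using that[OF 1 central_exps_central[OF 1] 2 3] by blast
qed

text \<open>Induction on the number of boundary edges where the row does not vanish modulo
  \<open>m\<close>. A correction clears one boundary component and leaves the others untouched; when
  none is left, \<open>central_boundary_zero\<close> applies.\<close>

lemma central_imp_central_exps: "central m'' k \<Longrightarrow> k \<in> central_exps m"
proof (induction "card {x\<in>bd. \<exists>t. 0 < t \<and> t < int n \<and> \<not> int m dvd row k (e2 x t)}" arbitrary: k rule: less_induct)
  case less
  let ?bad = "\<lambda>k. {x\<in>bd. \<exists>t. 0 < t \<and> t < int n \<and> \<not> int m dvd row k (e2 x t)}"
  show ?case
  proof (cases "?bad k = {}")
    case True
    then show ?thesis by (intro central_exps.Lambda central_boundary_zero[OF less.prems]) blast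
  next
    case False
    then obtain x t where x: "x \<in> bd" "0 < t" "t < int n" "\<not> int m dvd row k (e2 x t)" by blast
    obtain es where es: "boundary_component T es" "es ! 0 = x" using boundary_component_ex[OF x(1)] .
    have "even (length es)" using central_even_length[OF less.prems es(1) x(2,3)] x(4) es(2) by blast
    then obtain l where l: "l \<in> central_exps m" "central m'' l"
      "\<And>x t. x \<in> bd \<Longrightarrow> x \<notin> set es \<Longrightarrow> 0 < t \<Longrightarrow> t < int n \<Longrightarrow> row l (e2 x t) = 0"
      "\<And>x t. x \<in> set es \<Longrightarrow> 0 < t \<Longrightarrow> t < int n \<Longrightarrow> [row l (e2 x t) = row k (e2 x t)] (mod int m)"
      using central_correction[OF less.prems es(1)] by blast
    let ?k = "\<lambda>v. k v - l v"
    have xes: "x \<in> set es" using es boundary_componentD(1)[OF es(1)] by auto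
    \<comment> \<open>On \<open>es\<close> the rows of \<open>k\<close> and \<open>l\<close> agree
      modulo \<open>m\<close>, and off \<open>es\<close> the boundary row of \<open>l\<close> is
      zero: no bad edge is created and \<open>x\<close> is repaired.\<close>
    have "?bad ?k \<subseteq> ?bad k - {x}"
    proof
      fix y assume "y \<in> ?bad ?k"
      then obtain s where y: "y \<in> bd" "0 < s" "s < int n" "\<not> int m dvd row k (e2 y s) - row l (e2 y s)"
        by (auto simp: row_diff)
      have "y \<notin> set es"
        using l(4)[OF _ y(2,3)] y(4) by (metis cong_iff_dvd_diff cong_sym)
      moreover from this have "\<not> int m dvd row k (e2 y s)" using l(3)[OF y(1) _ y(2,3)] y(4) by simp
      ultimately show "y \<in> ?bad k - {x}" using y xes by blast
    qed
    moreover have "x \<in> ?bad k" using x by blast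
    ultimately have "?bad ?k \<subset> ?bad k" by blast
    then have "card (?bad ?k) < card (?bad k)" by (rule psubset_card_mono[rotated]) (simp add: finite_bd)
    then have "?k \<in> central_exps m" using less.hyps central_diff[OF less.prems l(2)] by blast
    from central_exps.add[OF this l(1)] show ?thesis by simp
  qed
qed

end

section \<open>Quantum tori\<close>

lemma zero_eq_Word: "0 = Word []" by (simp add: zero_free_word_def)

lemma Word_add: "Word u + Word v = Word (u @ v)" by (simp add: plus_free_word_def)

lemma letters_simps [simp]: "letters 0 = []" "letters (u + v) = letters u @ letters v"
  by (simp_all add: zero_free_word_def plus_free_word_def)

lemma free_algebra_simps [simp]:
  "a \<otimes>\<^bsub>free_algebra G\<^esub> b = a * b" "\<one>\<^bsub>free_algebra G\<^esub> = 1" "a \<oplus>\<^bsub>free_algebra G\<^esub> b = a + b" "\<zero>\<^bsub>free_algebra G\<^esub> = 0"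
  by (simp_all add: free_algebra_def)

lemma free_algebra_carrier: "a \<in> carrier (free_algebra G) \<longleftrightarrow> (\<forall>w\<in>Poly_Mapping.keys a. set (letters w) \<subseteq> G)"
  by (simp add: free_algebra_def)

lemma keys_uminus_poly: "Poly_Mapping.keys (- a) = Poly_Mapping.keys (a :: 'a \<Rightarrow>\<^sub>0 'b::ab_group_add)"
  by (auto simp: in_keys_iff)

lemma free_algebra_closed:
  fixes a b :: "'g free_word \<Rightarrow>\<^sub>0 'r::comm_ring_1"
  assumes "a \<in> carrier (free_algebra G)" "b \<in> carrier (free_algebra G)"
  shows "a + b \<in> carrier (free_algebra G)" "a * b \<in> carrier (free_algebra G)" "- a \<in> carrier (free_algebra G)"
proof -
  show "a + b \<in> carrier (free_algebra G)"
    using assms keys_add[of a b] unfolding free_algebra_carrier by blast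
  show "a * b \<in> carrier (free_algebra G)"
    using assms keys_mult[of a b] unfolding free_algebra_carrier by fastforce
  show "- a \<in> carrier (free_algebra G)"
    using assms unfolding free_algebra_carrier keys_uminus_poly by blast
qed

lemma ring_free_algebra: "ring (free_algebra G :: ('g free_word \<Rightarrow>\<^sub>0 'r::comm_ring_1) ring)"
proof (rule ringI)
  let ?F = "free_algebra G :: ('g free_word \<Rightarrow>\<^sub>0 'r) ring"
  show "abelian_group ?F"
  proof (rule abelian_groupI)
    fix x assume x: "x \<in> carrier ?F"
    show "\<exists>y\<in>carrier ?F. y \<oplus>\<^bsub>?F\<^esub> x = \<zero>\<^bsub>?F\<^esub>"
      using free_algebra_closed(3)[OF x x] by (intro bexI[of _ "- x"]) simp_all
  qed (auto simp: free_algebra_closed algebra_simps, auto simp: free_algebra_carrier)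
  show "monoid ?F"
    by (rule monoidI) (auto simp: free_algebra_closed mult.assoc, auto simp: free_algebra_carrier)
qed (simp_all add: algebra_simps)

lemma poly_mapping_sum_singles: "a = (\<Sum>w\<in>Poly_Mapping.keys a. Poly_Mapping.single w (Poly_Mapping.lookup a w))"
  by (rule poly_mapping_eqI) (simp add: lookup_sum lookup_single when_def in_keys_iff)

lemma single_sum: "Poly_Mapping.single w (sum f X) = (\<Sum>x\<in>X. Poly_Mapping.single w (f x))"
  by (induction X rule: infinite_finite_induct) (simp_all add: single_add)

section \<open>Integer powers of a unit\<close>

definition unit_inv :: "'r::idom \<Rightarrow> 'r" where
  "unit_inv q = (THE r. q * r = 1)"

lemma unit_inv: "q dvd 1 \<Longrightarrow> q * unit_inv q = 1"
proof -
  assume "q dvd 1"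
  then obtain r where r: "1 = q * r" by (auto simp: dvd_def)
  have "unit_inv q = r"
    unfolding unit_inv_def
  proof (rule the_equality)
    fix s assume s: "q * s = 1"
    have "(q * s) * r = s * (q * r)" by (simp only: mult_ac)
    then show "s = r" unfolding s r[symmetric] by simp
  qed (simp add: r)
  then show ?thesis using r by simp
qed

text \<open>Any presentation of the exponent as a difference of natural numbers may be used, which
  frees additivity from sign cases.\<close>

lemma unit_powi_eq:
  assumes "q dvd 1" "k = int x - int y"
  shows "unit_powi q k = q ^ x * unit_inv q ^ y"
proof (cases "0 \<le> k")
  case True
  then have "x = nat k + y" using assms by simp
  moreover have "q ^ y * unit_inv q ^ y = 1" using unit_inv[OF assms(1)] by (simp flip: power_mult_distrib)
  ultimately show ?thesis using True by (simp add: unit_powi_def power_add mult.assoc)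
next
  case False
  then have "y = x + nat (- k)" using assms by simp
  moreover have "q ^ x * unit_inv q ^ x = 1" using unit_inv[OF assms(1)] by (simp flip: power_mult_distrib)
  ultimately show ?thesis using False by (simp add: unit_powi_def unit_inv_def[symmetric] power_add mult.assoc[symmetric])
qed

lemma unit_powi_add:
  assumes "q dvd 1"
  shows "unit_powi q (j + k) = unit_powi q j * unit_powi q k"
proof -
  have *: "i = int (nat i) - int (nat (- i))" for i by simp
  have "j + k = int (nat j + nat k) - int (nat (- j) + nat (- k))" by simp
  from unit_powi_eq[OF assms this] unit_powi_eq[OF assms *, of j] unit_powi_eq[OF assms *, of k]
  show ?thesis by (simp add: power_add mult_ac)
qed

lemma unit_powi_0 [simp]: "unit_powi q 0 = 1"
  by (simp add: unit_powi_def)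

lemma unit_powi_minus: "q dvd 1 \<Longrightarrow> unit_powi q k * unit_powi q (- k) = 1"
  using unit_powi_add[of q k "- k"] by simp

lemma unit_powi_unit: "q dvd 1 \<Longrightarrow> unit_powi q k dvd 1"
  using unit_powi_minus by (metis dvd_triv_left)

lemma unit_powi_of_nat: "unit_powi q (int k) = q ^ k"
  by (simp add: unit_powi_def)

lemma primitive_root_power_eq_1:
  assumes "primitive_root_of_unity m z"
  shows "z ^ k = 1 \<longleftrightarrow> m dvd k"
proof -
  have m: "0 < m" "z ^ m = 1" "\<And>k. 0 < k \<Longrightarrow> k < m \<Longrightarrow> z ^ k \<noteq> 1"
    using assms by (auto simp: primitive_root_of_unity_def)
  have "z ^ k = z ^ (m * (k div m) + k mod m)" by simp
  also have "\<dots> = z ^ (k mod m)" unfolding power_add power_mult m(2) by simp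
  finally have "z ^ k = 1 \<longleftrightarrow> z ^ (k mod m) = 1" by simp
  also have "\<dots> \<longleftrightarrow> k mod m = 0" using m(3)[of "k mod m"] m(1) by (cases "k mod m = 0") auto
  finally show ?thesis by (simp add: dvd_eq_mod_eq_0)
qed

lemma unit_powi_double_eq_1:
  assumes q: "q dvd 1" and m: "primitive_root_of_unity m (q\<^sup>2)"
  shows "unit_powi q (2 * k) = 1 \<longleftrightarrow> int m dvd k"
proof -
  have pos: "unit_powi q (2 * int k) = 1 \<longleftrightarrow> m dvd k" for k
    using primitive_root_power_eq_1[OF m, of k] unit_powi_of_nat[of q "2 * k"] by (simp add: power_mult)
  show ?thesis
  proof (cases "0 \<le> k")
    case True
    then show ?thesis using pos[of "nat k"] by (metis int_dvd_int_iff nat_0_le)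
  next
    case False
    have "unit_powi q (2 * k) = 1 \<longleftrightarrow> unit_powi q (2 * (- k)) = 1"
      using unit_powi_minus[OF q, of "2 * k"] by (metis minus_mult_right mult.comm_neutral mult_1)
    also have "\<dots> \<longleftrightarrow> int m dvd - k" using pos[of "nat (- k)"] False by (metis int_dvd_int_iff nat_0_le neg_0_le_iff_le linorder_linear)
    finally show ?thesis by simp
  qed
qed

locale qtorus =
  fixes q :: "'r::idom" and I :: "'i set" and P :: "'i \<Rightarrow> 'i \<Rightarrow> int"
  assumes q: "q dvd 1" and finite_I: "finite I" and antisym: "\<And>i j. P i j = - P j i"
begin

abbreviation G where "G \<equiv> Gen ` I \<union> Gen_inv ` I"
abbreviation F where "F \<equiv> qt_free I :: ('i laurent_gen free_word \<Rightarrow>\<^sub>0 'r) ring"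
abbreviation J where "J \<equiv> qt_ideal q I P"
abbreviation A where "A \<equiv> quantum_torus q I P"
abbreviation pr where "pr \<equiv> (+>\<^bsub>F\<^esub>) J"
abbreviation qp where "qp \<equiv> unit_powi q"

lemma qp_add: "qp (j + k) = qp j * qp k"
  by (rule unit_powi_add[OF q])

lemma qp_nonzero: "qp k \<noteq> 0"
  using unit_powi_unit[OF q, of k] by auto

subsection \<open>Coefficients\<close>

text \<open>The quantum torus is compared with the twisted group algebra of the exponent lattice, in which
  a word is the power of \<open>q\<close> given by \<open>wexp\<close> times its normalized monomial. Only the coefficient
  functions are needed, not the ring structure of the twisted group algebra.\<close>

definition form :: "('i \<Rightarrow> int) \<Rightarrow> ('i \<Rightarrow> int) \<Rightarrow> int" where
  "form k l = (\<Sum>i\<in>I. \<Sum>j\<in>I. k i * l j * P i j)"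

definition delta :: "'i \<Rightarrow> 'i \<Rightarrow> int" where
  "delta i = (\<lambda>j. of_bool (j = i))"

fun gdeg :: "'i laurent_gen \<Rightarrow> 'i \<Rightarrow> int" where
  "gdeg (Gen i) = delta i"
| "gdeg (Gen_inv i) = (\<lambda>j. - delta i j)"

fun wdeg :: "'i laurent_gen list \<Rightarrow> 'i \<Rightarrow> int" where
  "wdeg [] = (\<lambda>i. 0)"
| "wdeg (g # u) = (\<lambda>i. gdeg g i + wdeg u i)"

fun wexp :: "'i laurent_gen list \<Rightarrow> int" where
  "wexp [] = 0"
| "wexp (g # u) = form (gdeg g) (wdeg u) + wexp u"

lemma form_add_left: "form (\<lambda>i. k i + k' i) l = form k l + form k' l"
  and form_add_right: "form k (\<lambda>i. l i + l' i) = form k l + form k l'"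
  and form_diff_right: "form k (\<lambda>i. l i - l' i) = form k l - form k l'"
  and form_minus_left: "form (\<lambda>i. - k i) l = - form k l"
  and form_minus_right: "form k (\<lambda>i. - l i) = - form k l"
  and form_0_left [simp]: "form (\<lambda>i. 0) l = 0"
  and form_0_right [simp]: "form k (\<lambda>i. 0) = 0"
  by (simp_all add: form_def distrib_right distrib_left sum.distrib sum_negf right_diff_distrib left_diff_distrib sum_subtractf)

lemma form_antisym: "form k l = - form l k"
proof -
  have "form k l = (\<Sum>j\<in>I. \<Sum>i\<in>I. k i * l j * P i j)" unfolding form_def by (rule sum.swap)
  also have "\<dots> = (\<Sum>j\<in>I. \<Sum>i\<in>I. - (l j * k i * P j i))"
  proof (intro sum.cong refl)
    fix i j
    show "k i * l j * P i j = - (l j * k i * P j i)" using antisym[of i j] by simp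
  qed
  finally show ?thesis by (simp add: form_def sum_negf)
qed

lemma form_self [simp]: "form k k = 0"
  using form_antisym[of k k] by simp

lemma form_delta_right: "j \<in> I \<Longrightarrow> form k (delta j) = (\<Sum>i\<in>I. k i * P i j)"
proof -
  assume j: "j \<in> I"
  have "k i * delta j j' * P i j' = (if j' = j then k i * P i j else 0)" for i j'
    by (simp add: delta_def)
  then show ?thesis using j finite_I by (simp add: form_def)
qed

lemma form_delta_delta: "i \<in> I \<Longrightarrow> j \<in> I \<Longrightarrow> form (delta i) (delta j) = P i j"
  using finite_I by (simp add: form_delta_right) (simp add: delta_def)

lemma wdeg_append: "wdeg (u @ v) = (\<lambda>i. wdeg u i + wdeg v i)"
  by (induction u) (auto simp: fun_eq_iff)

lemma wexp_append: "wexp (u @ v) = wexp u + wexp v + form (wdeg u) (wdeg v)"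
  by (induction u) (auto simp: wdeg_append form_add_left form_add_right)

definition coefs :: "('i laurent_gen free_word \<Rightarrow>\<^sub>0 'r) \<Rightarrow> ('i \<Rightarrow> int) \<Rightarrow> 'r" where
  "coefs a k = (\<Sum>w\<in>Poly_Mapping.keys a. if wdeg (letters w) = k then Poly_Mapping.lookup a w * qp (wexp (letters w)) else 0)"

lemma coefs_superset:
  assumes "finite X" "Poly_Mapping.keys a \<subseteq> X"
  shows "coefs a k = (\<Sum>w\<in>X. if wdeg (letters w) = k then Poly_Mapping.lookup a w * qp (wexp (letters w)) else 0)"
  unfolding coefs_def using assms by (intro sum.mono_neutral_left) (auto simp: in_keys_iff)

lemma coefs_add: "coefs (a + b) k = coefs a k + coefs b k"
proof -
  let ?X = "Poly_Mapping.keys a \<union> Poly_Mapping.keys b"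
  have "coefs (a + b) k = (\<Sum>w\<in>?X. if wdeg (letters w) = k then Poly_Mapping.lookup (a + b) w * qp (wexp (letters w)) else 0)"
    by (rule coefs_superset) (use keys_add[of a b] in auto)
  also have "\<dots> = (\<Sum>w\<in>?X. (if wdeg (letters w) = k then Poly_Mapping.lookup a w * qp (wexp (letters w)) else 0) +
      (if wdeg (letters w) = k then Poly_Mapping.lookup b w * qp (wexp (letters w)) else 0))"
    by (intro sum.cong) (auto simp: lookup_add distrib_right)
  also have "\<dots> = coefs a k + coefs b k"
    unfolding sum.distrib by (subst (1 2) coefs_superset[of ?X]) auto
  finally show ?thesis .
qed

lemma coefs_0 [simp]: "coefs 0 k = 0"
  by (simp add: coefs_def)

lemma coefs_uminus: "coefs (- a) k = - coefs a k"
  using coefs_add[of a "- a" k] by (simp add: minus_unique)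

lemma coefs_diff: "coefs (a - b) k = coefs a k - coefs b k"
  using coefs_add[of a "- b" k] by (simp add: coefs_uminus)

lemma coefs_sum: "coefs (sum f X) k = (\<Sum>x\<in>X. coefs (f x) k)"
  by (induction X rule: infinite_finite_induct) (simp_all add: coefs_add)

lemma coefs_single:
  "coefs (Poly_Mapping.single w r) k = (if wdeg (letters w) = k then r * qp (wexp (letters w)) else 0)"
  by (simp add: coefs_def)

lemma coefs_1: "coefs 1 k = of_bool (k = (\<lambda>i. 0))"
  using coefs_single[of 0 1 k] by auto

lemma coefs_single_mult:
  "coefs (Poly_Mapping.single u r * b) k =
    r * qp (wexp (letters u)) * qp (form (wdeg (letters u)) (\<lambda>i. k i - wdeg (letters u) i)) * coefs b (\<lambda>i. k i - wdeg (letters u) i)"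
proof -
  let ?u = "letters u"
  have "Poly_Mapping.single u r * b = (\<Sum>w\<in>Poly_Mapping.keys b. Poly_Mapping.single (u + w) (r * Poly_Mapping.lookup b w))"
    by (subst poly_mapping_sum_singles[of b]) (simp add: sum_distrib_left mult_single)
  then have "coefs (Poly_Mapping.single u r * b) k =
     (\<Sum>w\<in>Poly_Mapping.keys b. if wdeg (?u @ letters w) = k then r * Poly_Mapping.lookup b w * qp (wexp (?u @ letters w)) else 0)"
    by (simp add: coefs_sum coefs_single cong: if_cong)
  also have "\<dots> = (\<Sum>w\<in>Poly_Mapping.keys b. r * qp (wexp ?u) * qp (form (wdeg ?u) (\<lambda>i. k i - wdeg ?u i)) *
     (if wdeg (letters w) = (\<lambda>i. k i - wdeg ?u i) then Poly_Mapping.lookup b w * qp (wexp (letters w)) else 0))"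
  proof (rule sum.cong[OF refl])
    fix w
    have *: "wdeg (?u @ letters w) = k \<longleftrightarrow> wdeg (letters w) = (\<lambda>i. k i - wdeg ?u i)"
      by (auto simp: wdeg_append fun_eq_iff algebra_simps)
    show "(if wdeg (?u @ letters w) = k then r * Poly_Mapping.lookup b w * qp (wexp (?u @ letters w)) else 0) =
       r * qp (wexp ?u) * qp (form (wdeg ?u) (\<lambda>i. k i - wdeg ?u i)) *
     (if wdeg (letters w) = (\<lambda>i. k i - wdeg ?u i) then Poly_Mapping.lookup b w * qp (wexp (letters w)) else 0)"
      unfolding * by (auto simp: wexp_append qp_add mult_ac)
  qed
  finally show ?thesis by (simp add: coefs_def sum_distrib_left)
qed

lemma coefs_keys:
  assumes "coefs a k \<noteq> 0"
  shows "k \<in> (\<lambda>w. wdeg (letters w)) ` Poly_Mapping.keys a"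
proof (rule ccontr)
  assume "k \<notin> (\<lambda>w. wdeg (letters w)) ` Poly_Mapping.keys a"
  then have "coefs a k = 0" unfolding coefs_def by (intro sum.neutral) auto
  then show False using assms by simp
qed

lemma finite_coefs: "finite {k. coefs a k \<noteq> 0}"
  by (rule finite_subset[of _ "(\<lambda>w. wdeg (letters w)) ` Poly_Mapping.keys a"]) (use coefs_keys in blast, simp)

text \<open>This is the twisted convolution. The index set may be any finite set containing the
  support, so it can be taken empty when \<open>a\<close> has no coefficients and a singleton for a
  monomial.\<close>

lemma coefs_mult:
  assumes "finite D" "{l. coefs a l \<noteq> 0} \<subseteq> D"
  shows "coefs (a * b) k = (\<Sum>l\<in>D. coefs a l * qp (form l (\<lambda>i. k i - l i)) * coefs b (\<lambda>i. k i - l i))"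
proof -
  let ?K = "Poly_Mapping.keys a" and ?d = "\<lambda>w. wdeg (letters w)"
  let ?t = "\<lambda>l. qp (form l (\<lambda>i. k i - l i)) * coefs b (\<lambda>i. k i - l i)"
  let ?c = "\<lambda>w. Poly_Mapping.lookup a w * qp (wexp (letters w))"
  have "coefs (a * b) k = (\<Sum>w\<in>?K. ?c w * ?t (?d w))"
    by (subst poly_mapping_sum_singles[of a]) (simp add: sum_distrib_right coefs_sum coefs_single_mult mult.assoc)
  also have "\<dots> = (\<Sum>l\<in>?d ` ?K. \<Sum>w\<in>{w\<in>?K. ?d w = l}. ?c w * ?t (?d w))"
    by (rule sum.image_gen) simp
  also have "\<dots> = (\<Sum>l\<in>?d ` ?K. coefs a l * ?t l)"
  proof (rule sum.cong[OF refl])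
    fix l
    have "(\<Sum>w\<in>{w\<in>?K. ?d w = l}. ?c w * ?t (?d w)) = (\<Sum>w\<in>{w\<in>?K. ?d w = l}. ?c w) * ?t l"
      unfolding sum_distrib_right by (intro sum.cong) auto
    also have "(\<Sum>w\<in>{w\<in>?K. ?d w = l}. ?c w) = coefs a l"
      by (simp add: coefs_def sum.If_cases Int_def)
    finally show "(\<Sum>w\<in>{w\<in>?K. ?d w = l}. ?c w * ?t (?d w)) = coefs a l * ?t l" .
  qed
  also have "\<dots> = (\<Sum>l\<in>{l. coefs a l \<noteq> 0}. coefs a l * ?t l)"
    using coefs_keys by (intro sum.mono_neutral_right) auto
  also have "\<dots> = (\<Sum>l\<in>D. coefs a l * ?t l)"
    using assms by (intro sum.mono_neutral_left) auto
  finally show ?thesis by (simp add: mult.assoc)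
qed

subsection \<open>The quotient\<close>

lemma F_simps [simp]: "a \<otimes>\<^bsub>F\<^esub> b = a * b" "\<one>\<^bsub>F\<^esub> = 1" "a \<oplus>\<^bsub>F\<^esub> b = a + b" "\<zero>\<^bsub>F\<^esub> = 0"
  by (simp_all add: qt_free_def)

lemma F_carrier: "a \<in> carrier F \<longleftrightarrow> (\<forall>w\<in>Poly_Mapping.keys a. set (letters w) \<subseteq> G)"
  by (simp add: qt_free_def free_algebra_carrier)

lemma F_closed: "a \<in> carrier F \<Longrightarrow> b \<in> carrier F \<Longrightarrow> a + b \<in> carrier F"
  "a \<in> carrier F \<Longrightarrow> b \<in> carrier F \<Longrightarrow> a * b \<in> carrier F"
  "a \<in> carrier F \<Longrightarrow> - a \<in> carrier F"
  "a \<in> carrier F \<Longrightarrow> b \<in> carrier F \<Longrightarrow> a - b \<in> carrier F"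
  using free_algebra_closed(1)[of a G "- b"] by (simp_all add: qt_free_def free_algebra_closed)

lemma F_single: "set u \<subseteq> G \<Longrightarrow> Poly_Mapping.single (Word u) r \<in> carrier F"
  "scalar r \<in> carrier F" "g \<in> G \<Longrightarrow> letter g \<in> carrier F" "1 \<in> carrier F" "0 \<in> carrier F"
  by (auto simp: F_carrier scalar_def letter_def)

sublocale F: ring F
  by (simp add: qt_free_def ring_free_algebra)

lemma F_minus: "a \<in> carrier F \<Longrightarrow> \<ominus>\<^bsub>F\<^esub> a = - a"
  using F_closed(3) by (intro F.minus_equality) auto

lemma relators_carrier: "qt_relators q I P \<subseteq> carrier F"
  unfolding qt_relators_def by (auto intro!: F_closed F_single)

lemma ideal_J: "ideal J F"
  unfolding qt_ideal_def by (rule F.genideal_ideal[OF relators_carrier])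

sublocale J: ideal J F
  by (rule ideal_J)

lemma relators_J: "a \<in> qt_relators q I P \<Longrightarrow> a \<in> J"
  unfolding qt_ideal_def using F.genideal_self[OF relators_carrier] by blast

sublocale A: ring A
  unfolding quantum_torus_def by (rule J.quotient_is_ring)

lemma pr_hom: "pr \<in> ring_hom F A"
  unfolding quantum_torus_def by (rule J.rcos_ring_hom)

lemma pr_closed: "a \<in> carrier F \<Longrightarrow> pr a \<in> carrier A"
  and pr_mult: "a \<in> carrier F \<Longrightarrow> b \<in> carrier F \<Longrightarrow> pr (a * b) = pr a \<otimes>\<^bsub>A\<^esub> pr b"
  and pr_add: "a \<in> carrier F \<Longrightarrow> b \<in> carrier F \<Longrightarrow> pr (a + b) = pr a \<oplus>\<^bsub>A\<^esub> pr b"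
  and pr_1: "pr 1 = \<one>\<^bsub>A\<^esub>"
  using ring_hom_closed[OF pr_hom] ring_hom_mult[OF pr_hom, of a b] ring_hom_add[OF pr_hom, of a b] ring_hom_one[OF pr_hom] by simp_all

lemma pr_surj: "z \<in> carrier A \<Longrightarrow> \<exists>a\<in>carrier F. z = pr a"
  by (auto simp: quantum_torus_def FactRing_def A_RCOSETS_def')

lemma pr_eq_iff:
  assumes "a \<in> carrier F" "b \<in> carrier F"
  shows "pr a = pr b \<longleftrightarrow> a - b \<in> J"
proof -
  have "pr a = pr b \<longleftrightarrow> a \<ominus>\<^bsub>F\<^esub> b \<in> J"
    using F.quotient_eq_iff_same_a_r_cos[OF ideal_J assms] by simp
  also have "a \<ominus>\<^bsub>F\<^esub> b = a - b" using assms by (simp add: a_minus_def F_minus)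
  finally show ?thesis .
qed

text \<open>The elements without coefficients form a two-sided ideal that contains the relators.
  Hence coefficients descend to the quotient, and monomials of different degrees stay independent
  there.\<close>

lemma coefs_J:
  assumes "a \<in> J"
  shows "coefs a k = 0"
proof -
  let ?N = "{a \<in> carrier F. \<forall>k. coefs a k = 0}"
  have "ideal ?N F"
  proof (rule idealI[OF F.ring_axioms])
    show "subgroup ?N (add_monoid F)"
    proof (rule F.add.subgroupI)
      show "?N \<noteq> {}" using F_single(5) by auto
      fix a assume "a \<in> ?N"
      then show "\<ominus>\<^bsub>F\<^esub> a \<in> ?N" by (auto simp: F_minus F_closed coefs_uminus)
    qed (auto simp: F_closed coefs_add)
  next
    fix a x assume a: "a \<in> ?N" and x: "x \<in> carrier F"
    have "coefs (x * a) k = 0" for k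
      using coefs_mult[OF finite_coefs subset_refl, of x a k] a by simp
    then show "x \<otimes>\<^bsub>F\<^esub> a \<in> ?N" using a x by (simp add: F_closed)
    have "coefs (a * x) k = 0" for k
      using coefs_mult[of "{}" a x k] a by simp
    then show "a \<otimes>\<^bsub>F\<^esub> x \<in> ?N" using a x by (simp add: F_closed)
  qed
  moreover have "qt_relators q I P \<subseteq> ?N"
  proof
    fix a assume a: "a \<in> qt_relators q I P"
    then have "a \<in> carrier F" using relators_carrier by blast
    moreover have "coefs a k = 0" for k
    proof -
      have inv: "coefs (letter g * letter h - 1) k = 0" if "gdeg h = (\<lambda>i. - gdeg g i)" for g h
        using that by (auto simp: letter_def mult_single coefs_diff coefs_single coefs_1 form_minus_right form_minus_left)
      have comm: "coefs (letter (Gen i) * letter (Gen j) - scalar (qp (2 * P i j)) * (letter (Gen j) * letter (Gen i))) k = 0"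
        if ij: "i \<in> I" "j \<in> I" for i j
      proof -
        have "qp (2 * P i j) * qp (P j i) = qp (P i j)" using antisym[of j i] by (simp flip: qp_add)
        moreover have "(\<lambda>x. delta i x + delta j x) = (\<lambda>x. delta j x + delta i x)" by (simp add: add.commute)
        ultimately show ?thesis
          by (simp add: letter_def scalar_def mult_single coefs_diff coefs_single form_delta_delta ij)
      qed
      show ?thesis using a inv comm unfolding qt_relators_def by auto
    qed
    ultimately show "a \<in> ?N" by simp
  qed
  ultimately have "J \<subseteq> ?N" unfolding qt_ideal_def by (rule F.genideal_minimal)
  then show ?thesis using assms by blast
qed

lemma coefs_pr_eq: "a \<in> carrier F \<Longrightarrow> b \<in> carrier F \<Longrightarrow> pr a = pr b \<Longrightarrow> coefs a k = coefs b k"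
  using coefs_J[of "a - b" k] by (simp add: pr_eq_iff coefs_diff)

subsection \<open>Words of equal degree\<close>

definition word :: "'i laurent_gen list \<Rightarrow> ('i laurent_gen free_word \<Rightarrow>\<^sub>0 'r) set" where
  "word u = pr (Poly_Mapping.single (Word u) 1)"

abbreviation sc where "sc \<equiv> qt_scalar q I P"

lemma sc_closed: "sc r \<in> carrier A"
  unfolding qt_scalar_def by (intro pr_closed F_single)

lemma sc_mult: "sc r \<otimes>\<^bsub>A\<^esub> sc s = sc (r * s)"
  unfolding qt_scalar_def using pr_mult[OF F_single(2) F_single(2), of r s] by (simp add: scalar_def mult_single)

lemma sc_1: "sc 1 = \<one>\<^bsub>A\<^esub>"
  unfolding qt_scalar_def scalar_def by (simp add: pr_1)

lemma scalar_commute: "scalar r * a = a * scalar r"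
  by (subst (1 2) poly_mapping_sum_singles[of a]) (simp add: scalar_def sum_distrib_left sum_distrib_right mult_single mult.commute)

lemma sc_commute: "x \<in> carrier A \<Longrightarrow> x \<otimes>\<^bsub>A\<^esub> sc r = sc r \<otimes>\<^bsub>A\<^esub> x"
  using pr_surj[of x] unfolding qt_scalar_def by (auto simp flip: pr_mult simp: F_single scalar_commute)

lemma word_closed: "set u \<subseteq> G \<Longrightarrow> word u \<in> carrier A"
  unfolding word_def by (intro pr_closed F_single)

lemma word_append: "set u \<subseteq> G \<Longrightarrow> set v \<subseteq> G \<Longrightarrow> word (u @ v) = word u \<otimes>\<^bsub>A\<^esub> word v"
  unfolding word_def by (subst pr_mult[symmetric]) (auto simp: F_single mult_single Word_add)

text \<open>The scalar is left unspecified while words are rearranged; \<open>word_eq\<close>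
  recovers it at the end by comparing coefficients.\<close>

definition weq :: "'i laurent_gen list \<Rightarrow> 'i laurent_gen list \<Rightarrow> bool" where
  "weq u v \<longleftrightarrow> set u \<subseteq> G \<and> set v \<subseteq> G \<and> (\<exists>c. c dvd 1 \<and> word u = sc c \<otimes>\<^bsub>A\<^esub> word v)"

lemma weq_refl: "set u \<subseteq> G \<Longrightarrow> weq u u"
  unfolding weq_def using sc_1 A.l_one[OF word_closed] by (metis dvd_refl)

lemma weq_sym:
  assumes "weq u v"
  shows "weq v u"
proof -
  obtain c where c: "c dvd 1" "word u = sc c \<otimes>\<^bsub>A\<^esub> word v" "set u \<subseteq> G" "set v \<subseteq> G" using assms by (auto simp: weq_def)
  obtain d where d: "1 = c * d" using c(1) by (auto simp: dvd_def)
  have "sc d \<otimes>\<^bsub>A\<^esub> word u = sc (d * c) \<otimes>\<^bsub>A\<^esub> word v"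
    using c by (simp add: sc_mult[symmetric] A.m_assoc sc_closed word_closed)
  then have "word v = sc d \<otimes>\<^bsub>A\<^esub> word u" using d c by (simp add: mult.commute sc_1 word_closed)
  moreover have "d dvd 1" using d by (metis dvd_triv_right)
  ultimately show ?thesis using c unfolding weq_def by blast
qed

lemma weq_trans:
  assumes "weq u v" "weq v w"
  shows "weq u w"
proof -
  obtain c d where c: "c dvd 1" "word u = sc c \<otimes>\<^bsub>A\<^esub> word v" "d dvd 1" "word v = sc d \<otimes>\<^bsub>A\<^esub> word w"
    "set u \<subseteq> G" "set v \<subseteq> G" "set w \<subseteq> G" using assms by (auto simp: weq_def)
  have "word u = sc (c * d) \<otimes>\<^bsub>A\<^esub> word w"
    using c by (simp add: sc_mult[symmetric] A.m_assoc sc_closed word_closed)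
  moreover have "c * d dvd 1" using mult_dvd_mono[OF c(1,3)] by simp
  ultimately show ?thesis using c unfolding weq_def by blast
qed

lemma weq_append:
  assumes "weq u v" "weq u' v'"
  shows "weq (u @ u') (v @ v')"
proof -
  obtain c d where c: "c dvd 1" "word u = sc c \<otimes>\<^bsub>A\<^esub> word v" "d dvd 1" "word u' = sc d \<otimes>\<^bsub>A\<^esub> word v'"
    "set u \<subseteq> G" "set v \<subseteq> G" "set u' \<subseteq> G" "set v' \<subseteq> G" using assms by (auto simp: weq_def)
  note cl = sc_closed word_closed[OF c(5)] word_closed[OF c(6)] word_closed[OF c(7)] word_closed[OF c(8)]
  have "word (u @ u') = sc c \<otimes>\<^bsub>A\<^esub> (word v \<otimes>\<^bsub>A\<^esub> sc d) \<otimes>\<^bsub>A\<^esub> word v'"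
    using cl by (simp add: word_append c A.m_assoc)
  also have "\<dots> = sc c \<otimes>\<^bsub>A\<^esub> (sc d \<otimes>\<^bsub>A\<^esub> word v) \<otimes>\<^bsub>A\<^esub> word v'"
    using sc_commute[OF cl(3)] by simp
  also have "\<dots> = sc (c * d) \<otimes>\<^bsub>A\<^esub> word (v @ v')"
    using cl by (simp add: word_append c A.m_assoc sc_mult[symmetric])
  finally have "word (u @ u') = sc (c * d) \<otimes>\<^bsub>A\<^esub> word (v @ v')" .
  moreover have "c * d dvd 1" using mult_dvd_mono[OF c(1,3)] by simp
  ultimately show ?thesis using c unfolding weq_def by auto
qed

fun ginv :: "'i laurent_gen \<Rightarrow> 'i laurent_gen" where
  "ginv (Gen i) = Gen_inv i"
| "ginv (Gen_inv i) = Gen i"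

lemma ginv_G: "g \<in> G \<Longrightarrow> ginv g \<in> G"
  by (cases g) auto

lemma ginv_ginv [simp]: "ginv (ginv g) = g"
  by (cases g) auto

lemma gdeg_ginv: "gdeg (ginv g) = (\<lambda>i. - gdeg g i)"
  by (cases g) auto

lemma word_cancel: "g \<in> G \<Longrightarrow> weq [g, ginv g] []"
proof -
  assume g: "g \<in> G"
  have "letter g * letter (ginv g) - 1 \<in> qt_relators q I P"
    using g by (cases g) (auto simp: qt_relators_def)
  then have "pr (letter g * letter (ginv g)) = pr 1"
    using g ginv_G[OF g] by (simp add: pr_eq_iff F_closed F_single relators_J)
  then have "word [g, ginv g] = word []"
    by (simp add: word_def letter_def mult_single Word_add flip: zero_eq_Word)
  then show ?thesis
    using g ginv_G[OF g] weq_refl[of "[]"] by (simp add: weq_def)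
qed

text \<open>Only products of two positive letters are covered by the relators. Multiplying such a
  relation by the inverse of \<open>h\<close> on both sides yields the relations for inverse
  letters.\<close>

lemma word_commute_conj:
  assumes gh: "g \<in> G" "h \<in> G" and "weq [g, h] [h, g]"
  shows "weq [ginv h, g] [g, ginv h]"
proof -
  have h': "ginv h \<in> G" using ginv_G gh by blast
  have r: "weq [x] [x]" if "x \<in> G" for x using that by (intro weq_refl) auto
  have 1: "weq ([ginv h] @ [h, g] @ [ginv h]) ([] @ [g] @ [ginv h])"
    using weq_append[OF weq_append[OF word_cancel[OF h'] r[OF gh(1)]] r[OF h']] by simp
  have 2: "weq ([ginv h] @ [g, h] @ [ginv h]) ([ginv h] @ [g] @ [])"
    using weq_append[OF r[OF h'] weq_append[OF r[OF gh(1)] word_cancel[OF gh(2)]]] by simp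
  have 3: "weq ([ginv h] @ [g, h] @ [ginv h]) ([ginv h] @ [h, g] @ [ginv h])"
    by (intro weq_append r h' assms(3))
  show ?thesis using weq_trans[OF weq_sym[OF 2] weq_trans[OF 3 1]] by simp
qed

lemma word_commute: "g \<in> G \<Longrightarrow> h \<in> G \<Longrightarrow> weq [g, h] [h, g]"
proof -
  have 1: "weq [Gen i, Gen j] [Gen j, Gen i]" if ij: "i \<in> I" "j \<in> I" for i j
  proof -
    let ?c = "qp (2 * P i j)"
    have "letter (Gen i) * letter (Gen j) - scalar ?c * (letter (Gen j) * letter (Gen i)) \<in> J"
      by (rule relators_J) (use ij in \<open>auto simp: qt_relators_def\<close>)
    then have "pr (letter (Gen i) * letter (Gen j)) = pr (scalar ?c * (letter (Gen j) * letter (Gen i)))"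
      using ij by (subst pr_eq_iff) (auto intro!: F_closed F_single)
    then have "word [Gen i, Gen j] = sc ?c \<otimes>\<^bsub>A\<^esub> word [Gen j, Gen i]"
      using ij by (simp add: word_def letter_def mult_single Word_add qt_scalar_def pr_mult F_single)
    then show ?thesis using ij unit_powi_unit[OF q] unfolding weq_def by auto
  qed
  have 2: "weq [Gen_inv j, Gen i] [Gen i, Gen_inv j]" if "i \<in> I" "j \<in> I" for i j
    using word_commute_conj[OF _ _ 1[OF that]] that by simp
  have 3: "weq [Gen_inv i, Gen_inv j] [Gen_inv j, Gen_inv i]" if "i \<in> I" "j \<in> I" for i j
    using word_commute_conj[OF _ _ 2[OF that]] that by simp
  assume "g \<in> G" "h \<in> G"
  then show ?thesis by (cases g; cases h) (auto intro: 1 2 3 weq_sym)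
qed

lemma word_move: "g \<in> G \<Longrightarrow> set a \<subseteq> G \<Longrightarrow> weq ([g] @ a) (a @ [g])"
proof (induction a)
  case (Cons h a)
  then have 1: "weq ([g, h] @ a) ([h, g] @ a)"
    by (intro weq_append[OF word_commute weq_refl]) auto
  have "weq ([h] @ ([g] @ a)) ([h] @ (a @ [g]))"
    using Cons by (intro weq_append[OF weq_refl]) auto
  then show ?case using weq_trans[of "[g, h] @ a"] 1 by simp
qed (auto intro: weq_refl)

lemma gdeg_coeff: "wdeg u i \<noteq> 0 \<Longrightarrow> (if 0 < wdeg u i then Gen i else Gen_inv i) \<in> set u"
proof (induction u)
  case (Cons g u)
  show ?case
  proof (cases g)
    case (Gen j)
    then show ?thesis using Cons by (cases "j = i") (auto simp: delta_def split: if_splits)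
  next
    case (Gen_inv j)
    then show ?thesis using Cons by (cases "j = i") (auto simp: delta_def split: if_splits)
  qed
qed simp

text \<open>In a word of degree zero the inverse of the first letter occurs later; moving the first
  letter next to it shortens the word by two.\<close>

lemma weq_Nil:
  assumes "set u \<subseteq> G" "wdeg u = (\<lambda>i. 0)"
  shows "weq u []"
  using assms
proof (induction "length u" arbitrary: u rule: less_induct)
  case less
  show ?case
  proof (cases u)
    case Nil
    then show ?thesis by (simp add: weq_refl)
  next
    case (Cons g v)
    have deg: "gdeg g i + wdeg v i = 0" for i using less.prems(2) Cons by (simp add: fun_eq_iff)
    have "ginv g \<in> set v"
    proof (cases g)
      case (Gen i)
      then have "wdeg v i = - 1" using deg[of i] by (simp add: delta_def)
      then show ?thesis using gdeg_coeff[of v i] Gen by simp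
    next
      case (Gen_inv i)
      then have "wdeg v i = 1" using deg[of i] by (simp add: delta_def)
      then show ?thesis using gdeg_coeff[of v i] Gen_inv by simp
    qed
    then obtain a b where v: "v = a @ ginv g # b" by (meson split_list)
    have G: "g \<in> G" "set a \<subseteq> G" "set b \<subseteq> G" "ginv g \<in> G" using less.prems(1) Cons v by auto
    have 1: "weq (([g] @ a) @ (ginv g # b)) ((a @ [g]) @ (ginv g # b))"
      by (intro weq_append word_move weq_refl) (use G in auto)
    have 2: "weq (a @ ([g, ginv g] @ b)) (a @ ([] @ b))"
      by (intro weq_append word_cancel weq_refl) (use G in auto)
    have "weq u (a @ b)" using weq_trans[of u] 1 2 Cons v by simp
    moreover have "wdeg (a @ b) = (\<lambda>i. 0)"
      using deg by (simp add: v wdeg_append gdeg_ginv fun_eq_iff) 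
    then have "weq (a @ b) []" using less.hyps[of "a @ b"] G Cons v by simp
    ultimately show ?thesis by (rule weq_trans)
  qed
qed

text \<open>Both \<open>u @ v'\<close> and \<open>v' @ v\<close> have degree zero and can be
  removed, so \<open>u @ v' @ v\<close> reduces to either word.\<close>

lemma weq_deg:
  assumes u: "set u \<subseteq> G" and v: "set v \<subseteq> G" and deg: "wdeg u = wdeg v"
  shows "weq u v"
proof -
  \<comment> \<open>The order need not be reversed, as only the degree of this word matters.\<close>
  define v' where "v' = map ginv v"
  have v': "set v' \<subseteq> G" using v ginv_G unfolding v'_def by auto
  have d: "wdeg v' = (\<lambda>i. - wdeg v i)" unfolding v'_def by (induction v) (auto simp: gdeg_ginv fun_eq_iff)
  have 1: "weq (u @ (v' @ v)) (u @ [])"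
    by (intro weq_append weq_refl weq_Nil) (use u v v' d in \<open>auto simp: wdeg_append\<close>)
  have 2: "weq ((u @ v') @ v) ([] @ v)"
    by (intro weq_append weq_refl weq_Nil) (use u v v' d deg in \<open>auto simp: wdeg_append\<close>)
  show ?thesis using weq_trans[OF weq_sym[OF 1]] 2 by simp
qed

text \<open>The unknown scalar is read off in the coefficient of degree \<open>wdeg u\<close>, where
  both words have a nonzero coefficient.\<close>

lemma word_eq:
  assumes u: "set u \<subseteq> G" and v: "set v \<subseteq> G" and deg: "wdeg u = wdeg v"
  shows "word u = sc (qp (wexp u - wexp v)) \<otimes>\<^bsub>A\<^esub> word v"
proof -
  obtain c where c: "word u = sc c \<otimes>\<^bsub>A\<^esub> word v" using weq_deg[OF assms] by (auto simp: weq_def)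
  have "pr (Poly_Mapping.single (Word u) 1) = pr (Poly_Mapping.single (Word v) c)"
    using c pr_mult[OF F_single(2) F_single(1)[OF v], of c 1] by (simp add: word_def qt_scalar_def scalar_def mult_single)
  then have "coefs (Poly_Mapping.single (Word u) 1) (wdeg u) = coefs (Poly_Mapping.single (Word v) c) (wdeg u)"
    by (intro coefs_pr_eq F_single u v)
  then have "qp (wexp u) = c * qp (wexp v)" by (simp add: coefs_single deg)
  moreover have "qp (wexp u) = qp (wexp u - wexp v) * qp (wexp v)" by (simp flip: qp_add)
  ultimately have "c = qp (wexp u - wexp v)" using qp_nonzero[of "wexp v"] by simp
  then show ?thesis using c by simp
qed

text \<open>Modulo the ideal every word is a multiple of one representative of its degree.
  Collecting terms leaves on each representative a multiple of the coefficient in that degree, which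
  is zero.\<close>

lemma coefs_inj_0:
  assumes a: "a \<in> carrier F" and zero: "\<And>k. coefs a k = 0"
  shows "a \<in> J"
proof -
  let ?K = "Poly_Mapping.keys a" and ?d = "\<lambda>w. wdeg (letters w)"
  define rep where "rep k = (SOME w. w \<in> ?K \<and> ?d w = k)" for k
  have rep: "rep (?d w) \<in> ?K \<and> ?d (rep (?d w)) = ?d w" if "w \<in> ?K" for w
    unfolding rep_def by (rule someI[of _ w]) (use that in simp)
  define c where "c w = Poly_Mapping.lookup a w * qp (wexp (letters w))" for w
  define e where "e k = qp (- wexp (letters (rep k)))" for k
  have G: "set (letters w) \<subseteq> G" if "w \<in> ?K" for w using a that F_carrier by blast
  have cl: "Poly_Mapping.single w r \<in> carrier F" if "w \<in> ?K" for w r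
    using F_single(1)[OF G[OF that]] by simp
  have sums: "sum f X \<in> carrier F" if "\<And>x. x \<in> X \<Longrightarrow> f x \<in> carrier F" for f and X :: "'i laurent_gen free_word set"
    using that by (induction X rule: infinite_finite_induct) (auto intro: F_closed F_single)
  have single: "Poly_Mapping.single w (Poly_Mapping.lookup a w) - Poly_Mapping.single (rep (?d w)) (c w * e (?d w)) \<in> J"
    if w: "w \<in> ?K" for w
  proof -
    let ?r = "rep (?d w)" and ?l = "Poly_Mapping.lookup a w"
    have "word (letters w) = sc (qp (wexp (letters w) - wexp (letters ?r))) \<otimes>\<^bsub>A\<^esub> word (letters ?r)"
      using rep[OF w] G w by (intro word_eq) auto
    then have "sc ?l \<otimes>\<^bsub>A\<^esub> word (letters w) = sc (c w * e (?d w)) \<otimes>\<^bsub>A\<^esub> word (letters ?r)"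
      using rep[OF w] G w
      by (simp add: A.m_assoc[symmetric] sc_closed word_closed sc_mult c_def e_def mult.assoc diff_conv_add_uminus qp_add del: add_uminus_conv_diff)
    then have "pr (Poly_Mapping.single w ?l) = pr (Poly_Mapping.single ?r (c w * e (?d w)))"
      using pr_mult[OF F_single(2) cl[OF w, of 1], of ?l] pr_mult[OF F_single(2) cl[of ?r 1], of "c w * e (?d w)"] rep[OF w]
      by (simp add: word_def qt_scalar_def scalar_def mult_single)
    then show ?thesis using rep[OF w] w by (simp add: pr_eq_iff cl)
  qed
  have Jsum: "sum f X \<in> J" if "\<And>x. x \<in> X \<Longrightarrow> f x \<in> J" for f and X :: "'i laurent_gen free_word set"
    using that J.a_closed J.zero_closed by (induction X rule: infinite_finite_induct) auto
  have "(\<Sum>w\<in>?K. Poly_Mapping.single (rep (?d w)) (c w * e (?d w))) =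
      (\<Sum>k\<in>?d ` ?K. \<Sum>w\<in>{w\<in>?K. ?d w = k}. Poly_Mapping.single (rep (?d w)) (c w * e (?d w)))"
    by (rule sum.image_gen) simp
  also have "\<dots> = (\<Sum>k\<in>?d ` ?K. Poly_Mapping.single (rep k) (coefs a k * e k))"
  proof (rule sum.cong[OF refl])
    fix k
    have "(\<Sum>w\<in>{w\<in>?K. ?d w = k}. Poly_Mapping.single (rep (?d w)) (c w * e (?d w))) =
       (\<Sum>w\<in>{w\<in>?K. ?d w = k}. Poly_Mapping.single (rep k) (c w * e k))"
      by (intro sum.cong) auto
    also have "\<dots> = Poly_Mapping.single (rep k) ((\<Sum>w\<in>{w\<in>?K. ?d w = k}. c w) * e k)"
      by (simp add: sum_distrib_right single_sum)
    also have "(\<Sum>w\<in>{w\<in>?K. ?d w = k}. c w) = coefs a k"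
      by (simp add: coefs_def c_def sum.If_cases Int_def)
    finally show "(\<Sum>w\<in>{w\<in>?K. ?d w = k}. Poly_Mapping.single (rep (?d w)) (c w * e (?d w))) =
      Poly_Mapping.single (rep k) (coefs a k * e k)" .
  qed
  also have "\<dots> = 0" by (simp add: zero)
  finally have "a = (\<Sum>w\<in>?K. Poly_Mapping.single w (Poly_Mapping.lookup a w) - Poly_Mapping.single (rep (?d w)) (c w * e (?d w)))"
    by (simp add: sum_subtractf flip: poly_mapping_sum_singles)
  also have "\<dots> \<in> J" by (rule Jsum) (rule single)
  finally show ?thesis .
qed

subsection \<open>Monomials and the center\<close>

definition cf :: "('i laurent_gen free_word \<Rightarrow>\<^sub>0 'r) set \<Rightarrow> ('i \<Rightarrow> int) \<Rightarrow> 'r" where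
  "cf z = coefs (SOME a. a \<in> carrier F \<and> z = pr a)"

lemma cf_pr:
  assumes "a \<in> carrier F"
  shows "cf (pr a) = coefs a"
proof -
  define b where "b = (SOME b. b \<in> carrier F \<and> pr a = pr b)"
  have "b \<in> carrier F \<and> pr a = pr b" unfolding b_def by (rule someI[of _ a]) (use assms in simp)
  then have "coefs b = coefs a" using coefs_pr_eq[OF _ assms] by (intro ext) metis
  then show ?thesis by (simp add: cf_def b_def)
qed

lemma cf_inj:
  assumes "x \<in> carrier A" "y \<in> carrier A" "cf x = cf y"
  shows "x = y"
proof -
  obtain a b where ab: "a \<in> carrier F" "x = pr a" "b \<in> carrier F" "y = pr b"
    using pr_surj assms(1,2) by metis
  then have "a - b \<in> J" using assms(3) by (intro coefs_inj_0) (auto simp: F_closed coefs_diff cf_pr)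
  then show ?thesis using ab by (simp add: pr_eq_iff)
qed

lemma cf_add:
  assumes "x \<in> carrier A" "y \<in> carrier A"
  shows "cf (x \<oplus>\<^bsub>A\<^esub> y) k = cf x k + cf y k"
proof -
  obtain a b where ab: "a \<in> carrier F" "x = pr a" "b \<in> carrier F" "y = pr b"
    using pr_surj assms by metis
  then show ?thesis by (simp add: pr_add[symmetric] cf_pr F_closed coefs_add)
qed

lemma cf_mult:
  assumes "x \<in> carrier A" "y \<in> carrier A" "finite D" "{l. cf x l \<noteq> 0} \<subseteq> D"
  shows "cf (x \<otimes>\<^bsub>A\<^esub> y) k = (\<Sum>l\<in>D. cf x l * qp (form l (\<lambda>i. k i - l i)) * cf y (\<lambda>i. k i - l i))"
proof -
  obtain a b where ab: "a \<in> carrier F" "x = pr a" "b \<in> carrier F" "y = pr b"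
    using pr_surj assms(1,2) by metis
  then show ?thesis using assms(4) by (simp add: pr_mult[symmetric] cf_pr F_closed coefs_mult[OF assms(3)])
qed

lemma finite_cf: "x \<in> carrier A \<Longrightarrow> finite {k. cf x k \<noteq> 0}"
  using pr_surj[of x] finite_coefs by (auto simp: cf_pr)

lemma cf_support:
  assumes "x \<in> carrier A" "cf x k \<noteq> 0" "i \<notin> I"
  shows "k i = 0"
proof -
  obtain a where a: "a \<in> carrier F" "x = pr a" using pr_surj assms(1) by metis
  then obtain w where w: "w \<in> Poly_Mapping.keys a" "k = wdeg (letters w)"
    using coefs_keys[of a k] assms(2) by (auto simp: cf_pr)
  then have G: "set (letters w) \<subseteq> G" using a F_carrier by blast
  show ?thesis
  proof (rule ccontr)
    assume "k i \<noteq> 0"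
    then have "(if 0 < k i then Gen i else Gen_inv i) \<in> G" using gdeg_coeff[of "letters w" i] w(2) G by auto
    then show False using assms(3) by (auto split: if_splits)
  qed
qed

lemma cf_sc: "cf (sc r) = (\<lambda>k. if k = (\<lambda>i. 0) then r else 0)"
  unfolding qt_scalar_def cf_pr[OF F_single(2)] by (auto simp: scalar_def coefs_single)

text \<open>A monomial up to a unit of \<open>R\<close>. Scalars belong to every subalgebra under
  consideration, so neither the normalization nor the order of factors has to be tracked.\<close>

definition is_monomial :: "('i laurent_gen free_word \<Rightarrow>\<^sub>0 'r) set \<Rightarrow> ('i \<Rightarrow> int) \<Rightarrow> bool" where
  "is_monomial x k \<longleftrightarrow> x \<in> carrier A \<and> (\<exists>c. c dvd 1 \<and> cf x = (\<lambda>l. if l = k then c else 0))"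

lemma diff_eq_iff: "(\<lambda>i. m i - k i) = l \<longleftrightarrow> m = (\<lambda>i. k i + l i :: int)"
  by (auto simp: fun_eq_iff algebra_simps)

lemma cf_monomial_mult:
  assumes "x \<in> carrier A" "cf x = (\<lambda>l. if l = k then c else 0)" "y \<in> carrier A"
  shows "cf (x \<otimes>\<^bsub>A\<^esub> y) m = c * qp (form k m) * cf y (\<lambda>i. m i - k i)"
proof -
  have "cf (x \<otimes>\<^bsub>A\<^esub> y) m = (\<Sum>l\<in>{k}. cf x l * qp (form l (\<lambda>i. m i - l i)) * cf y (\<lambda>i. m i - l i))"
    by (rule cf_mult) (use assms in auto)
  then show ?thesis by (simp add: assms(2) form_diff_right)
qed

lemma cf_mult_monomial:
  assumes "x \<in> carrier A" "cf x = (\<lambda>l. if l = k then c else 0)" "y \<in> carrier A"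
  shows "cf (y \<otimes>\<^bsub>A\<^esub> x) m = c * qp (form m k) * cf y (\<lambda>i. m i - k i)"
proof -
  let ?D = "{l. cf y l \<noteq> 0}"
  have "cf (y \<otimes>\<^bsub>A\<^esub> x) m = (\<Sum>l\<in>?D. cf y l * qp (form l (\<lambda>i. m i - l i)) * cf x (\<lambda>i. m i - l i))"
    by (rule cf_mult) (use assms finite_cf in auto)
  also have "\<dots> = (\<Sum>l\<in>?D. if l = (\<lambda>i. m i - k i) then cf y l * qp (form l k) * c else 0)"
  proof (rule sum.cong[OF refl])
    fix l
    have "(\<lambda>i. m i - l i) = k \<longleftrightarrow> l = (\<lambda>i. m i - k i)" by (auto simp: fun_eq_iff algebra_simps)
    then show "cf y l * qp (form l (\<lambda>i. m i - l i)) * cf x (\<lambda>i. m i - l i) =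
        (if l = (\<lambda>i. m i - k i) then cf y l * qp (form l k) * c else 0)"
      by (auto simp: assms(2))
  qed
  also have "\<dots> = c * qp (form (\<lambda>i. m i - k i) k) * cf y (\<lambda>i. m i - k i)"
    using finite_cf[OF assms(3)] by simp
  also have "form (\<lambda>i. m i - k i) k = form m k"
    using form_antisym[of "\<lambda>i. m i - k i" k] form_antisym[of m k] by (simp add: form_diff_right)
  finally show ?thesis .
qed

lemma monomial_mult:
  assumes "is_monomial x k" "is_monomial y l"
  shows "is_monomial (x \<otimes>\<^bsub>A\<^esub> y) (\<lambda>i. k i + l i)"
proof -
  obtain c d where cd: "x \<in> carrier A" "c dvd 1" "cf x = (\<lambda>l. if l = k then c else 0)"
    "y \<in> carrier A" "d dvd 1" "cf y = (\<lambda>m. if m = l then d else 0)"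
    using assms unfolding is_monomial_def by blast
  let ?e = "c * qp (form k (\<lambda>i. k i + l i)) * d"
  have "cf (x \<otimes>\<^bsub>A\<^esub> y) = (\<lambda>m. if m = (\<lambda>i. k i + l i) then ?e else 0)"
    by (rule ext) (simp add: cf_monomial_mult[OF cd(1,3,4)] cd(6) diff_eq_iff)
  moreover have "?e dvd 1"
    using mult_dvd_mono[OF mult_dvd_mono[OF cd(2) unit_powi_unit[OF q]] cd(5)] by simp
  ultimately show ?thesis unfolding is_monomial_def using cd by blast
qed

lemma monomial_sc: "c dvd 1 \<Longrightarrow> is_monomial (sc c) (\<lambda>i. 0)"
  unfolding is_monomial_def using cf_sc sc_closed by blast

lemma monomial_1: "is_monomial \<one>\<^bsub>A\<^esub> (\<lambda>i. 0)"
  using monomial_sc[of 1] by (simp add: sc_1)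

lemma monomial_nat_pow: "is_monomial x k \<Longrightarrow> is_monomial (x [^]\<^bsub>A\<^esub> (n::nat)) (\<lambda>i. int n * k i)"
proof (induction n)
  case (Suc n)
  from monomial_mult[OF Suc.IH Suc.prems] Suc.prems show ?case by (simp add: algebra_simps)
qed (simp add: monomial_1)

lemma monomial_inv:
  assumes x: "is_monomial x k" "x \<in> Units A"
  shows "is_monomial (inv\<^bsub>A\<^esub> x) (\<lambda>i. - k i)"
proof -
  obtain c where c: "c dvd 1" "cf x = (\<lambda>l. if l = k then c else 0)" "x \<in> carrier A"
    using x unfolding is_monomial_def by blast
  obtain d where d: "1 = c * d" using c(1) by (auto simp: dvd_def)
  let ?y = "inv\<^bsub>A\<^esub> x"
  have y: "?y \<in> carrier A" using x(2) by simp
  have "cf ?y l = (if l = (\<lambda>i. - k i) then d else 0)" for l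
  proof -
    \<comment> \<open>The product with the inverse is compared in degree \<open>l + k\<close>, where
      only the coefficient of the inverse in degree \<open>l\<close> occurs.\<close>
    have "cf \<one>\<^bsub>A\<^esub> (\<lambda>i. l i + k i) = c * qp (form k (\<lambda>i. l i + k i)) * cf ?y l"
      using cf_monomial_mult[OF c(3,2) y, of "\<lambda>i. l i + k i"] x(2) by simp
    then have *: "(if l = (\<lambda>i. - k i) then 1 else 0) = c * qp (form k l) * cf ?y l"
      using cf_sc[of 1] by (auto simp: sc_1 fun_eq_iff eq_neg_iff_add_eq_0 form_add_right)
    show ?thesis
    proof (cases "l = (\<lambda>i. - k i)")
      case True
      then have "c * cf ?y l = c * d" using * d by (simp add: form_minus_right)
      moreover have "c \<noteq> 0" using d by auto
      ultimately have "cf ?y l = d" by (metis mult_left_cancel)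
      then show ?thesis using True by simp
    next
      case False
      then show ?thesis using * d qp_nonzero[of "form k l"] by auto
    qed
  qed
  moreover have "d dvd 1" using d by (metis dvd_triv_right)
  ultimately show ?thesis unfolding is_monomial_def using y by (metis ext)
qed

lemma monomial_int_pow:
  assumes "is_monomial x k" "x \<in> Units A"
  shows "is_monomial (x [^]\<^bsub>A\<^esub> (z::int)) (\<lambda>i. z * k i)"
proof (cases "z < 0")
  case True
  have "is_monomial (inv\<^bsub>A\<^esub> (x [^]\<^bsub>A\<^esub> nat (- z))) (\<lambda>i. - (int (nat (- z)) * k i))"
    by (intro monomial_inv monomial_nat_pow assms A.Units_pow_closed)
  moreover have "x [^]\<^bsub>A\<^esub> z = inv\<^bsub>A\<^esub> (x [^]\<^bsub>A\<^esub> nat (- z))"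
    using True by (simp only: int_pow_def2 if_True)
  moreover have "- (int (nat (- z)) * k i) = z * k i" for i using True by simp
  ultimately show ?thesis by (simp only:)
next
  case False
  then have "x [^]\<^bsub>A\<^esub> z = x [^]\<^bsub>A\<^esub> nat z" by (simp only: int_pow_def2 if_False)
  moreover have "int (nat z) = z" using False by simp
  ultimately show ?thesis using monomial_nat_pow[OF assms(1), of "nat z"] by (simp only:)
qed

lemma monomial_list_prod:
  "(\<And>x. x \<in> set xs \<Longrightarrow> is_monomial (f x) (d x)) \<Longrightarrow> is_monomial (list_prod A (map f xs)) (\<lambda>i. \<Sum>x\<leftarrow>xs. d x i)"
  by (induction xs) (auto simp: list_prod_def monomial_1 intro: monomial_mult)

lemma monomial_gen:
  assumes "i \<in> I"
  shows "is_monomial (qt_gen q I P i) (delta i)" "qt_gen q I P i \<in> Units A"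
proof -
  have F: "letter (Gen i) \<in> carrier F" "letter (Gen_inv i) \<in> carrier F" using assms by (auto intro: F_single)
  have c: "coefs (letter (Gen i)) k = (if k = delta i then 1 else 0)" for k
    by (auto simp: letter_def coefs_single)
  show "is_monomial (qt_gen q I P i) (delta i)"
    unfolding is_monomial_def qt_gen_def using F(1) c by (auto simp: pr_closed cf_pr intro!: exI[of _ 1])
  have "letter (Gen i) * letter (Gen_inv i) - 1 \<in> J" "letter (Gen_inv i) * letter (Gen i) - 1 \<in> J"
    by (rule relators_J, use assms in \<open>auto simp: qt_relators_def\<close>)+
  then have "pr (letter (Gen i)) \<otimes>\<^bsub>A\<^esub> pr (letter (Gen_inv i)) = \<one>\<^bsub>A\<^esub>"
    "pr (letter (Gen_inv i)) \<otimes>\<^bsub>A\<^esub> pr (letter (Gen i)) = \<one>\<^bsub>A\<^esub>"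
    using F by (simp_all add: pr_mult[symmetric] pr_1[symmetric] pr_eq_iff F_closed F_single)
  then show "qt_gen q I P i \<in> Units A"
    unfolding qt_gen_def Units_def using F pr_closed by blast
qed

lemma monomial_qt_monomial:
  assumes "set vs = I" "distinct vs"
  shows "is_monomial (qt_monomial q vs P k) (\<lambda>i. if i \<in> I then k i else 0)"
proof -
  have "is_monomial (list_prod A (map (\<lambda>i. qt_gen q I P i [^]\<^bsub>A\<^esub> k i) vs)) (\<lambda>j. \<Sum>i\<leftarrow>vs. k i * delta i j)"
    using assms by (intro monomial_list_prod monomial_int_pow monomial_gen) auto
  from monomial_mult[OF monomial_sc[OF unit_powi_unit[OF q]] this]
  have "is_monomial (qt_monomial q vs P k) (\<lambda>j. 0 + (\<Sum>i\<leftarrow>vs. k i * delta i j))"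
    by (simp add: qt_monomial_def assms(1) Let_def)
  moreover have "(\<Sum>i\<leftarrow>vs. k i * delta i j) = (if j \<in> I then k j else 0)" for j
  proof -
    have "k i * delta i j = (if i = j then k j else 0)" for i by (simp add: delta_def)
    then have "(\<Sum>i\<in>I. k i * delta i j) = (if j \<in> I then k j else 0)" using finite_I by simp
    then show ?thesis using assms by (simp add: sum_list_distinct_conv_sum_set)
  qed
  ultimately show ?thesis by simp
qed

section \<open>Central exponents of a quantum torus\<close>

definition central_exp :: "nat \<Rightarrow> ('i \<Rightarrow> int) \<Rightarrow> bool" where
  "central_exp m k \<longleftrightarrow> (\<forall>j\<in>I. int m dvd (\<Sum>i\<in>I. k i * P i j))"

lemma form_eq_sum: "form k l = (\<Sum>j\<in>I. l j * (\<Sum>i\<in>I. k i * P i j))"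
  unfolding form_def by (subst sum.swap) (simp add: sum_distrib_left mult_ac)

text \<open>Exchanging the factors changes the coefficient in degree \<open>l\<close> by
  \<open>q\<close> to the power \<open>2 * form k l\<close>, which is 1 because \<open>m\<close>
  divides every column sum of \<open>k\<close>.\<close>

lemma monomial_center:
  assumes m: "primitive_root_of_unity m (q\<^sup>2)" and x: "is_monomial x k" and k: "central_exp m k"
  shows "x \<in> center A"
proof -
  obtain c where c: "cf x = (\<lambda>l. if l = k then c else 0)" "x \<in> carrier A"
    using x unfolding is_monomial_def by blast
  have "x \<otimes>\<^bsub>A\<^esub> y = y \<otimes>\<^bsub>A\<^esub> x" if y: "y \<in> carrier A" for y
  proof (rule cf_inj)
    have "qp (form k l) = qp (form l k)" for l
    proof -
      have "int m dvd form k l" unfolding form_eq_sum using k by (auto simp: central_exp_def intro!: dvd_sum)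
      then have "qp (2 * form k l) = 1" by (simp add: unit_powi_double_eq_1[OF q m])
      moreover have "qp (form k l) = qp (2 * form k l) * qp (form l k)"
        using form_antisym[of l k] by (simp flip: qp_add)
      ultimately show ?thesis by simp
    qed
    then show "cf (x \<otimes>\<^bsub>A\<^esub> y) = cf (y \<otimes>\<^bsub>A\<^esub> x)"
      by (intro ext) (simp add: cf_monomial_mult[OF c(2,1) y] cf_mult_monomial[OF c(2,1) y])
  qed (use y c in auto)
  then show ?thesis using c(2) by (simp add: center_def)
qed

text \<open>Multiplication by a generator only shifts degrees, so the condition of commuting with it
  splits into one condition for each coefficient of \<open>z\<close>.\<close>

lemma center_central_exp:
  assumes m: "primitive_root_of_unity m (q\<^sup>2)" and z: "z \<in> center A" and k: "cf z k \<noteq> 0"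
  shows "central_exp m k"
  unfolding central_exp_def
proof
  fix j assume j: "j \<in> I"
  \<comment> \<open>In degree \<open>k + delta j\<close> both products with the generator involve
    only the coefficient of \<open>z\<close> in degree \<open>k\<close>.\<close>
  let ?g = "qt_gen q I P j" and ?m = "\<lambda>i. k i + delta j i"
  obtain c where c: "c dvd 1" "cf ?g = (\<lambda>l. if l = delta j then c else 0)" "?g \<in> carrier A"
    using monomial_gen(1)[OF j] unfolding is_monomial_def by blast
  have zA: "z \<in> carrier A" and comm: "z \<otimes>\<^bsub>A\<^esub> ?g = ?g \<otimes>\<^bsub>A\<^esub> z"
    using z c(3) by (auto simp: center_def)
  have "c * qp (form ?m (delta j)) * cf z k = c * qp (form (delta j) ?m) * cf z k"
    using cf_monomial_mult[OF c(3,2) zA, of ?m, symmetric] cf_mult_monomial[OF c(3,2) zA, of ?m] comm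
    by (simp only: add_diff_cancel_right')
  moreover have "c \<noteq> 0" using c(1) by auto
  ultimately have "qp (form k (delta j)) = qp (form (delta j) k)"
    using k by (simp add: form_add_left form_add_right)
  moreover have "qp (2 * form k (delta j)) * qp (form (delta j) k) = qp (form k (delta j))"
    using form_antisym[of "delta j" k] by (simp flip: qp_add)
  ultimately have "qp (2 * form k (delta j)) = 1" using qp_nonzero[of "form (delta j) k"] by simp
  then show "int m dvd (\<Sum>i\<in>I. k i * P i j)"
    by (simp add: unit_powi_double_eq_1[OF q m] form_delta_right[OF j])
qed

lemma center_sc: "sc r \<in> center A"
  unfolding center_def using sc_closed sc_commute by auto

text \<open>This reduces the center to a statement about exponents: a central element is rebuilt
  from its finitely many coefficients once every central exponent has some monomial in the
  subalgebra.\<close>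

theorem center_eq_subalgebra:
  assumes m: "primitive_root_of_unity m (q\<^sup>2)"
    and H: "\<And>h. h \<in> H \<Longrightarrow> \<exists>k. is_monomial h k \<and> central_exp m k"
    and exps: "\<And>k. central_exp m k \<Longrightarrow> (\<forall>i. i \<notin> I \<longrightarrow> k i = 0) \<Longrightarrow> \<exists>y \<in> qt_subalgebra q I P H. is_monomial y k"
  shows "center A = qt_subalgebra q I P H"
proof
  let ?U = "qt_subalgebra q I P H"
  show "?U \<subseteq> center A"
  proof
    fix z assume "z \<in> ?U"
    then show "z \<in> center A"
      unfolding qt_subalgebra_def
    proof induction
      case (incl h)
      then show ?case using center_sc H monomial_center[OF m] by blast
    next
      case (eng_add x y)
      then show ?case by (simp add: center_def A.l_distr A.r_distr)
    next
      case (eng_mult x y)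
      then have xy: "x \<in> carrier A" "y \<in> carrier A" by (auto simp: center_def)
      have "(x \<otimes>\<^bsub>A\<^esub> y) \<otimes>\<^bsub>A\<^esub> z = z \<otimes>\<^bsub>A\<^esub> (x \<otimes>\<^bsub>A\<^esub> y)" if z: "z \<in> carrier A" for z
      proof -
        have "(x \<otimes>\<^bsub>A\<^esub> y) \<otimes>\<^bsub>A\<^esub> z = x \<otimes>\<^bsub>A\<^esub> (z \<otimes>\<^bsub>A\<^esub> y)"
          using eng_mult.IH(2) xy z by (simp add: center_def A.m_assoc)
        also have "\<dots> = (z \<otimes>\<^bsub>A\<^esub> x) \<otimes>\<^bsub>A\<^esub> y"
          using eng_mult.IH(1) xy z by (simp add: center_def A.m_assoc[symmetric])
        finally show ?thesis using xy z by (simp add: A.m_assoc)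
      qed
      then show ?case using xy by (simp add: center_def)
    qed (auto simp: center_def A.l_minus A.r_minus)
  qed
  show "center A \<subseteq> ?U"
  proof
    fix z assume z: "z \<in> center A"
    then have zA: "z \<in> carrier A" by (simp add: center_def)
    have scU: "sc r \<in> ?U" for r unfolding qt_subalgebra_def by (rule generate_ring.incl) auto
    have sums: "\<exists>b\<in>?U. b \<in> carrier A \<and> cf b = (\<lambda>k. if k \<in> D then f k else 0)"
      if "finite D" "\<And>k. k \<in> D \<Longrightarrow> \<exists>y\<in>?U. is_monomial y k" for D f
      using that
    proof (induction D rule: finite_induct)
      case empty
      show ?case using cf_sc[of 0] sc_closed scU[of 0] by (intro bexI[of _ "sc 0"]) auto
    next
      case (insert k D)
      obtain b where b: "b \<in> ?U" "b \<in> carrier A" "cf b = (\<lambda>k. if k \<in> D then f k else 0)"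
        using insert by blast
      obtain y c where y: "y \<in> ?U" "y \<in> carrier A" "c dvd 1" "cf y = (\<lambda>l. if l = k then c else 0)"
        using insert.prems unfolding is_monomial_def by blast
      obtain d where d: "1 = c * d" using y(3) by (auto simp: dvd_def)
      \<comment> \<open>The inverse \<open>d\<close> of the unit coefficient of \<open>y\<close>
        adjusts the coefficient to the prescribed one.\<close>
      let ?s = "sc (f k * d) \<otimes>\<^bsub>A\<^esub> y"
      have s: "?s \<in> ?U" "?s \<in> carrier A"
        using generate_ring.eng_mult[OF scU[unfolded qt_subalgebra_def] y(1)[unfolded qt_subalgebra_def]] sc_closed y(2)
        by (auto simp: qt_subalgebra_def)
      have "cf ?s l = (if l = k then f k else 0)" for l
        using cf_monomial_mult[OF sc_closed cf_sc y(2), of "f k * d" l] y(4) d by (simp add: mult.assoc mult.commute)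
      then have "cf (?s \<oplus>\<^bsub>A\<^esub> b) = (\<lambda>l. if l \<in> insert k D then f l else 0)"
        using insert.hyps(2) by (intro ext) (auto simp: cf_add[OF s(2) b(2)] b(3))
      moreover have "?s \<oplus>\<^bsub>A\<^esub> b \<in> ?U"
        using s(1) b(1) unfolding qt_subalgebra_def by (rule generate_ring.eng_add)
      ultimately show ?case using s(2) b(2) by blast
    qed
    have "\<exists>y\<in>?U. is_monomial y k" if "k \<in> {k. cf z k \<noteq> 0}" for k
      using that center_central_exp[OF m z] cf_support[OF zA] by (intro exps) auto
    then obtain b where b: "b \<in> ?U" "b \<in> carrier A" "cf b = (\<lambda>k. if k \<in> {k. cf z k \<noteq> 0} then cf z k else 0)"
      using sums[OF finite_cf[OF zA]] by blast
    have "cf b = cf z" unfolding b(3) by auto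
    then show "z \<in> ?U" using cf_inj[OF b(2) zA] b(1) by blast
  qed
qed

end

section \<open>The center\<close>

theorem theorem1:
  fixes T :: "'f triangulation"
    and q :: "'r::idom"
    and n m'' d' m' :: nat
    and vs :: "'f ext_vertex list"
  assumes "2 \<le> n"
    and "q dvd 1"
    and "primitive_root_of_unity m'' (q\<^sup>2)"
    and "d' = gcd n m''"
    and "m' = m'' div d'"
    and "ideal_triangulation T"
    and "essentially_bordered T"
    and "\<nexists>P. interior_puncture T P"
    and "set vs = V'_ext n T" and "distinct vs"
    and "odd m''"
  shows "center (A_alg q n T) =
    qt_subalgebra q (V'_ext n T) (P_mat n T)
      ({qt_monomial q vs (P_mat n T) k | k. k \<in> Lambda n T m'} \<union>
       {boundary_element q n T m' es i k | es i k.
          boundary_component T es \<and> even (length es) \<and> 1 \<le> i \<and> i \<le> n - 1 \<and> k \<le> m'})"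
proof -
  interpret bordered_root n T m' m''
    by unfold_locales (use assms(1,4-6,8,11) in blast)+
  interpret qtorus q "V'_ext n T" "P_mat n T"
    by unfold_locales (use assms(2) finite_V' P_mat_antisym in blast)+
  let ?H = "{qt_monomial q vs (P_mat n T) k | k. k \<in> Lambda n T m'} \<union>
       {boundary_element q n T m' es i k | es i k.
          boundary_component T es \<and> even (length es) \<and> 1 \<le> i \<and> i \<le> n - 1 \<and> k \<le> m'}"
  let ?U = "qt_subalgebra q (V'_ext n T) (P_mat n T) ?H"
  \<comment> \<open>Exponents in \<open>Lambda\<close> are arbitrary outside \<open>V'\<close>,
    while exponents of elements of the torus vanish there; truncation reconciles the two.\<close>
  let ?r = "\<lambda>k v. if v \<in> V' then k v else (0::int)"
  have exp: "central_exp m'' (?r k) \<longleftrightarrow> central m'' k" for k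
    unfolding central_exp_def central_def by (simp cong: sum.cong)
  have lam: "is_monomial (qt_monomial q vs (P_mat n T) k) (?r k)" for k
    by (rule monomial_qt_monomial[OF assms(9,10)])
  have bdry: "is_monomial (boundary_element q n T m' es i c) (?r (bexp m' es i c))"
    if es: "boundary_component T es" and i: "1 \<le> i" "i \<le> n - 1" for es i c
  proof -
    note es' = boundary_componentD[OF es]
    have V': "e3 (es ! j) (int i) \<in> V'" if "j < length es" for j
      using es' i n2 that by (intro e3_V') auto
    have av: "attached_vertex n T i (es ! j) = e3 (es ! j) (int i)" if "j < length es" for j
      using es' i n2 that by (intro attached_vertex_eq) auto
    have "is_monomial (boundary_element q n T m' es i c)
      (\<lambda>v. \<Sum>j\<leftarrow>[0..<length es]. int (if even j then c else m' - c) * delta (e3 (es ! j) (int i)) v)"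
      unfolding boundary_element_def A_alg_def A_gen_def
      using V' by (intro monomial_list_prod monomial_nat_pow) (auto simp: av intro: monomial_gen)
    moreover have "(\<Sum>j\<leftarrow>[0..<length es]. int (if even j then c else m' - c) * delta (e3 (es ! j) (int i)) v) =
      ?r (bexp m' es i c) v" for v
    proof -
      have summand: "int (if even j then c else m' - c) * delta (e3 (es ! j) (int i)) v =
          of_bool (v = e3 (es ! j) (int i)) * bcoef m' c j" for j
        by (simp add: bcoef_def delta_def)
      have "(\<Sum>j\<leftarrow>[0..<length es]. int (if even j then c else m' - c) * delta (e3 (es ! j) (int i)) v) = bexp m' es i c v"
        unfolding bexp_def summand by (simp add: sum_list_distinct_conv_sum_set atLeast0LessThan del: sum_of_bool_mult_eq)
      moreover have "bexp m' es i c v = 0" if "v \<notin> V'"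
        unfolding bexp_def using V' that by (intro sum.neutral) auto
      ultimately show ?thesis by simp
    qed
    ultimately show ?thesis by simp
  qed
  have "center (quantum_torus q (V'_ext n T) (P_mat n T)) = ?U"
  proof (rule center_eq_subalgebra[OF assms(3)])
    fix h assume "h \<in> ?H"
    then consider k where "h = qt_monomial q vs (P_mat n T) k" "k \<in> Lambda n T m'"
      | es i c where "h = boundary_element q n T m' es i c" "boundary_component T es" "even (length es)"
        "1 \<le> i" "i \<le> n - 1" "c \<le> m'"
      by blast
    then show "\<exists>k. is_monomial h k \<and> central_exp m'' k"
    proof cases
      case 1
      then show ?thesis using lam exp central_Lambda by blast
    next
      case 2
      then have "central m'' (bexp m' es i c)" using n2 by (intro central_bexp) auto
      then show ?thesis using bdry[OF 2(2,4,5)] exp 2(1) by blast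
    qed
  next
    fix k assume k: "central_exp m'' k" "\<forall>i. i \<notin> V' \<longrightarrow> k i = 0"
    have rk: "?r k = k" using k(2) by auto
    have "k \<in> central_exps m'" using central_imp_central_exps exp[of k] k(1) rk by simp
    then have "\<exists>y\<in>?U. is_monomial y (?r k)"
    proof induction
      case (Lambda k)
      then have "qt_monomial q vs (P_mat n T) k \<in> ?U"
        unfolding qt_subalgebra_def by (intro generate_ring.incl) blast
      then show ?case using lam by blast
    next
      case (boundary es i c)
      then have "boundary_element q n T m' es i c \<in> ?U"
        unfolding qt_subalgebra_def by (intro generate_ring.incl) blast
      then show ?case using bdry boundary by blast
    next
      case (add k l)
      then obtain x y where xy: "x \<in> ?U" "is_monomial x (?r k)" "y \<in> ?U" "is_monomial y (?r l)" by blast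
      have "x \<otimes>\<^bsub>A\<^esub> y \<in> ?U" using xy unfolding qt_subalgebra_def by (intro generate_ring.eng_mult)
      moreover have "(\<lambda>v. ?r k v + ?r l v) = ?r (\<lambda>v. k v + l v)" by auto
      ultimately show ?case using monomial_mult[OF xy(2,4)] by (metis (no_types, lifting))
    qed
    then show "\<exists>y\<in>?U. is_monomial y k" unfolding rk .
  qed
  then show ?thesis by (simp add: A_alg_def)
qed

end
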